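(* Let $n\ge2$ and $p>1$. There exists a constant $\tilde c_{n,p}$, depending only on $n$ and $p$, such that for every $K\in\mathcal{K}_o^n$ and every $u\in\mathbb{S}^{n-1}$, $$\mathrm{Vol}_n(\Pi_p^{\ast}K)=\tilde c_{n,p}\,\mu_{n-1,u}\bigl(L_{n-1,u,p}(K)\bigr)=\tilde c_{n,p}\int_{G_{u^\perp,n-2}}\int_{\mathbb{R}}|s|^{n-2}\,|L_{E,p,u,s}(K)|\,ds\,\sigma_{u^\perp,n-2}(dE).$$
   Context: $\mathcal{K}_o^n$ is the set of convex bodies (compact convex sets with nonempty interior) in $\mathbb{R}^n$ containing the origin in their interiors; $h_K$ is the support function and $S(K,\cdot)$ the surface area measure. With $\omega_r=\pi^{r/2}/\Gamma(1+r/2)$ and $c_{n,p}=\omega_{n+p}/(\omega_2\omega_n\omega_{p-1})$, the $L_p$-projection body $\Pi_pK$ has support function $h_{\Pi_pK}(v)=\left(\frac{1}{n\omega_nc_{n-2,p}}\int_{\mathbb{S}^{n-1}}|\langle v,\theta\rangle|^p h_K(\theta)^{1-p}\,dS(K,\theta)\right)^{1/p}$, and $\Pi_p^{\ast}K=(\Pi_pK)^{\ast}$ is its polar body. For an $(n-2)$-dimensional linear subspace $E$ and $x\in\mathbb{R}^n$ define $$|P_{E\wedge x,p}K|=\|P_{E^\perp}x\|\left(\int_{\mathbb{S}^{n-1}}|\langle v(E,x),\theta\rangle|^p h_K(\theta)^{1-p}\,dS(K,\theta)\right)^{1/p},$$ where $P_{E^\perp}$ is orthogonal projection onto $E^\perp$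 and $v(E,x)$ is a unit vector orthogonal to $\mathrm{span}\{E,x\}$ (the value is $0$ if $x\in E$). Put $L_{E,p}(K)=\{x\in E^\perp: |P_{E\wedge x,p}K|\le1\}$. $G_{u^\perp,n-2}$ is the Grassmannian of $(n-2)$-dimensional linear subspaces of $u^\perp$ and $\sigma_{u^\perp,n-2}$ its uniform Haar probability measure. For $E\in G_{u^\perp,n-2}$ and $s\in\mathbb{R}$, $L_{E,p,u,s}(K)=\{y\in E^\perp\cap u^\perp: |P_{E\wedge(y+su),p}K|\le1\}$, and $|L_{E,p,u,s}(K)|$ is its length (one-dimensional Lebesgue measure in the line $E^\perp\cap u^\perp$). Let $V_{n-1,u}=\{(E,x):E\in G_{u^\perp,n-2},\ x\in E^\perp\}$, equipped with the Borel measure $\mu_{n-1,u}(dE,dx)=|\langle x,u\rangle|^{n-2}\,\mathcal{L}_{E^\perp}(dx)\,\sigma_{u^\perp,n-2}(dE)$, where $\mathcal{L}_{E^\perp}$ is Lebesgue measure on the plane $E^\perp$. The $L_p$-Projection Rolodex of $K$ relative to $u^\perp$ is $L_{n-1,u,p}(K)=\{(E,x): E\in G_{u^\perp,n-2},\ x\in L_{E,p}(K)\}\subset V_{n-1,u}$. *)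

theory Defs
  imports "HOL-Analysis.Analysis"
begin

section \<open>Convex bodies\<close>

definition convex_bodies_o :: "'a::euclidean_space set set" where
  "convex_bodies_o = {K. compact K \<and> convex K \<and> interior K \<noteq> {} \<and> 0 \<in> interior K}"

definition support_function :: "'a::euclidean_space set \<Rightarrow> 'a \<Rightarrow> real" where
  "support_function K v = (SUP x\<in>K. x \<bullet> v)"

definition polar_body :: "'a::euclidean_space set \<Rightarrow> 'a set" where
  "polar_body K = {x. \<forall>y\<in>K. x \<bullet> y \<le> 1}"


section \<open>Surface area measure\<close>

text \<open>
  The \<open>m\<close>-dimensional Hausdorff outer measure (for \<open>m \<ge> 1\<close>), normalised so that it agrees with
  Lebesgue measure in dimension \<open>m\<close>.  Boundedness of the covering sets is required explicitly
  because \<^const>\<open>diameter\<close> is only meaningful for bounded sets.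
\<close>

definition hausdorff_pre :: "nat \<Rightarrow> real \<Rightarrow> 'a::metric_space set \<Rightarrow> ennreal" where
  "hausdorff_pre m \<delta> A =
     (INF C \<in> {C :: nat \<Rightarrow> 'a set. A \<subseteq> (\<Union>i. C i) \<and> (\<forall>i. bounded (C i) \<and> diameter (C i) \<le> \<delta>)}.
        \<Sum>i. ennreal (unit_ball_vol (real m) * (diameter (C i) / 2) ^ m))"

definition hausdorff_outer :: "nat \<Rightarrow> 'a::metric_space set \<Rightarrow> ennreal" where
  "hausdorff_outer m A = (SUP \<delta> \<in> {0<..}. hausdorff_pre m \<delta> A)"

text \<open>The boundary points of \<open>K\<close> having an outer unit normal in \<open>\<omega>\<close>.\<close>

definition reverse_spherical_image :: "'a::euclidean_space set \<Rightarrow> 'a set \<Rightarrow> 'a set" where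
  "reverse_spherical_image K \<omega> =
     {x \<in> frontier K. \<exists>v\<in>\<omega>. norm v = 1 \<and> (\<forall>y\<in>K. y \<bullet> v \<le> x \<bullet> v)}"

text \<open>
  \<open>S(K, \<omega>)\<close> is the \<open>(n-1)\<close>-dimensional Hausdorff measure of the reverse spherical image of \<open>\<omega>\<close>,
  as a Borel measure on the unit sphere.
\<close>

definition surface_area_measure :: "'a::euclidean_space set \<Rightarrow> 'a measure" where
  "surface_area_measure K =
     measure_of (sphere 0 1) (sets (restrict_space borel (sphere 0 1)))
       (\<lambda>\<omega>. hausdorff_outer (DIM('a) - 1) (reverse_spherical_image K \<omega>))"


section \<open>The \<open>L\<^sub>p\<close>-projection body\<close>

text \<open>The library's \<^const>\<open>unit_ball_vol\<close> is \<open>\<omega>\<^sub>r\<close>, for real \<open>r\<close>.\<close>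

definition c_const :: "real \<Rightarrow> real \<Rightarrow> real" where
  "c_const n p =
     unit_ball_vol (n + p) / (unit_ball_vol 2 * unit_ball_vol n * unit_ball_vol (p - 1))"

definition lp_projection_integral :: "real \<Rightarrow> 'a::euclidean_space set \<Rightarrow> 'a \<Rightarrow> real" where
  "lp_projection_integral p K v =
     (LINT \<theta>|surface_area_measure K. \<bar>v \<bullet> \<theta>\<bar> powr p * support_function K \<theta> powr (1 - p))"

text \<open>
  \<open>\<Pi>\<^sub>p K\<close> is specified by its support function; a nonempty compact convex set is determined by
  the values of its support function on the sphere.
\<close>

definition lp_projection_body :: "real \<Rightarrow> 'a::euclidean_space set \<Rightarrow> 'a set" where
  "lp_projection_body p K =
     (THE L. compact L \<and> convex L \<and> L \<noteq> {} \<and>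
        (\<forall>v\<in>sphere 0 1. support_function L v =
           (1 / (real DIM('a) * unit_ball_vol (real DIM('a)) * c_const (real DIM('a) - 2) p)
              * lp_projection_integral p K v) powr (1 / p)))"

definition lp_polar_projection_body :: "real \<Rightarrow> 'a::euclidean_space set \<Rightarrow> 'a set" where
  "lp_polar_projection_body p K = polar_body (lp_projection_body p K)"


section \<open>Grassmannians and measures on subspaces\<close>

definition orth_proj :: "'a::euclidean_space set \<Rightarrow> 'a \<Rightarrow> 'a" where
  "orth_proj F x = (THE y. y \<in> F \<and> x - y \<in> F\<^sup>\<bottom>)"

definition grassmannian :: "'a::euclidean_space set \<Rightarrow> nat \<Rightarrow> 'a set set" where
  "grassmannian W k = {E. subspace E \<and> E \<subseteq> W \<and> dim E = k}"

text \<open>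
  The Borel sets of the Grassmannian, whose topology is the one induced by identifying a subspace
  with the orthogonal projection onto it (a bounded linear operator).
\<close>

definition grassmannian_borel :: "'a::euclidean_space set \<Rightarrow> nat \<Rightarrow> 'a set measure" where
  "grassmannian_borel W k =
     vimage_algebra (grassmannian W k) (\<lambda>E. Blinfun (orth_proj E)) borel"

text \<open>
  The Haar probability measure: the unique Borel probability measure invariant under the
  orthogonal group of \<open>W\<close>.  Every orthogonal map of \<open>W\<close> is the restriction of an orthogonal map of
  the ambient space that preserves \<open>W\<close>.
\<close>

definition grassmannian_haar :: "'a::euclidean_space set \<Rightarrow> nat \<Rightarrow> 'a set measure" where
  "grassmannian_haar W k =
     (THE \<sigma>. sets \<sigma> = sets (grassmannian_borel W k) \<and> emeasure \<sigma> (space \<sigma>) = 1 \<and>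
        (\<forall>f. orthogonal_transformation f \<and> f ` W = W \<longrightarrow>
           (\<forall>A\<in>sets \<sigma>. emeasure \<sigma> ((\<lambda>E. f ` E) ` A) = emeasure \<sigma> A)))"

text \<open>
  Lebesgue measure of the dimension of \<open>W\<close> on a linear subspace \<open>W\<close>, regarded as a measure on the
  ambient space concentrated on \<open>W\<close>: the product of one-dimensional Lebesgue measures in
  the coordinates of an orthonormal basis (the choice of the basis is irrelevant).
\<close>

definition subspace_lebesgue :: "'a::euclidean_space set \<Rightarrow> 'a measure" where
  "subspace_lebesgue W =
     (let B = (SOME B. pairwise orthogonal B \<and> (\<forall>b\<in>B. norm b = 1) \<and> span B = W)
      in distr (\<Pi>\<^sub>M b\<in>B. (lborel :: real measure)) borel (\<lambda>c. \<Sum>b\<in>B. c b *\<^sub>R b))"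


section \<open>The \<open>L\<^sub>p\<close>-projection Rolodex\<close>

text \<open>
  For \<open>E\<close> of dimension \<open>n - 2\<close> and \<open>x \<notin> E\<close> the vector is unique up to sign, which does not affect
  \<open>wedge_projection\<close>; for \<open>x \<in> E\<close> the factor \<open>norm (orth_proj (E\<^sup>\<bottom>) x)\<close> there vanishes.
\<close>

definition wedge_normal :: "'a::euclidean_space set \<Rightarrow> 'a \<Rightarrow> 'a" where
  "wedge_normal E x = (SOME v. norm v = 1 \<and> v \<in> (span (insert x E))\<^sup>\<bottom>)"

definition wedge_projection ::
    "real \<Rightarrow> 'a::euclidean_space set \<Rightarrow> 'a set \<Rightarrow> 'a \<Rightarrow> real" where
  "wedge_projection p K E x =
     norm (orth_proj (E\<^sup>\<bottom>) x) * lp_projection_integral p K (wedge_normal E x) powr (1 / p)"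

definition L_body :: "real \<Rightarrow> 'a::euclidean_space set \<Rightarrow> 'a set \<Rightarrow> 'a set" where
  "L_body p K E = {x \<in> E\<^sup>\<bottom>. wedge_projection p K E x \<le> 1}"

definition L_slice ::
    "real \<Rightarrow> 'a::euclidean_space set \<Rightarrow> 'a set \<Rightarrow> 'a \<Rightarrow> real \<Rightarrow> 'a set" where
  "L_slice p K E u s = {y \<in> E\<^sup>\<bottom> \<inter> {u}\<^sup>\<bottom>. wedge_projection p K E (y + s *\<^sub>R u) \<le> 1}"

definition rolodex_space :: "'a::euclidean_space \<Rightarrow> ('a set \<times> 'a) set" where
  "rolodex_space u = {(E, x). E \<in> grassmannian ({u}\<^sup>\<bottom>) (DIM('a) - 2) \<and> x \<in> E\<^sup>\<bottom>}"

definition rolodex_measure :: "'a::euclidean_space \<Rightarrow> ('a set \<times> 'a) measure" where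
  "rolodex_measure u =
     measure_of (rolodex_space u)
       (sets (restrict_space
          (grassmannian_borel ({u}\<^sup>\<bottom>) (DIM('a) - 2) \<Otimes>\<^sub>M borel) (rolodex_space u)))
       (\<lambda>A. \<integral>\<^sup>+E. (\<integral>\<^sup>+x. ennreal (\<bar>x \<bullet> u\<bar> ^ (DIM('a) - 2)) * indicator A (E, x)
                    \<partial>subspace_lebesgue (E\<^sup>\<bottom>))
              \<partial>grassmannian_haar ({u}\<^sup>\<bottom>) (DIM('a) - 2))"

definition lp_rolodex ::
    "real \<Rightarrow> 'a::euclidean_space set \<Rightarrow> 'a \<Rightarrow> ('a set \<times> 'a) set" where
  "lp_rolodex p K u =
     {(E, x). E \<in> grassmannian ({u}\<^sup>\<bottom>) (DIM('a) - 2) \<and> x \<in> L_body p K E}"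

end

theory Submission
  imports Defs
begin

text \<open>
  Write \<open>g v = (\<integral> \<bar>\<langle>v, \<theta>\<rangle>\<bar>\<^sup>p h\<^sub>K(\<theta>)\<^bsup>1-p\<^esup> dS(K, \<theta>))\<^bsup>1/p\<^esup>\<close>.  Up to a constant dilation, \<open>\<Pi>\<^sub>p\<^sup>*K\<close> is the unit
  ball of \<open>g\<close>.  A subspace \<open>E\<close> of dimension \<open>n - 2\<close> in \<open>u\<^sup>\<bottom>\<close> has the form \<open>{u, w}\<^sup>\<bottom>\<close> with a unit vector
  \<open>w \<in> u\<^sup>\<bottom>\<close> that is unique up to sign, and \<open>\<bar>P\<^bsub>E\<and>x,p\<^esub>K\<bar>\<close> at \<open>x = s u + t w\<close> equals \<open>g (s w - t u)\<close>, the value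
  of \<open>g\<close> at \<open>x\<close> turned by a right angle.  So both right-hand sides integrate \<open>\<bar>s\<bar>\<^bsup>n-2\<^esup>\<close> over the section of
  \<open>{g \<le> 1}\<close> by the plane \<open>span {u, w}\<close> and average over \<open>w\<close>, where \<open>s\<close> is the coordinate along \<open>w\<close>; this is
  the volume in cylindrical coordinates about the axis \<open>u\<close>.  About the surface area measure only its
  finiteness matters.
\<close>

section \<open>Gauges and polar bodies\<close>

text \<open>Several objects of the statement are descriptions that would be arbitrary if existence
  or uniqueness failed: the projection body and the Haar measure come from \<open>THE\<close>, bases
  of subspaces and normals from \<open>SOME\<close>, the rolodex measure from
  \<open>measure_of\<close>. Much of the work shows that these have the intended value. For the Haar
  measure both existence and uniqueness are proved: it is the distribution of
  \<open>hyp u w\<close>, where \<open>w\<close> is the direction orthogonal to \<open>u\<close> of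
  a uniformly random point of a bounded solid of revolution about \<open>u\<close>. The same solid
  appears in the cylindrical coordinates, so that no measure on the sphere enters. The constant is
  \<open>V / (R * \<kappa>)\<close>: \<open>V\<close> is the volume of that solid, \<open>R\<close>
  the integral of a radial weight, \<open>\<kappa>\<close> the volume factor of the dilation between
  the polar body and the unit ball of \<open>g\<close>. Only \<open>V\<close> could depend on
  \<open>u\<close>, and rotation invariance excludes it. All identities are equations in
  \<open>ennreal\<close>, so they also cover a \<open>g\<close> that vanishes in some
  direction.\<close>

lemma compact_image_inner_bdd:
  fixes L :: "'a::euclidean_space set"
  assumes "compact L"
  shows "bdd_above ((\<lambda>x. x \<bullet> v) ` L)"
  by (intro bounded_imp_bdd_above compact_imp_bounded compact_continuous_image assms continuous_intros)

lemma support_function_ge: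
  assumes "compact L" "x \<in> L"
  shows "x \<bullet> v \<le> support_function L v"
  unfolding support_function_def
  by (rule cSUP_upper[OF assms(2) compact_image_inner_bdd[OF assms(1)]])

lemma polar_body_support_function:
  fixes L :: "'a::euclidean_space set"
  assumes "compact L" "L \<noteq> {}"
  shows "polar_body L = {x. support_function L x \<le> 1}"
proof -
  have "support_function L x \<le> 1 \<longleftrightarrow> (\<forall>y\<in>L. y \<bullet> x \<le> 1)" for x
    unfolding support_function_def
    by (rule cSUP_le_iff[OF assms(2) compact_image_inner_bdd[OF assms(1)]])
  then show ?thesis by (simp add: polar_body_def inner_commute)
qed

text \<open>A point of \<open>L\<close> outside \<open>L'\<close> is cut off from \<open>L'\<close>
  by a hyperplane, and the unit normal is a direction in which the support functions differ. Applied
  both ways, this is the uniqueness behind the \<open>THE\<close> in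
  \<open>lp_projection_body\<close>.\<close>

lemma support_function_subset:
  fixes L L' :: "'a::euclidean_space set"
  assumes "compact L" and L': "compact L'" "convex L'" "L' \<noteq> {}"
    and eq: "\<And>v. norm v = 1 \<Longrightarrow> support_function L v = support_function L' v"
  shows "L \<subseteq> L'"
proof
  fix x assume x: "x \<in> L"
  show "x \<in> L'"
  proof (rule ccontr)
    assume "x \<notin> L'"
    then obtain a b where ab: "a \<bullet> x < b" "\<And>y. y \<in> L' \<Longrightarrow> b < a \<bullet> y"
      using separating_hyperplane_closed_point[of L' x] L' compact_imp_closed by blast
    have "a \<noteq> 0" using ab L'(3) by force
    \<comment> \<open>The separation puts \<open>L'\<close> on the upper side of the hyperplane, so
      the direction pointing out of \<open>L'\<close> is minus its normal.\<close>
    define v where "v = - (a /\<^sub>R norm a)"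
    have v: "norm v = 1" using \<open>a \<noteq> 0\<close> by (simp add: v_def)
    have iv: "y \<bullet> v = - (a \<bullet> y) / norm a" for y
      by (simp add: v_def inner_commute divide_inverse)
    have "support_function L' v \<le> - b / norm a"
      unfolding support_function_def
      using L'(3) ab(2) \<open>a \<noteq> 0\<close> by (intro cSUP_least) (auto simp: iv divide_le_cancel less_imp_le)
    also have "\<dots> < x \<bullet> v" using ab(1) \<open>a \<noteq> 0\<close> by (simp add: iv divide_strict_right_mono)
    also have "\<dots> \<le> support_function L v" by (rule support_function_ge[OF assms(1) x])
    finally show False using eq[OF v] by simp
  qed
qed

text \<open>This is the bipolar theorem for \<open>B = {x. g x \<le> 1}\<close>. The polar of
  \<open>B\<close> is bounded because \<open>B\<close> is a neighbourhood of 0; as \<open>g\<close>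
  may vanish off 0, \<open>B\<close> itself may be unbounded. It supplies the existence behind the
  \<open>THE\<close> in \<open>lp_projection_body\<close>.\<close>

lemma support_function_polar_gauge:
  fixes g :: "'a::euclidean_space \<Rightarrow> real"
  assumes nn: "\<And>x. 0 \<le> g x" and cont: "continuous_on UNIV g"
    and hom: "\<And>c x. 0 \<le> c \<Longrightarrow> g (c *\<^sub>R x) = c * g x"
    and conv: "convex {x. g x \<le> 1}"
  defines "L \<equiv> polar_body {x. g x \<le> 1}"
  shows "compact L" "convex L" "L \<noteq> {}" "\<And>v. support_function L v = g v"
proof -
  let ?B = "{x. g x \<le> 1}"
  have Leq: "L = (\<Inter>y\<in>?B. {x. y \<bullet> x \<le> 1})"
    by (auto simp: L_def polar_body_def inner_commute)
  have g0: "g 0 = 0" using hom[of 0 0] by simp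
  have L0: "0 \<in> L" by (simp add: L_def polar_body_def)
  then show ne: "L \<noteq> {}" by blast
  have "closed L" unfolding Leq by (auto intro: closed_halfspace_le)
  show "convex L" unfolding Leq by (auto intro!: convex_INT convex_halfspace_le)
  have cB: "closed ?B"
    using continuous_closed_preimage[OF cont closed_UNIV, of "{..1}"]
    by (simp add: vimage_def)
  have "isCont g 0" using cont by (simp add: continuous_on_eq_continuous_at)
  then obtain r where r: "r > 0" "\<And>x. norm x < r \<Longrightarrow> g x < 1"
    unfolding continuous_at_eps_delta using g0 nn
    by (metis abs_of_nonneg diff_zero dist_0_norm dist_commute dist_real_def zero_less_one)
  have "norm y \<le> 2 / r" if y: "y \<in> L" for y
  proof (cases "y = 0")
    case False
    let ?x = "(r / 2 / norm y) *\<^sub>R y"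
    have "norm ?x < r" using r False by simp
    then have "g ?x \<le> 1" using r(2) less_imp_le by blast
    then have "y \<bullet> ?x \<le> 1" using y unfolding L_def polar_body_def by blast
    moreover have "y \<bullet> ?x = r / 2 * norm y"
      using False by (simp add: dot_square_norm power2_eq_square)
    ultimately have "r / 2 * norm y \<le> 1" by linarith
    then show ?thesis using r by (simp add: field_simps)
  qed (use r in auto)
  then have "bounded L" unfolding bounded_iff by blast
  with \<open>closed L\<close> show comp: "compact L" by (simp add: compact_eq_bounded_closed)
  fix v
  have sf0: "0 \<le> support_function L v" using support_function_ge[OF comp L0, of v] by simp
  show "support_function L v = g v"
  proof (rule antisym)
    show "support_function L v \<le> g v"
      unfolding support_function_def
    proof (intro cSUP_least ne)
      fix y assume y: "y \<in> L"
      have scaled: "t * (y \<bullet> v) \<le> 1" if "0 \<le> t" "t * g v \<le> 1" for t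
      proof -
        have "t *\<^sub>R v \<in> {x. g x \<le> 1}" using that hom by simp
        then have "y \<bullet> (t *\<^sub>R v) \<le> 1" using y unfolding L_def polar_body_def by blast
        then show ?thesis by simp
      qed
      show "y \<bullet> v \<le> g v"
      proof (cases "g v = 0")
        case True
        show ?thesis
        proof (rule ccontr)
          assume "\<not> y \<bullet> v \<le> g v"
          then show False using scaled[of "2 / (y \<bullet> v)"] True by simp
        qed
      next
        case False
        then have "g v > 0" using nn[of v] by simp
        then show ?thesis using scaled[of "1 / g v"] by (simp add: field_simps)
      qed
    qed
    show "g v \<le> support_function L v"
    proof (rule ccontr)
      assume "\<not> ?thesis"
      \<comment> \<open>For such \<open>t\<close> the point \<open>v / t\<close> lies outside
        \<open>B\<close> and can be separated from it.\<close>
      then obtain t where t: "support_function L v < t" "t < g v" using dense by (meson not_le)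
      have "t > 0" using t sf0 by simp
      have "g ((1/t) *\<^sub>R v) > 1" using t \<open>t > 0\<close> by (simp add: hom less_divide_eq)
      then obtain a b where ab: "a \<bullet> ((1/t) *\<^sub>R v) < b" "\<And>y. y \<in> ?B \<Longrightarrow> b < a \<bullet> y"
        using separating_hyperplane_closed_point[OF conv cB, of "(1/t) *\<^sub>R v"] by force
      have b: "b < 0" using ab(2)[of 0] g0 by simp
      \<comment> \<open>As \<open>b\<close> is negative, dividing by it turns
        \<open>b < a \<bullet> y\<close> on \<open>B\<close> into the defining inequality of the
        polar.\<close>
      have "(1 / b) *\<^sub>R a \<in> L"
        using ab(2) b by (auto simp: L_def polar_body_def field_simps less_imp_le)
      from support_function_ge[OF comp this, of v] have "(1/b) * (a \<bullet> v) \<le> support_function L v" by simp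
      moreover have "(1/b) * (a \<bullet> v) > t" using ab(1) b \<open>t > 0\<close> by (simp add: field_simps)
      ultimately show False using t by simp
    qed
  qed
qed

section \<open>Convexity and homogeneity of the integral behind the projection body\<close>

lemma abs_powr_convex:
  assumes p: "1 < (p::real)" and "0 \<le> a" "0 \<le> b" "a + b = 1"
  shows "\<bar>a * x + b * y\<bar> powr p \<le> a * \<bar>x\<bar> powr p + b * \<bar>y\<bar> powr p"
proof -
  \<comment> \<open>This serves the case that \<open>x\<close> or \<open>y\<close> is 0, where a
    coefficient itself is raised to the power \<open>p\<close>.\<close>
  have le1: "c powr p \<le> c" if "0 \<le> c" "c \<le> 1" for c
    using that powr_mono'[of 1 p c] p by (cases "c = 0") auto
  have "\<bar>a * x + b * y\<bar> powr p \<le> (a * \<bar>x\<bar> + b * \<bar>y\<bar>) powr p"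
    using assms by (intro powr_mono2) (auto intro!: order_trans[OF abs_triangle_ineq] simp: abs_mult)
  also have "\<dots> \<le> a * \<bar>x\<bar> powr p + b * \<bar>y\<bar> powr p"
  proof (cases "x = 0 \<or> y = 0")
    case True
    then show ?thesis
      using assms le1[of a] le1[of b] by (auto simp: powr_mult mult_right_mono)
  next
    case False
    then show ?thesis
      using convex_onD[OF powr_convex[of p], of b "\<bar>x\<bar>" "\<bar>y\<bar>"] assms
      by (simp add: eq_diff_eq[symmetric])
  qed
  finally show ?thesis .
qed

text \<open>Finiteness of \<open>M\<close> and the bound on \<open>k\<close> make every integrand
  integrable; otherwise the Bochner integral would default to 0 and the monotonicity step for
  convexity would break down. Convexity then passes from the integrand to \<open>I\<close>, and it
  will also yield continuity and hence measurability.\<close>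

lemma
  fixes M :: "'a::euclidean_space measure" and k :: "'a \<Rightarrow> real"
  assumes fin: "finite_measure M" and sp: "space M = sphere 0 1"
    and id[measurable]: "(\<lambda>x. x) \<in> M \<rightarrow>\<^sub>M borel"
    and k[measurable]: "k \<in> borel_measurable M"
    and bd: "\<And>\<theta>. \<theta> \<in> space M \<Longrightarrow> 0 \<le> k \<theta> \<and> k \<theta> \<le> C"
    and p: "1 < p"
  defines "I \<equiv> \<lambda>v. LINT \<theta>|M. \<bar>v \<bullet> \<theta>\<bar> powr p * k \<theta>"
  shows lp_integral_nonneg: "\<And>v. 0 \<le> I v"
    and lp_integral_scaleR: "\<And>c v. I (c *\<^sub>R v) = \<bar>c\<bar> powr p * I v"
    and lp_integral_convex: "convex_on UNIV I"
proof -
  interpret finite_measure M by fact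
  show "0 \<le> I v" for v unfolding I_def by (intro integral_nonneg_AE AE_I2) (use bd in auto)
  show "I (c *\<^sub>R v) = \<bar>c\<bar> powr p * I v" for c v
    unfolding I_def by (simp add: abs_mult powr_mult mult.assoc)
  have int: "integrable M (\<lambda>\<theta>. \<bar>v \<bullet> \<theta>\<bar> powr p * k \<theta>)" for v
  proof (rule integrable_const_bound[where B = "norm v powr p * C"])
    show "AE \<theta> in M. norm (\<bar>v \<bullet> \<theta>\<bar> powr p * k \<theta>) \<le> norm v powr p * C"
    proof (rule AE_I2)
      fix \<theta> assume \<theta>: "\<theta> \<in> space M"
      then have "\<bar>v \<bullet> \<theta>\<bar> \<le> norm v" using Cauchy_Schwarz_ineq2[of v \<theta>] sp by simp
      then have "\<bar>v \<bullet> \<theta>\<bar> powr p \<le> norm v powr p" using p by (intro powr_mono2) auto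
      then show "norm (\<bar>v \<bullet> \<theta>\<bar> powr p * k \<theta>) \<le> norm v powr p * C"
        using bd[OF \<theta>] by (auto simp: abs_mult intro!: mult_mono)
    qed
  qed measurable
  show "convex_on UNIV I"
  proof (rule convex_onI)
    fix t x y assume t: "(0::real) < t" "t < 1"
    have "I ((1 - t) *\<^sub>R x + t *\<^sub>R y) \<le>
        (LINT \<theta>|M. (1 - t) * (\<bar>x \<bullet> \<theta>\<bar> powr p * k \<theta>) + t * (\<bar>y \<bullet> \<theta>\<bar> powr p * k \<theta>))"
      unfolding I_def
    proof (intro integral_mono int Bochner_Integration.integrable_add integrable_mult_right)
      fix \<theta> assume \<theta>: "\<theta> \<in> space M"
      have "\<bar>((1 - t) *\<^sub>R x + t *\<^sub>R y) \<bullet> \<theta>\<bar> powr p * k \<theta> \<le>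
          ((1 - t) * \<bar>x \<bullet> \<theta>\<bar> powr p + t * \<bar>y \<bullet> \<theta>\<bar> powr p) * k \<theta>"
        using abs_powr_convex[OF p, of "1-t" t "x \<bullet> \<theta>" "y \<bullet> \<theta>"] t bd[OF \<theta>]
        by (intro mult_right_mono) (auto simp: inner_add_left)
      then show "\<bar>((1 - t) *\<^sub>R x + t *\<^sub>R y) \<bullet> \<theta>\<bar> powr p * k \<theta> \<le>
          (1 - t) * (\<bar>x \<bullet> \<theta>\<bar> powr p * k \<theta>) + t * (\<bar>y \<bullet> \<theta>\<bar> powr p * k \<theta>)"
        by (simp add: algebra_simps)
    qed
    also have "\<dots> = (1 - t) * I x + t * I y"
      unfolding I_def using int by simp
    finally show "I ((1 - t) *\<^sub>R x + t *\<^sub>R y) \<le> (1 - t) * I x + t * I y" .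
  qed simp
qed

text \<open>Convexity of the unit sublevel set replaces Minkowski's inequality.\<close>

lemma polar_body_of_lp_gauge:
  fixes I :: "'a::euclidean_space \<Rightarrow> real"
  assumes nn: "\<And>v. 0 \<le> I v" and hom: "\<And>c v. I (c *\<^sub>R v) = \<bar>c\<bar> powr p * I v"
    and conv: "convex_on UNIV I" and p: "1 < p" and d: "0 < d"
  shows "polar_body (THE L. compact L \<and> convex L \<and> L \<noteq> {} \<and>
           (\<forall>v\<in>sphere 0 1. support_function L v = (d * I v) powr (1 / p))) =
         {x. (d * I x) powr (1 / p) \<le> 1}"
proof -
  let ?g = "\<lambda>v. (d * I v) powr (1 / p)"
  define L where "L = polar_body {x. ?g x \<le> 1}"
  have cI: "continuous_on UNIV I" by (rule convex_on_continuous[OF open_UNIV conv])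
  have le1: "?g v \<le> 1 \<longleftrightarrow> d * I v \<le> 1" for v
  proof
    assume "?g v \<le> 1"
    moreover have "1 powr (1 / p) < ?g v" if "1 < d * I v"
      using that p by (intro powr_less_mono2) auto
    ultimately show "d * I v \<le> 1" by (cases "d * I v \<le> 1") auto
  next
    assume "d * I v \<le> 1"
    then show "?g v \<le> 1"
      using nn[of v] d p by (intro powr_le1) auto
  qed
  have "convex {x. d * I x \<le> 1}"
  proof (rule convexI, clarsimp)
    fix x y :: 'a and u v :: real
    assume *: "d * I x \<le> 1" "d * I y \<le> 1" "0 \<le> u" "0 \<le> v" "u + v = 1"
    have "I (u *\<^sub>R x + v *\<^sub>R y) \<le> u * I x + v * I y"
      using conv * by (simp add: convex_on_def)
    then have "d * I (u *\<^sub>R x + v *\<^sub>R y) \<le> d * (u * I x + v * I y)" using d by simp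
    also have "\<dots> = u * (d * I x) + v * (d * I y)" by (simp add: algebra_simps)
    also have "\<dots> \<le> u * 1 + v * 1" using * by (intro add_mono mult_left_mono) auto
    finally show "d * I (u *\<^sub>R x + v *\<^sub>R y) \<le> 1" using * by simp
  qed
  then have cv: "convex {x. ?g x \<le> 1}" by (simp add: le1)
  have cg: "continuous_on UNIV ?g"
    using p by (intro continuous_on_powr' continuous_intros cI) (auto simp: d nn less_imp_le)
  have hg: "?g (c *\<^sub>R x) = c * ?g x" if "0 \<le> c" for c x
  proof -
    have "d * I (c *\<^sub>R x) = c powr p * (d * I x)" using that by (simp add: hom)
    then show ?thesis using that p d nn[of x] by (simp add: powr_mult powr_powr)
  qed
  have L: "compact L" "convex L" "L \<noteq> {}" "\<And>v. support_function L v = ?g v"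
    using support_function_polar_gauge[of ?g, OF _ cg hg cv] unfolding L_def by auto
  have "(THE L. compact L \<and> convex L \<and> L \<noteq> {} \<and>
           (\<forall>v\<in>sphere 0 1. support_function L v = ?g v)) = L"
  proof (rule the_equality)
    fix L' assume "compact L' \<and> convex L' \<and> L' \<noteq> {} \<and> (\<forall>v\<in>sphere 0 1. support_function L' v = ?g v)"
    then show "L' = L"
      using support_function_subset[of L' L] support_function_subset[of L L'] L by simp
  qed (use L in auto)
  then show ?thesis using polar_body_support_function[OF L(1,3)] L(4) by simp
qed

lemma c_const_pos:
  assumes "1 < p"
  shows "0 < c_const (real n) p"
proof -
  have "0 < (p - 1) / 2 + 1" "0 < (real n + p) / 2 + 1"
    using assms by (auto intro!: add_pos_nonneg add_nonneg_pos)
  then show ?thesis unfolding c_const_def unit_ball_vol_def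
    by (auto intro!: divide_pos_pos mult_pos_pos Gamma_real_pos)
qed

section \<open>Finiteness of the surface area measure\<close>

lemma hausdorff_pre_finite_cover:
  fixes A :: "'a::metric_space set"
  assumes "finite J" "A \<subseteq> (\<Union>j\<in>J. C j)" "1 \<le> m" "0 \<le> e" "e \<le> \<delta>"
    and C: "\<And>j. j \<in> J \<Longrightarrow> bounded (C j) \<and> diameter (C j) \<le> e"
  shows "hausdorff_pre m \<delta> A \<le> ennreal (real (card J) * (unit_ball_vol (real m) * (e / 2) ^ m))"
proof -
  obtain h where h: "bij_betw h {0..<card J} J" using ex_bij_betw_nat_finite[OF assms(1)] by blast
  define D where "D i = (if i < card J then C (h i) else {})" for i
  have hJ: "h i \<in> J" if "i < card J" for i using h that by (auto simp: bij_betw_def)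
  have cov: "A \<subseteq> (\<Union>i. D i)"
  proof
    fix x assume "x \<in> A"
    then obtain j where j: "j \<in> J" "x \<in> C j" using assms(2) by blast
    moreover from j(1) h have "j \<in> h ` {0..<card J}" by (simp add: bij_betw_def)
    then obtain i where "i < card J" "h i = j" by auto
    ultimately show "x \<in> (\<Union>i. D i)" by (auto simp: D_def)
  qed
  have "bounded (D i) \<and> diameter (D i) \<le> \<delta>" for i
  proof (cases "i < card J")
    case True
    then show ?thesis using C[OF hJ[OF True]] assms(5) by (simp add: D_def)
  qed (use assms(4,5) in \<open>simp add: D_def\<close>)
  then have "hausdorff_pre m \<delta> A \<le> (\<Sum>i. ennreal (unit_ball_vol (real m) * (diameter (D i) / 2) ^ m))"
    unfolding hausdorff_pre_def
    using cov by (intro INF_lower) simp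
  \<comment> \<open>The padding sets are empty and contribute 0 because \<open>m \<ge> 1\<close>;
    for \<open>m = 0\<close> each would contribute through \<open>0 ^ 0 = 1\<close>.\<close>
  also have "\<dots> = (\<Sum>i<card J. ennreal (unit_ball_vol (real m) * (diameter (D i) / 2) ^ m))"
    using assms(3) by (intro suminf_finite) (auto simp: D_def)
  also have "\<dots> \<le> (\<Sum>i<card J. ennreal (unit_ball_vol (real m) * (e / 2) ^ m))"
    using C hJ
    by (intro sum_mono ennreal_leI mult_left_mono power_mono divide_right_mono)
       (auto simp: D_def diameter_ge_0)
  also have "\<dots> = ennreal (real (card J) * (unit_ball_vol (real m) * (e / 2) ^ m))"
    using assms(4) by (subst sum_ennreal) auto
  finally show ?thesis .
qed

text \<open>The interval from \<open>- R\<close> to \<open>R\<close> is cut into \<open>N\<close>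
  cells of length \<open>2 * R / N\<close>; shifted by \<open>R\<close>, the cell with number
  \<open>k\<close> has centre \<open>(2 * k + 1) * R / N\<close>. The auxiliary \<open>q\<close>
  measures \<open>t + R\<close> in cell lengths.\<close>

lemma ex_grid_cell:
  fixes t R :: real
  assumes "\<bar>t\<bar> \<le> R" "0 < R" "0 < N"
  shows "\<exists>k<N. \<bar>t + R - (2 * real k + 1) * R / real N\<bar> \<le> R / real N"
proof -
  define q where "q = (t + R) * real N / (2 * R)"
  have "0 \<le> t + R" "t + R \<le> 2 * R" using assms(1) by auto
  then have q: "0 \<le> q" "q \<le> real N" using assms by (auto simp: q_def divide_le_eq mult.commute)
  have "\<exists>k<N. real k \<le> q \<and> q \<le> real k + 1"
  \<comment> \<open>At the right end the floor of \<open>q\<close> is \<open>N\<close>, which is no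
    cell number, so the last cell is taken.\<close>
  proof (cases "q = real N")
    case True
    then show ?thesis using assms(3) by (intro exI[of _ "N - 1"]) (auto simp: of_nat_diff)
  next
    case False
    then have "nat \<lfloor>q\<rfloor> < N" using q by linarith
    moreover have "real (nat \<lfloor>q\<rfloor>) \<le> q \<and> q \<le> real (nat \<lfloor>q\<rfloor>) + 1" using q by linarith
    ultimately show ?thesis by blast
  qed
  then obtain k where k: "k < N" "real k \<le> q" "q \<le> real k + 1" by blast
  have "t + R = q * (2 * R / real N)" using assms by (simp add: q_def)
  moreover have "(2 * real k + 1) * R / real N = (real k + 1/2) * (2 * R / real N)"
    using assms(3) by (simp add: field_simps)
  ultimately have "t + R - (2 * real k + 1) * R / real N = (q - (real k + 1/2)) * (2 * R / real N)"
    by (simp only: left_diff_distrib)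
  then have "\<bar>t + R - (2 * real k + 1) * R / real N\<bar> = \<bar>q - (real k + 1/2)\<bar> * \<bar>2 * R / real N\<bar>"
    by (simp only: abs_mult)
  also have "\<dots> \<le> (1/2) * \<bar>2 * R / real N\<bar>"
  proof (rule mult_right_mono)
    show "\<bar>q - (real k + 1/2)\<bar> \<le> 1/2" using k by linarith
  qed (use assms in auto)
  finally have "\<bar>t + R - (2 * real k + 1) * R / real N\<bar> \<le> R / real N" using assms by simp
  with k(1) show ?thesis by blast
qed

text \<open>The nearest-point map of \<open>K\<close> sends the surface of a surrounding cube onto the boundary
  of \<open>K\<close>, because the cube is hit by the outer normal ray at each boundary point.\<close>

lemma frontier_subset_closest_point_image:
  fixes K :: "'a::euclidean_space set"
  assumes K: "compact K" "convex K" "interior K \<noteq> {}" and KQ: "K \<subseteq> interior Q" and Q: "bounded Q"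
  shows "frontier K \<subseteq> closest_point K ` frontier Q"
proof
  fix x assume x: "x \<in> frontier K"
  have cl: "closed K" using K compact_imp_closed by blast
  then have xK: "x \<in> K" using x frontier_subset_closed by blast
  have xri: "x \<notin> rel_interior K" using x K by (simp add: frontier_def rel_interior_nonempty_interior)
  then obtain a where a: "a \<noteq> 0" "\<And>y. y \<in> closure K \<Longrightarrow> a \<bullet> x \<le> a \<bullet> y"
    using supporting_hyperplane_relative_frontier[OF K(2) _ xri] xK closure_subset by (metis subsetD)
  \<comment> \<open>\<open>a\<close> is an inner normal at \<open>x\<close>, so the ray in direction
    \<open>- a\<close> is the outer normal ray.\<close>
  obtain d where d: "0 < d" "x + d *\<^sub>R (- a) \<in> frontier Q"
  proof -
    have "x \<in> interior Q" "- a \<noteq> 0" using xK KQ a(1) by auto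
    from ray_to_frontier[OF Q this] that show thesis by metis
  qed
  have "x = closest_point K (x + d *\<^sub>R (- a))"
  proof (rule closest_point_unique[OF K(2) cl xK], rule ballI)
    fix z assume z: "z \<in> K"
    have "(x - z) \<bullet> a \<le> 0" using a(2)[of z] z cl by (simp add: inner_diff_right inner_commute[of _ a])
    then have "2 * d * ((x - z) \<bullet> a) \<le> 0" using d(1) by (intro mult_nonneg_nonpos) auto
    then have "(norm (d *\<^sub>R a))\<^sup>2 \<le> (norm (x - z))\<^sup>2 - 2 * d * ((x - z) \<bullet> a) + (norm (d *\<^sub>R a))\<^sup>2"
      using zero_le_power2[of "norm (x - z)"] by linarith
    also have "\<dots> = (norm ((x - z) - d *\<^sub>R a))\<^sup>2"
    proof -
      have "(norm (p - q))\<^sup>2 = (norm p)\<^sup>2 - 2 * (p \<bullet> q) + (norm q)\<^sup>2" for p q :: 'a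
        by (simp add: power2_norm_eq_inner inner_diff_left inner_diff_right inner_commute)
      from this[of "x - z" "d *\<^sub>R a"] show ?thesis by simp
    qed
    finally have "norm (d *\<^sub>R a) \<le> norm ((x - z) - d *\<^sub>R a)" by (rule power2_le_imp_le) simp
    then show "dist (x + d *\<^sub>R - a) x \<le> dist (x + d *\<^sub>R - a) z"
      by (simp add: dist_norm algebra_simps)
  qed
  then show "x \<in> closest_point K ` frontier Q" using d(2) by blast
qed

text \<open>The nearest-point map is 1-Lipschitz, so a covering of the cube surface is carried to
  one of the boundary of \<open>K\<close> without enlarging diameters. The
  \<open>2 * DIM('a)\<close> faces of the cube are cut into grid cells, and the covering sums are
  the same for every mesh size.\<close>

lemma hausdorff_outer_frontier_finite:
  fixes K :: "'a::euclidean_space set"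
  assumes K: "compact K" "convex K" "interior K \<noteq> {}" and dim: "2 \<le> DIM('a)"
  shows "hausdorff_outer (DIM('a) - 1) (frontier K) < \<infinity>"
proof -
  define m where "m = DIM('a) - 1"
  have m: "1 \<le> m" "DIM('a) = Suc m" using dim by (auto simp: m_def)
  obtain R0 where R0: "\<And>x. x \<in> K \<Longrightarrow> norm x \<le> R0" using compact_imp_bounded[OF K(1)] bounded_iff by blast
  define R where "R = max R0 0 + 1"
  have R: "0 < R" by (simp add: R_def)
  have KR: "norm x < R" if "x \<in> K" for x using R0[OF that] by (simp add: R_def)
  define Q :: "'a set" where "Q = cbox (- R *\<^sub>R One) (R *\<^sub>R One)"
  have fQ: "frontier Q = {x. (\<forall>j\<in>Basis. \<bar>x \<bullet> j\<bar> \<le> R) \<and> (\<exists>i\<in>Basis. x \<bullet> i = R \<or> x \<bullet> i = - R)}"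
    (is "_ = ?F")
  proof -
    have "x \<in> frontier Q \<longleftrightarrow> x \<in> ?F" for x
    proof -
      have "x \<in> frontier Q \<longleftrightarrow> (\<forall>j\<in>Basis. \<bar>x \<bullet> j\<bar> \<le> R) \<and> \<not> (\<forall>j\<in>Basis. \<bar>x \<bullet> j\<bar> < R)"
        unfolding Q_def frontier_cbox Diff_iff mem_box
        by (simp add: abs_le_iff abs_less_iff minus_le_iff minus_less_iff conj_commute)
      also have "\<dots> \<longleftrightarrow> x \<in> ?F"
      proof (safe)
        fix i assume "\<forall>j\<in>Basis. \<bar>x \<bullet> j\<bar> \<le> R" "i \<in> Basis" "\<not> \<bar>x \<bullet> i\<bar> < R"
        then have "\<bar>x \<bullet> i\<bar> = R" by force
        then show "\<exists>i\<in>Basis. x \<bullet> i = R \<or> x \<bullet> i = - R"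
          using \<open>i \<in> Basis\<close> by (auto simp: abs_if split: if_splits)
      qed (use R in force)+
      finally show ?thesis .
    qed
    then show ?thesis by blast
  qed
  have KQ: "K \<subseteq> interior Q"
  proof
    fix x assume "x \<in> K"
    then have "\<bar>x \<bullet> j\<bar> < R" if "j \<in> Basis" for j using KR[of x] Basis_le_norm[OF that, of x] by simp
    then have "- R < x \<bullet> j \<and> x \<bullet> j < R" if "j \<in> Basis" for j using that by (simp add: abs_less_iff minus_less_iff)
    then show "x \<in> interior Q" by (auto simp: Q_def interior_cbox mem_box)
  qed
  have cl: "closed K" and ne: "K \<noteq> {}" using K compact_imp_closed interior_subset by blast+
  define M where "M = 2 * real DIM('a) * (unit_ball_vol (real m) * (R * real DIM('a)) ^ m)"
  have "hausdorff_pre m \<delta> (frontier K) \<le> ennreal M" if \<delta>: "0 < \<delta>" for \<delta>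
  proof -
    obtain N :: nat where N2: "2 * R * real DIM('a) / \<delta> < real N"
      using reals_Archimedean2 by blast
    have "0 < 2 * R * real DIM('a) / \<delta>" using R \<delta> by simp
    with N2 have "0 < real N" by linarith
    with N2 have N: "0 < N" "2 * R * real DIM('a) / \<delta> < real N" by simp_all
    \<comment> \<open>Coordinates of two points of a cell differ by at most
      \<open>2 * R / N\<close>; estimating the norm by the sum of the coordinates gives the factor
      \<open>DIM('a)\<close>. The choice of \<open>N\<close> keeps this below \<delta>.\<close>
    define e where "e = 2 * R * real DIM('a) / real N"
    have e: "0 \<le> e" "e \<le> \<delta>" using N R \<delta> by (auto simp: e_def field_simps)
    \<comment> \<open>An index consists of the constant coordinate \<open>i\<close> of a face, its
      value \<open>s\<close> there, and the grid position in the remaining \<open>m\<close>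
      coordinates.\<close>
    define J where "J = (SIGMA i:(Basis::'a set). {R, - R} \<times> PiE (Basis - {i}) (\<lambda>_. {..<N}))"
    define cell where "cell = (\<lambda>(i, s, k). {x::'a. x \<bullet> i = s \<and>
      (\<forall>j\<in>Basis - {i}. \<bar>x \<bullet> j + R - (2 * real (k j) + 1) * R / real N\<bar> \<le> R / real N)})"
    have "finite J" unfolding J_def by (intro finite_SigmaI finite_PiE) auto
    have cardJ: "card J = DIM('a) * (2 * N ^ m)"
    proof -
      have "card ({R, - R} \<times> PiE (Basis - {i}) (\<lambda>_. {..<N})) = 2 * N ^ m" if "i \<in> Basis" for i :: 'a
      proof -
        have "card (Basis - {i}) = m" using that m by simp
        then show ?thesis using R by (simp add: card_cartesian_product card_PiE)
      qed
      then show ?thesis unfolding J_def by (subst card_SigmaI) (auto intro!: finite_PiE)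
    qed
    have cover: "frontier Q \<subseteq> (\<Union>c\<in>J. cell c)"
    proof
      fix x assume "x \<in> frontier Q"
      then obtain i where i: "i \<in> Basis" "x \<bullet> i \<in> {R, - R}" and xR: "\<And>j. j \<in> Basis \<Longrightarrow> \<bar>x \<bullet> j\<bar> \<le> R"
        unfolding fQ by blast
      have "\<forall>j\<in>Basis. \<exists>k<N. \<bar>x \<bullet> j + R - (2 * real k + 1) * R / real N\<bar> \<le> R / real N"
        using ex_grid_cell[OF xR R N(1)] by blast
      then obtain k where k: "\<And>j. j \<in> Basis \<Longrightarrow> k j < N"
        "\<And>j. j \<in> Basis \<Longrightarrow> \<bar>x \<bullet> j + R - (2 * real (k j) + 1) * R / real N\<bar> \<le> R / real N" by metis
      have "(i, x \<bullet> i, restrict k (Basis - {i})) \<in> J" using i k by (auto simp: J_def)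
      moreover have "x \<in> cell (i, x \<bullet> i, restrict k (Basis - {i}))" using k by (auto simp: cell_def)
      ultimately show "x \<in> (\<Union>c\<in>J. cell c)" by blast
    qed
    have dcell: "dist x y \<le> e" if c: "c \<in> J" "x \<in> cell c" "y \<in> cell c" for c x y
    proof -
      obtain i s k where ck: "c = (i, s, k)" by (cases c)
      have "\<bar>(x - y) \<bullet> j\<bar> \<le> 2 * R / real N" if j: "j \<in> Basis" for j
      proof (cases "j = i")
        case True
        then show ?thesis using c ck R N by (auto simp: cell_def inner_diff_left)
      next
        case False
        then have "\<bar>x \<bullet> j + R - (2 * real (k j) + 1) * R / real N\<bar> \<le> R / real N"
          "\<bar>y \<bullet> j + R - (2 * real (k j) + 1) * R / real N\<bar> \<le> R / real N"
          using c ck j by (auto simp: cell_def)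
        moreover have "\<bar>a - b\<bar> \<le> d + d" if "\<bar>a + R - c\<bar> \<le> d" "\<bar>b + R - c\<bar> \<le> d" for a b c d
          using that by linarith
        ultimately have "\<bar>x \<bullet> j - y \<bullet> j\<bar> \<le> R / real N + R / real N" by blast
        then show ?thesis by (simp add: inner_diff_left)
      qed
      then have "(\<Sum>j\<in>Basis. \<bar>(x - y) \<bullet> j\<bar>) \<le> real DIM('a) * (2 * R / real N)"
        using sum_bounded_above[of Basis "\<lambda>j. \<bar>(x - y) \<bullet> j\<bar>" "2 * R / real N"] by simp
      then show ?thesis using norm_le_l1[of "x - y"] by (simp add: dist_norm e_def mult_ac)
    qed
    have lip: "dist (closest_point K x) (closest_point K y) \<le> dist x y" for x y
      by (rule closest_point_lipschitz[OF K(2) cl ne])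
    have "hausdorff_pre m \<delta> (frontier K) \<le>
        ennreal (real (card J) * (unit_ball_vol (real m) * (e / 2) ^ m))"
    proof (rule hausdorff_pre_finite_cover[OF \<open>finite J\<close> _ m(1) e])
      show "frontier K \<subseteq> (\<Union>c\<in>J. closest_point K ` cell c)"
      proof -
        have "bounded Q" by (simp add: Q_def bounded_cbox)
        then have "frontier K \<subseteq> closest_point K ` frontier Q"
          by (rule frontier_subset_closest_point_image[OF K KQ])
        also have "\<dots> \<subseteq> closest_point K ` (\<Union>c\<in>J. cell c)" by (rule image_mono[OF cover])
        finally show ?thesis by (simp only: image_UN)
      qed
      fix c assume c: "c \<in> J"
      have *: "dist x y \<le> e" if "x \<in> closest_point K ` cell c" "y \<in> closest_point K ` cell c" for x y
        using that dcell[OF c] order_trans[OF lip] by blast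
      have "diameter (closest_point K ` cell c) \<le> e"
        using * e by (intro diameter_le) (auto simp: dist_norm)
      moreover have "bounded (closest_point K ` cell c)"
        using * unfolding bounded_two_points by blast
      ultimately show "bounded (closest_point K ` cell c) \<and> diameter (closest_point K ` cell c) \<le> e"
        by blast
    qed
    \<comment> \<open>The \<open>N ^ m\<close> cells of a face cancel the factor
      \<open>1 / N ^ m\<close> from the diameters, so the bound does not depend on \<delta>.\<close>
    also have "real (card J) * (unit_ball_vol (real m) * (e / 2) ^ m) = M"
      using N by (simp add: cardJ M_def e_def power_divide power_mult_distrib)
    finally show ?thesis .
  qed
  then have "hausdorff_outer m (frontier K) \<le> ennreal M"
    unfolding hausdorff_outer_def by (intro SUP_least) auto
  then have "hausdorff_outer m (frontier K) < \<infinity>" by (rule le_less_trans) simp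
  then show ?thesis by (simp add: m_def)
qed

lemma hausdorff_outer_mono: "A \<subseteq> B \<Longrightarrow> hausdorff_outer m A \<le> hausdorff_outer m B"
  unfolding hausdorff_outer_def hausdorff_pre_def by (intro SUP_subset_mono INF_superset_mono) auto

lemma
  shows space_surface_area_measure: "space (surface_area_measure K) = sphere 0 1"
    and measurable_surface_area_measure: "(\<lambda>x. x) \<in> surface_area_measure K \<rightarrow>\<^sub>M borel"
proof -
  have A: "sets (restrict_space borel (sphere 0 1 :: 'a set)) \<subseteq> Pow (sphere 0 1)"
    using sets.space_closed[of "restrict_space borel (sphere 0 1 :: 'a set)"] by (simp add: space_restrict_space)
  show sp: "space (surface_area_measure K) = sphere 0 1"
    unfolding surface_area_measure_def by (rule space_measure_of[OF A])
  have "sets (surface_area_measure K) = sets (restrict_space borel (sphere 0 1))"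
    unfolding surface_area_measure_def
    using sets_measure_of[OF A] sets.sigma_sets_eq[of "restrict_space borel (sphere 0 1 :: 'a set)"]
    by (simp add: space_restrict_space)
  then show "(\<lambda>x. x) \<in> surface_area_measure K \<rightarrow>\<^sub>M borel"
    using measurable_cong_sets[of "surface_area_measure K" "restrict_space borel (sphere 0 1)" borel borel]
      measurable_restrict_space1[OF measurable_ident, of "borel :: 'a measure" "sphere 0 1"] 
    by (simp add: id_def)
qed

text \<open>Should the set function defining the surface area measure fail to be countably additive, the
  measure is zero, so finiteness holds in either case.\<close>

lemma finite_measure_surface_area_measure:
  fixes K :: "'a::euclidean_space set"
  assumes K: "compact K" "convex K" "interior K \<noteq> {}" and dim: "2 \<le> DIM('a)"
  shows "finite_measure (surface_area_measure K)"
proof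
  have "emeasure (surface_area_measure K) (sphere 0 1) \<le>
      hausdorff_outer (DIM('a) - 1) (reverse_spherical_image K (sphere 0 1))"
    unfolding surface_area_measure_def by (simp add: emeasure_measure_of_conv)
  also have "\<dots> \<le> hausdorff_outer (DIM('a) - 1) (frontier K)"
    by (rule hausdorff_outer_mono) (auto simp: reverse_spherical_image_def)
  also have "\<dots> < \<infinity>" by (rule hausdorff_outer_frontier_finite[OF assms])
  finally show "emeasure (surface_area_measure K) (space (surface_area_measure K)) \<noteq> \<infinity>"
    by (simp add: space_surface_area_measure)
qed

section \<open>Regularity of the support function on the sphere\<close>

lemma continuous_on_support_function:
  fixes K :: "'a::euclidean_space set"
  assumes K: "compact K" "K \<noteq> {}"
  shows "continuous_on UNIV (support_function K)"
proof (rule convex_on_continuous[OF open_UNIV convex_onI])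
  fix t x y assume t: "(0::real) < t" "t < 1"
  show "support_function K ((1 - t) *\<^sub>R x + t *\<^sub>R y) \<le> (1 - t) * support_function K x + t * support_function K y"
    unfolding support_function_def
  proof (intro cSUP_least K)
    fix z assume "z \<in> K"
    then have "z \<bullet> x \<le> (SUP z\<in>K. z \<bullet> x)" "z \<bullet> y \<le> (SUP z\<in>K. z \<bullet> y)"
      by (intro cSUP_upper compact_image_inner_bdd K; assumption)+
    then show "z \<bullet> ((1 - t) *\<^sub>R x + t *\<^sub>R y) \<le> (1 - t) * (SUP z\<in>K. z \<bullet> x) + t * (SUP z\<in>K. z \<bullet> y)"
      using t by (simp add: inner_add_right add_mono mult_left_mono)
  qed
qed simp

text \<open>The exponent \<open>1 - p\<close> is negative, so a positive lower bound of the support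
  function is what bounds the weight in the projection integral. A ball about 0 inside
  \<open>K\<close> provides it.\<close>

lemma support_function_bounded_below:
  fixes K :: "'a::euclidean_space set"
  assumes "compact K" "0 \<in> interior K"
  shows "\<exists>r>0. \<forall>\<theta>. norm \<theta> = 1 \<longrightarrow> r \<le> support_function K \<theta>"
proof -
  obtain r where r: "0 < r" "cball 0 r \<subseteq> K" using assms(2) mem_interior_cball by blast
  have "r \<le> support_function K \<theta>" if "norm \<theta> = 1" for \<theta>
  proof -
    have "(r *\<^sub>R \<theta>) \<bullet> \<theta> \<le> support_function K \<theta>"
      using r that by (intro support_function_ge assms(1) subsetD[OF r(2)]) simp
    then show ?thesis using that by (simp add: dot_square_norm)
  qed
  then show ?thesis using r(1) by blast
qed

section \<open>Orthogonal changes of variables\<close>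

text \<open>Householder reflection in the hyperplane orthogonal to \<open>d\<close>. For
  \<open>d = 0\<close> division by zero makes it the identity, so \<open>reflect (a - b)\<close>
  carries \<open>a\<close> to \<open>b\<close> even if \<open>a = b\<close>.\<close>

definition reflect :: "'a::euclidean_space \<Rightarrow> 'a \<Rightarrow> 'a" where
  "reflect d x = x - (2 * (x \<bullet> d) / (d \<bullet> d)) *\<^sub>R d"

lemma orthogonal_transformation_reflect: "orthogonal_transformation (reflect d)"
proof (cases "d = 0")
  case False
  then have "reflect d x \<bullet> reflect d y = x \<bullet> y" for x y
    by (simp add: reflect_def inner_diff_left inner_diff_right inner_commute field_simps)
  moreover have "linear (reflect d)"
    by (rule linearI) (simp_all add: reflect_def inner_add_left algebra_simps add_divide_distrib)
  ultimately show ?thesis by (simp add: orthogonal_transformation_def)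
qed (simp add: reflect_def[abs_def] orthogonal_transformation_id)

lemma reflect_diff:
  assumes "norm a = norm b"
  shows "reflect (a - b) a = b"
proof (cases "a = b")
  case False
  have "a \<bullet> a = b \<bullet> b" using assms by (simp add: norm_eq)
  then have "2 * (a \<bullet> (a - b)) = (a - b) \<bullet> (a - b)"
    by (simp add: inner_diff_left inner_diff_right inner_commute)
  then show ?thesis using False by (simp add: reflect_def)
qed (simp add: reflect_def)

lemma reflect_fixes: "x \<bullet> d = 0 \<Longrightarrow> reflect d x = x"
  by (simp add: reflect_def)

lemma nn_integral_lborel_affine:
  fixes t :: "'a::euclidean_space"
  assumes [measurable]: "h \<in> borel_measurable borel" and c: "c \<noteq> 0"
  shows "(\<integral>\<^sup>+x. h x \<partial>lborel) = ennreal (\<bar>c\<bar> ^ DIM('a)) * (\<integral>\<^sup>+x. h (t + c *\<^sub>R x) \<partial>lborel)"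
  by (subst lborel_affine[OF c, of t])
     (simp add: nn_integral_density nn_integral_distr nn_integral_cmult)

lemma nn_integral_lborel_translation:
  fixes t :: "'a::euclidean_space"
  assumes "h \<in> borel_measurable borel"
  shows "(\<integral>\<^sup>+x. h (t + x) \<partial>lborel) = (\<integral>\<^sup>+x. h x \<partial>lborel)"
  using nn_integral_lborel_affine[OF assms, of 1 t] by simp

text \<open>Comparing both integrals with the integral over the unit ball, which the orthogonal map
  preserves, by means of translation invariance and Fubini's theorem.\<close>

lemma nn_integral_lborel_orthogonal:
  fixes f :: "'a::euclidean_space \<Rightarrow> 'a"
  assumes f: "orthogonal_transformation f" and [measurable]: "h \<in> borel_measurable borel"
  shows "(\<integral>\<^sup>+x. h (f x) \<partial>lborel) = (\<integral>\<^sup>+x. h x \<partial>lborel)"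
proof -
  have lf: "linear f" using f orthogonal_transformation_linear by blast
  have [measurable]: "f \<in> borel_measurable borel"
    using lf by (intro borel_measurable_continuous_onI linear_continuous_on) (simp add: linear_linear)
  obtain g where g: "\<And>y. f (g y) = y" and [measurable]: "g \<in> borel_measurable borel"
  proof -
    have bij: "bij f" using f orthogonal_transformation_bij by blast
    have "linear (inv f)" using orthogonal_transformation_inv[OF f] orthogonal_transformation_linear by blast
    then have "inv f \<in> borel_measurable borel"
      by (intro borel_measurable_continuous_onI linear_continuous_on) (simp add: linear_linear)
    with that[of "inv f"] show thesis using bij by (simp add: bij_is_surj surj_f_inv_f)
  qed
  define b :: "'a \<Rightarrow> ennreal" where "b = indicator (ball 0 1)"
  have [measurable]: "b \<in> borel_measurable borel"
    unfolding b_def by (intro borel_measurable_indicator) auto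
  have bf: "b (f x) = b x" for x
    using f by (simp add: b_def indicator_def orthogonal_transformation_norm)
  define V where "V = (\<integral>\<^sup>+x. b x \<partial>(lborel :: 'a measure))"
  have V: "V = ennreal (unit_ball_vol (real DIM('a)))"
    using emeasure_ball[of 1 "0::'a"] by (simp add: V_def b_def)
  have "V * (\<integral>\<^sup>+x. h (f x) \<partial>lborel) = (\<integral>\<^sup>+x. \<integral>\<^sup>+y. b y * h (f x) \<partial>lborel \<partial>lborel)"
    by (simp add: V_def nn_integral_cmult nn_integral_multc)
  also have "\<dots> = (\<integral>\<^sup>+x. \<integral>\<^sup>+y. b (f x + y) * h (f x) \<partial>lborel \<partial>lborel)"
    by (intro nn_integral_cong nn_integral_lborel_translation[symmetric]) measurable
  also have "\<dots> = (\<integral>\<^sup>+y. \<integral>\<^sup>+x. b (f x + y) * h (f x) \<partial>lborel \<partial>lborel)"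
    by (rule lborel_pair.Fubini') measurable
  also have "\<dots> = (\<integral>\<^sup>+y. \<integral>\<^sup>+x. b (f x) * h (f x - y) \<partial>lborel \<partial>lborel)"
  proof (rule nn_integral_cong)
    fix y
    have "(\<integral>\<^sup>+x. b (f x + y) * h (f x) \<partial>lborel) = (\<integral>\<^sup>+x. b (f (- g y + x) + y) * h (f (- g y + x)) \<partial>lborel)"
      by (rule nn_integral_lborel_translation[symmetric]) measurable
    also have "\<dots> = (\<integral>\<^sup>+x. b (f x) * h (f x - y) \<partial>lborel)"
      using g by (simp add: linear_add[OF lf] linear_neg[OF lf] linear_diff[OF lf])
    finally show "(\<integral>\<^sup>+x. b (f x + y) * h (f x) \<partial>lborel) = (\<integral>\<^sup>+x. b (f x) * h (f x - y) \<partial>lborel)" .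
  qed
  also have "\<dots> = (\<integral>\<^sup>+x. \<integral>\<^sup>+y. b (f x) * h (f x - y) \<partial>lborel \<partial>lborel)"
    by (rule lborel_pair.Fubini') measurable
  also have "\<dots> = (\<integral>\<^sup>+x. b x * (\<integral>\<^sup>+y. h y \<partial>lborel) \<partial>lborel)"
  proof (rule nn_integral_cong)
    fix x
    have "(\<integral>\<^sup>+y. h (f x - y) \<partial>lborel) = (\<integral>\<^sup>+y. h y \<partial>lborel)"
      using nn_integral_lborel_affine[of h "-1" "f x"] by simp
    then show "(\<integral>\<^sup>+y. b (f x) * h (f x - y) \<partial>lborel) = b x * (\<integral>\<^sup>+y. h y \<partial>lborel)"
      by (simp add: nn_integral_cmult bf)
  qed
  also have "\<dots> = V * (\<integral>\<^sup>+y. h y \<partial>lborel)" by (simp add: V_def nn_integral_multc)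
  finally have eq: "V * (\<integral>\<^sup>+x. h (f x) \<partial>lborel) = V * (\<integral>\<^sup>+x. h x \<partial>lborel)" .
  have pos: "0 < unit_ball_vol (real DIM('a))" by (rule unit_ball_vol_pos) simp
  have "V \<noteq> 0" "V \<noteq> top" unfolding V using pos by (simp_all add: ennreal_eq_0_iff not_le del: unit_ball_vol_pos)
  with eq show ?thesis by (simp add: ennreal_mult_cancel_left)
qed

text \<open>An orthogonal map carries a basis vector \<open>b\<close> to \<open>u\<close>. Before
  this map the scaling is diagonal, with entry 1 at \<open>b\<close> and \<open>l\<close> at the
  other basis vectors, which gives the Jacobian.\<close>

lemma nn_integral_lborel_scale_orthogonal:
  fixes u :: "'a::euclidean_space"
  assumes u: "norm u = 1" and l: "l \<noteq> 0" and [measurable]: "h \<in> borel_measurable borel"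
  shows "(\<integral>\<^sup>+x. h x \<partial>lborel) =
    ennreal (\<bar>l\<bar> ^ (DIM('a) - 1)) * (\<integral>\<^sup>+x. h ((x \<bullet> u) *\<^sub>R u + l *\<^sub>R (x - (x \<bullet> u) *\<^sub>R u)) \<partial>lborel)"
proof -
  obtain b :: 'a where b: "b \<in> Basis" using nonempty_Basis by blast
  define f where "f = reflect (b - u)"
  have f: "orthogonal_transformation f" unfolding f_def by (rule orthogonal_transformation_reflect)
  have lf: "linear f" using f orthogonal_transformation_linear by blast
  have fb: "f b = u" unfolding f_def using b u by (intro reflect_diff) simp
  have [measurable]: "f \<in> borel_measurable borel"
    using lf by (intro borel_measurable_continuous_onI linear_continuous_on) (simp add: linear_linear)
  define c where "c j = (if j = b then 1 else l)" for j
  have T: "(\<Sum>j\<in>Basis. (c j * (x \<bullet> j)) *\<^sub>R j) = (x \<bullet> b) *\<^sub>R b + l *\<^sub>R (x - (x \<bullet> b) *\<^sub>R b)" for x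
  proof (rule euclidean_eqI)
    fix i :: 'a assume "i \<in> Basis"
    then show "(\<Sum>j\<in>Basis. (c j * (x \<bullet> j)) *\<^sub>R j) \<bullet> i = ((x \<bullet> b) *\<^sub>R b + l *\<^sub>R (x - (x \<bullet> b) *\<^sub>R b)) \<bullet> i"
      using b by (simp add: inner_sum_left inner_Basis if_distrib sum.delta c_def algebra_simps cong: if_cong)
  qed
  have prod: "(\<Prod>j\<in>Basis. \<bar>c j\<bar>) = \<bar>l\<bar> ^ (DIM('a) - 1)"
  proof -
    have "(\<Prod>j\<in>Basis. \<bar>c j\<bar>) = (\<Prod>j\<in>Basis - {b}. \<bar>c j\<bar>)"
      using b by (subst prod.remove[OF finite_Basis b]) (simp add: c_def)
    also have "\<dots> = (\<Prod>j\<in>Basis - {b}. \<bar>l\<bar>)" by (intro prod.cong) (auto simp: c_def)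
    finally show ?thesis using b by simp
  qed
  have "(\<integral>\<^sup>+x. h x \<partial>lborel) = (\<integral>\<^sup>+x. h (f x) \<partial>lborel)"
    by (rule nn_integral_lborel_orthogonal[OF f, symmetric]) measurable
  also have "\<dots> = (\<integral>\<^sup>+x. h (f x) \<partial>density (distr lborel borel (\<lambda>x. 0 + (\<Sum>j\<in>Basis. (c j * (x \<bullet> j)) *\<^sub>R j)))
      (\<lambda>_. (\<Prod>j\<in>Basis. \<bar>c j\<bar>)))"
    by (subst lborel_affine_euclidean[of c 0]) (auto simp: c_def l)
  also have "\<dots> = ennreal (\<bar>l\<bar> ^ (DIM('a) - 1)) *
      (\<integral>\<^sup>+x. h (f ((x \<bullet> b) *\<^sub>R b + l *\<^sub>R (x - (x \<bullet> b) *\<^sub>R b))) \<partial>lborel)"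
    by (simp add: T prod nn_integral_density nn_integral_distr nn_integral_cmult)
  also have "(\<integral>\<^sup>+x. h (f ((x \<bullet> b) *\<^sub>R b + l *\<^sub>R (x - (x \<bullet> b) *\<^sub>R b))) \<partial>lborel) =
      (\<integral>\<^sup>+x. h ((f x \<bullet> u) *\<^sub>R u + l *\<^sub>R (f x - (f x \<bullet> u) *\<^sub>R u)) \<partial>lborel)"
  proof (rule nn_integral_cong)
    fix x
    have "f x \<bullet> u = x \<bullet> b" using f fb by (metis orthogonal_transformation_def)
    then show "h (f ((x \<bullet> b) *\<^sub>R b + l *\<^sub>R (x - (x \<bullet> b) *\<^sub>R b))) =
        h ((f x \<bullet> u) *\<^sub>R u + l *\<^sub>R (f x - (f x \<bullet> u) *\<^sub>R u))"
      by (simp add: linear_add[OF lf] linear_diff[OF lf] linear_scale[OF lf] fb)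
  qed
  also have "\<dots> = (\<integral>\<^sup>+x. h ((x \<bullet> u) *\<^sub>R u + l *\<^sub>R (x - (x \<bullet> u) *\<^sub>R u)) \<partial>lborel)"
    by (rule nn_integral_lborel_orthogonal[OF f]) measurable
  finally show ?thesis .
qed

text \<open>The substitution is made one variable at a time by affine changes on the line, whose
  factors multiply to \<open>\<bar>a * d - b * c\<bar>\<close>. The first change scales by
  \<open>a\<close>; if \<open>a = 0\<close>, the matrix is triangular once the variables are
  exchanged.\<close>

lemma nn_integral_planar_orthogonal:
  fixes G :: "real \<Rightarrow> real \<Rightarrow> ennreal"
  assumes [measurable]: "case_prod G \<in> borel_measurable (borel \<Otimes>\<^sub>M borel)"
    and det: "\<bar>a * d - b * c\<bar> = 1"
  shows "(\<integral>\<^sup>+s. \<integral>\<^sup>+t. G (s * a + t * c) (s * b + t * d) \<partial>lborel \<partial>lborel) =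
         (\<integral>\<^sup>+s. \<integral>\<^sup>+t. G s t \<partial>lborel \<partial>lborel)"
proof -
  have swap: "(\<integral>\<^sup>+s. \<integral>\<^sup>+t. G (s * a + t * c) (s * b + t * d) \<partial>lborel \<partial>lborel) =
     (\<integral>\<^sup>+t. \<integral>\<^sup>+s. G (s * a + t * c) (s * b + t * d) \<partial>lborel \<partial>lborel)"
    by (rule lborel_pair.Fubini') measurable
  show ?thesis
  proof (cases "a = 0")
    case True
    then have bc: "b \<noteq> 0" "c \<noteq> 0" "\<bar>b\<bar> * \<bar>c\<bar> = 1" using det by (auto simp: abs_mult)
    have "(\<integral>\<^sup>+s. \<integral>\<^sup>+t. G s t \<partial>lborel \<partial>lborel) =
        ennreal \<bar>c\<bar> * (\<integral>\<^sup>+s. \<integral>\<^sup>+t. G (0 + c * s) t \<partial>lborel \<partial>lborel)"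
      using bc by (intro nn_integral_real_affine) measurable
    also have "(\<integral>\<^sup>+s. \<integral>\<^sup>+t. G (0 + c * s) t \<partial>lborel \<partial>lborel) =
        (\<integral>\<^sup>+s. ennreal \<bar>b\<bar> * (\<integral>\<^sup>+t. G (0 + c * s) (s * d + b * t) \<partial>lborel) \<partial>lborel)"
      using bc by (intro nn_integral_cong nn_integral_real_affine) measurable
    also have "\<dots> = ennreal \<bar>b\<bar> * (\<integral>\<^sup>+s. \<integral>\<^sup>+t. G (0 + c * s) (s * d + b * t) \<partial>lborel \<partial>lborel)"
      by (rule nn_integral_cmult) measurable
    also have "(\<integral>\<^sup>+s. \<integral>\<^sup>+t. G (0 + c * s) (s * d + b * t) \<partial>lborel \<partial>lborel) =
        (\<integral>\<^sup>+t. \<integral>\<^sup>+s. G (s * a + t * c) (s * b + t * d) \<partial>lborel \<partial>lborel)"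
      using True by (simp add: mult.commute add.commute)
    finally have "(\<integral>\<^sup>+s. \<integral>\<^sup>+t. G s t \<partial>lborel \<partial>lborel) = ennreal (\<bar>b\<bar> * \<bar>c\<bar>) *
        (\<integral>\<^sup>+t. \<integral>\<^sup>+s. G (s * a + t * c) (s * b + t * d) \<partial>lborel \<partial>lborel)"
      by (simp only: ennreal_mult' abs_ge_zero mult_ac)
    then show ?thesis unfolding swap bc(3) by simp
  next
    case False
    let ?H = "\<lambda>s t. G s (s * b / a + t * (a * d - b * c) / a)"
    have e: "s * b + t * d = (s * a + t * c) * b / a + t * (a * d - b * c) / a" for s t
      using False by (simp add: field_simps)
    have inner: "ennreal \<bar>a\<bar> * (\<integral>\<^sup>+s. G (s * a + t * c) (s * b + t * d) \<partial>lborel) =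
        (\<integral>\<^sup>+s. ?H s t \<partial>lborel)" for t
      using nn_integral_real_affine[of "\<lambda>s. ?H s t" a "t * c"] False
      by (subst e) (simp add: mult.commute add.commute)
    have "ennreal \<bar>a\<bar> * (\<integral>\<^sup>+t. \<integral>\<^sup>+s. G (s * a + t * c) (s * b + t * d) \<partial>lborel \<partial>lborel) =
        (\<integral>\<^sup>+t. \<integral>\<^sup>+s. ?H s t \<partial>lborel \<partial>lborel)"
      by (subst nn_integral_cmult[symmetric]) (simp_all add: inner)
    also have "\<dots> = (\<integral>\<^sup>+s. \<integral>\<^sup>+t. ?H s t \<partial>lborel \<partial>lborel)"
      by (rule lborel_pair.Fubini') measurable
    also have "\<dots> = (\<integral>\<^sup>+s. ennreal \<bar>a\<bar> * (\<integral>\<^sup>+t. G s t \<partial>lborel) \<partial>lborel)"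
    proof (rule nn_integral_cong)
      fix s
      have k: "(a * d - b * c) / a \<noteq> 0" "\<bar>a\<bar> * \<bar>(a * d - b * c) / a\<bar> = 1" using det False by auto
      have "(\<integral>\<^sup>+t. G s t \<partial>lborel) = ennreal \<bar>(a * d - b * c) / a\<bar> * (\<integral>\<^sup>+t. ?H s t \<partial>lborel)"
        using nn_integral_real_affine[of "G s" "(a * d - b * c) / a" "s * b / a"] k(1)
        by (simp add: mult.commute)
      then have "ennreal \<bar>a\<bar> * (\<integral>\<^sup>+t. G s t \<partial>lborel) =
          ennreal (\<bar>a\<bar> * \<bar>(a * d - b * c) / a\<bar>) * (\<integral>\<^sup>+t. ?H s t \<partial>lborel)"
        by (simp only: ennreal_mult' abs_ge_zero mult.assoc)
      then show "(\<integral>\<^sup>+t. ?H s t \<partial>lborel) = ennreal \<bar>a\<bar> * (\<integral>\<^sup>+t. G s t \<partial>lborel)"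
        by (simp only: k(2)) simp
    qed
    also have "\<dots> = ennreal \<bar>a\<bar> * (\<integral>\<^sup>+s. \<integral>\<^sup>+t. G s t \<partial>lborel \<partial>lborel)"
      by (rule nn_integral_cmult) measurable
    finally show ?thesis unfolding swap using False by (simp add: ennreal_mult_cancel_left)
  qed
qed

section \<open>Lebesgue measure on planes and lines in a given orthonormal basis\<close>

lemma orthonormal_basis_some:
  fixes W :: "'a::euclidean_space set"
  assumes "pairwise orthogonal B0 \<and> (\<forall>b\<in>B0. norm b = 1) \<and> span B0 = W"
  obtains B where "pairwise orthogonal B" "\<forall>b\<in>B. norm b = 1" "span B = W"
    "finite B" "card B = dim W"
    "subspace_lebesgue W = distr (\<Pi>\<^sub>M b\<in>B. (lborel :: real measure)) borel (\<lambda>c. \<Sum>b\<in>B. c b *\<^sub>R b)"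
proof -
  \<comment> \<open>The basis chosen by \<open>SOME\<close> inside \<open>subspace_lebesgue\<close>;
    it inherits the three properties from the witness \<open>B0\<close> but need not equal
    it.\<close>
  define B where "B = (SOME B. pairwise orthogonal B \<and> (\<forall>b\<in>B. norm b = 1) \<and> span B = W)"
  have B: "pairwise orthogonal B \<and> (\<forall>b\<in>B. norm b = 1) \<and> span B = W"
    unfolding B_def by (rule someI, rule assms)
  then have "0 \<notin> B" by auto
  with B have ind: "independent B" by (intro pairwise_orthogonal_independent) simp_all
  have "finite B" by (rule independent_imp_finite[OF ind])
  moreover have "card B = dim W" using dim_span_eq_card_independent[OF ind] B by simp
  ultimately show thesis by (intro that[of B]) (use B in \<open>simp_all add: subspace_lebesgue_def B_def Let_def\<close>)
qed

text \<open>The basis chosen in \<open>subspace_lebesgue\<close> and the basis \<open>u\<close>,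
  \<open>w\<close> are related by an orthogonal 2 x 2 matrix, so the change of coordinates has
  determinant 1 or -1.\<close>

lemma nn_integral_subspace_lebesgue_plane:
  fixes u w :: "'a::euclidean_space"
  assumes u: "norm u = 1" and w: "norm w = 1" and uw: "u \<bullet> w = 0"
    and [measurable]: "F \<in> borel_measurable borel"
  shows "(\<integral>\<^sup>+x. F x \<partial>subspace_lebesgue (span {u, w})) =
         (\<integral>\<^sup>+s. \<integral>\<^sup>+t. F (s *\<^sub>R u + t *\<^sub>R w) \<partial>lborel \<partial>lborel)"
proof -
  have on: "pairwise orthogonal {u, w} \<and> (\<forall>b\<in>{u, w}. norm b = 1) \<and> span {u, w} = span {u, w}"
    using u w uw by (auto simp: pairwise_insert orthogonal_def inner_commute)
  have "u \<noteq> 0" using u by force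
  moreover have "w \<noteq> 0" using w by force
  moreover have "u \<noteq> w"
  proof
    assume "u = w"
    then have "u \<bullet> u = 0" using uw by simp
    with \<open>u \<noteq> 0\<close> show False by simp
  qed
  ultimately have dim2: "dim (span {u, w}) = 2"
    using pairwise_orthogonal_independent[of "{u, w}"] on u w
    by (subst dim_span_eq_card_independent) auto
  obtain B where B: "pairwise orthogonal B" "\<forall>b\<in>B. norm b = 1" "span B = span {u, w}"
    "finite B" "card B = dim (span {u, w})"
    "subspace_lebesgue (span {u, w}) = distr (\<Pi>\<^sub>M b\<in>B. (lborel :: real measure)) borel (\<lambda>c. \<Sum>b\<in>B. c b *\<^sub>R b)"
    by (rule orthonormal_basis_some[OF on])
  have "card B = 2" using B(5) dim2 by simp
  then obtain b1 b2 where b: "B = {b1, b2}" "b1 \<noteq> b2" unfolding card_2_iff by blast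
  interpret product_sigma_finite "\<lambda>_::'a. lborel :: real measure" ..
  have exp: "x = (x \<bullet> b1) *\<^sub>R b1 + (x \<bullet> b2) *\<^sub>R b2" if "x \<in> {u, w}" for x
  proof -
    have "x \<in> span B" unfolding B(3) using that by (rule span_base)
    then have "(\<Sum>i\<in>B. (x \<bullet> i) *\<^sub>R i) = x" using B(2) by (intro orthonormal_basis_expand[OF B(1) _ _ B(4)]) auto
    then show ?thesis using b by simp
  qed
  have bb: "b1 \<bullet> b2 = 0" "b1 \<bullet> b1 = 1" "b2 \<bullet> b2 = 1"
    using B(1,2) b by (auto simp: pairwise_def orthogonal_def dot_square_norm)
  define \<alpha> \<beta> \<gamma> \<delta> where abcd: "\<alpha> = u \<bullet> b1" "\<beta> = u \<bullet> b2" "\<gamma> = w \<bullet> b1" "\<delta> = w \<bullet> b2"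
  have ue: "u = \<alpha> *\<^sub>R b1 + \<beta> *\<^sub>R b2" and we: "w = \<gamma> *\<^sub>R b1 + \<delta> *\<^sub>R b2"
    unfolding abcd by (intro exp; simp)+
  have inner_exp: "(x *\<^sub>R b1 + y *\<^sub>R b2) \<bullet> (x' *\<^sub>R b1 + y' *\<^sub>R b2) = x * x' + y * y'" for x y x' y'
    by (simp add: inner_add_left inner_add_right inner_commute[of b2 b1] bb)
  have "u \<bullet> u = 1" "w \<bullet> w = 1" using u w by (simp_all add: dot_square_norm)
  moreover have "u \<bullet> u = \<alpha> * \<alpha> + \<beta> * \<beta>" "w \<bullet> w = \<gamma> * \<gamma> + \<delta> * \<delta>" "u \<bullet> w = \<alpha> * \<gamma> + \<beta> * \<delta>"
    by (simp_all only: ue we inner_exp)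
  ultimately have "\<alpha> * \<alpha> + \<beta> * \<beta> = 1" "\<gamma> * \<gamma> + \<delta> * \<delta> = 1" "\<alpha> * \<gamma> + \<beta> * \<delta> = 0"
    using uw by simp_all
  \<comment> \<open>Lagrange's identity: the squared determinant is the Gram determinant of
    \<open>u\<close> and \<open>w\<close>.\<close>
  moreover have "(\<alpha> * \<delta> - \<beta> * \<gamma>)\<^sup>2 =
      (\<alpha> * \<alpha> + \<beta> * \<beta>) * (\<gamma> * \<gamma> + \<delta> * \<delta>) - (\<alpha> * \<gamma> + \<beta> * \<delta>) * (\<alpha> * \<gamma> + \<beta> * \<delta>)"
    by (simp add: power2_eq_square algebra_simps)
  ultimately have "(\<alpha> * \<delta> - \<beta> * \<gamma>)\<^sup>2 = 1" by simp
  then have det: "\<bar>\<alpha> * \<delta> - \<beta> * \<gamma>\<bar> = 1" by (simp add: abs_square_eq_1)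
  have "(\<integral>\<^sup>+x. F x \<partial>subspace_lebesgue (span {u, w})) =
      (\<integral>\<^sup>+c. F (\<Sum>b\<in>B. c b *\<^sub>R b) \<partial>(\<Pi>\<^sub>M b\<in>B. (lborel :: real measure)))"
    unfolding B(6) by (rule nn_integral_distr) measurable
  also have "\<dots> = (\<integral>\<^sup>+c. F (c b1 *\<^sub>R b1 + c b2 *\<^sub>R b2) \<partial>(\<Pi>\<^sub>M b\<in>{b1, b2}. (lborel :: real measure)))"
    using b by simp
  also have "\<dots> = (\<integral>\<^sup>+z. F (fst z *\<^sub>R b1 + snd z *\<^sub>R b2) \<partial>(lborel \<Otimes>\<^sub>M lborel))"
    using b(2) by (intro product_nn_integral_pair) measurable
  also have "\<dots> = (\<integral>\<^sup>+s. \<integral>\<^sup>+t. F (s *\<^sub>R b1 + t *\<^sub>R b2) \<partial>lborel \<partial>lborel)"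
    by (subst lborel.nn_integral_fst[symmetric]) (auto simp: split_beta')
  also have "\<dots> = (\<integral>\<^sup>+s. \<integral>\<^sup>+t. F ((s * \<alpha> + t * \<gamma>) *\<^sub>R b1 + (s * \<beta> + t * \<delta>) *\<^sub>R b2) \<partial>lborel \<partial>lborel)"
    by (rule nn_integral_planar_orthogonal[OF _ det, symmetric]) measurable
  also have "\<dots> = (\<integral>\<^sup>+s. \<integral>\<^sup>+t. F (s *\<^sub>R u + t *\<^sub>R w) \<partial>lborel \<partial>lborel)"
    by (simp only: ue we) (simp add: algebra_simps)
  finally show ?thesis .
qed

text \<open>The chosen basis vector is \<open>w\<close> or \<open>- w\<close>, and reversing a line
  preserves length.\<close>

lemma emeasure_subspace_lebesgue_line:
  fixes w :: "'a::euclidean_space"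
  assumes w: "norm w = 1" and [measurable]: "A \<in> sets borel"
  shows "emeasure (subspace_lebesgue (span {w})) A = (\<integral>\<^sup>+t. indicator A (t *\<^sub>R w) \<partial>lborel)"
proof -
  have on: "pairwise orthogonal {w} \<and> (\<forall>b\<in>{w}. norm b = 1) \<and> span {w} = span {w}"
    using w by (auto simp: pairwise_insert)
  have "w \<noteq> 0" using w by auto
  then have dim1: "dim (span {w}) = 1"
    using pairwise_orthogonal_independent[of "{w}"] on w
    by (subst dim_span_eq_card_independent) auto
  obtain B where B: "pairwise orthogonal B" "\<forall>b\<in>B. norm b = 1" "span B = span {w}"
    "finite B" "card B = dim (span {w})"
    "subspace_lebesgue (span {w}) = distr (\<Pi>\<^sub>M b\<in>B. (lborel :: real measure)) borel (\<lambda>c. \<Sum>b\<in>B. c b *\<^sub>R b)"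
    by (rule orthonormal_basis_some[OF on])
  obtain b where b: "B = {b}" using B(5) card_1_singletonE unfolding dim1 by blast
  interpret product_sigma_finite "\<lambda>_::'a. lborel :: real measure" ..
  have "w \<in> span {w}" by (simp add: span_base)
  then have "w \<in> span {b}" using B(3) b by simp
  then obtain k where k: "w = k *\<^sub>R b" unfolding span_singleton by blast
  then have k1: "\<bar>k\<bar> = 1" using w B(2) b by simp
  have "emeasure (subspace_lebesgue (span {w})) A = (\<integral>\<^sup>+x. indicator A x \<partial>subspace_lebesgue (span {w}))"
    by (simp add: B(6))
  also have "\<dots> = (\<integral>\<^sup>+c. indicator A (\<Sum>b\<in>B. c b *\<^sub>R b) \<partial>(\<Pi>\<^sub>M b\<in>B. (lborel :: real measure)))"
    unfolding B(6) by (rule nn_integral_distr) measurable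
  also have "\<dots> = (\<integral>\<^sup>+c. indicator A (c b *\<^sub>R b) \<partial>(\<Pi>\<^sub>M b\<in>{b}. (lborel :: real measure)))"
    using b by simp
  also have "\<dots> = (\<integral>\<^sup>+t. indicator A (t *\<^sub>R b) \<partial>lborel)"
    by (rule product_nn_integral_singleton) measurable
  also have "\<dots> = ennreal \<bar>k\<bar> * (\<integral>\<^sup>+t. indicator A ((0 + k * t) *\<^sub>R b) \<partial>lborel)"
  proof (rule nn_integral_real_affine)
    show "(\<lambda>t. indicator A (t *\<^sub>R b) :: ennreal) \<in> borel_measurable borel" by measurable
  qed (use k1 in auto)
  also have "\<dots> = (\<integral>\<^sup>+t. indicator A (t *\<^sub>R w) \<partial>lborel)"
    by (simp add: k1 k mult.commute)
  finally show ?thesis .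
qed

section \<open>Cylindrical coordinates\<close>

definition perp_part :: "'a::euclidean_space \<Rightarrow> 'a \<Rightarrow> 'a" where
  "perp_part u x = x - (x \<bullet> u) *\<^sub>R u"

definition perp_dir :: "'a::euclidean_space \<Rightarrow> 'a \<Rightarrow> 'a" where
  "perp_dir u x = perp_part u x /\<^sub>R norm (perp_part u x)"

text \<open>A solid of revolution about \<open>u\<close> that takes the place of the unit sphere of
  the orthogonal hyperplane: the direction of a random point in it is uniform by symmetry. Its
  points stay away from the axis, so \<open>perp_dir\<close> is a genuine unit vector on it.\<close>

definition annular_slab :: "'a::euclidean_space \<Rightarrow> 'a set" where
  "annular_slab u = {x. x \<bullet> u \<in> {- (1/2)..1/2} \<and> norm (perp_part u x) \<in> {1..2}}"

text \<open>The exponent is tuned to the scaling: for \<open>m = n - 1\<close> and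
  \<open>q = r\<close> in the interval, \<open>annular_weight m r * \<bar>l\<bar> ^ (m - 1)\<close>
  equals \<open>r * \<bar>r * l\<bar> ^ (m - 1)\<close>, which the substitution
  \<open>s = r * l\<close> frees of \<open>r\<close>. The interval keeps all constants finite and
  positive.\<close>

definition annular_weight :: "nat \<Rightarrow> real \<Rightarrow> real" where
  "annular_weight m q = q ^ m * indicator {1..2} q"

text \<open>The measure \<open>dl / \<bar>l\<bar>\<close> is invariant under scaling, so replacing 1
  by any positive radius in the numerator leaves this value unchanged. For \<open>m \<ge> 1\<close>
  it is \<open>2 * (2 ^ m - 1) / m\<close>.\<close>

definition radial_const :: "nat \<Rightarrow> ennreal" where
  "radial_const m = (\<integral>\<^sup>+l. ennreal (annular_weight m (1 / \<bar>l\<bar>) / \<bar>l\<bar>) \<partial>(lborel :: real measure))"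

lemma annular_weight_nonneg: "0 \<le> q \<Longrightarrow> 0 \<le> annular_weight m q"
  by (simp add: annular_weight_def)

lemma measurable_perp_part[measurable]: "perp_part u \<in> borel_measurable borel"
  unfolding perp_part_def[abs_def] by measurable

lemma measurable_perp_dir[measurable]: "perp_dir u \<in> borel_measurable borel"
  unfolding perp_dir_def[abs_def] by measurable

lemma measurable_annular_weight[measurable]: "annular_weight m \<in> borel_measurable borel"
  unfolding annular_weight_def[abs_def] by measurable

lemma sets_annular_slab[measurable]: "annular_slab u \<in> sets borel"
  unfolding annular_slab_def by measurable

lemma perp_part_simps:
  assumes "norm u = 1"
  shows "perp_part u (a *\<^sub>R u + l *\<^sub>R perp_part u x) = l *\<^sub>R perp_part u x"
    "(a *\<^sub>R u + l *\<^sub>R perp_part u x) \<bullet> u = a"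
    "perp_part u x \<bullet> u = 0"
proof -
  have uu: "u \<bullet> u = 1" using assms by (simp add: dot_square_norm)
  show z: "perp_part u x \<bullet> u = 0" by (simp add: perp_part_def inner_diff_left uu)
  then show "perp_part u (a *\<^sub>R u + l *\<^sub>R perp_part u x) = l *\<^sub>R perp_part u x"
    "(a *\<^sub>R u + l *\<^sub>R perp_part u x) \<bullet> u = a"
    by (simp_all add: perp_part_def[of u "a *\<^sub>R u + _"] inner_add_left uu)
qed

lemma AE_perp_part_nonzero:
  fixes u :: "'a::euclidean_space"
  assumes "norm u = 1" "2 \<le> DIM('a)"
  shows "AE x in lborel. perp_part u x \<noteq> 0"
proof -
  have "dim {x. perp_part u x = 0} \<le> dim (span {u})"
  proof (rule dim_subset, rule subsetI)
    fix x assume "x \<in> {x. perp_part u x = 0}"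
    then have "x = (x \<bullet> u) *\<^sub>R u" by (simp add: perp_part_def)
    then show "x \<in> span {u}" by (metis span_base span_scale singletonI)
  qed
  also have "\<dots> \<le> card {u}" by (intro dim_le_card) auto
  also have "card {u} < DIM('a)" using assms by simp
  finally have "negligible {x. perp_part u x = 0}" by (rule negligible_lowdim)
  moreover have "{x. perp_part u x = 0} \<in> sets borel" by measurable
  ultimately have "{x. perp_part u x = 0} \<in> null_sets lborel"
    by (simp add: negligible_iff_null_sets null_sets_completion_iff)
  from AE_not_in[OF this] show ?thesis by simp
qed

text \<open>The integrand lives where \<open>\<bar>l\<bar>\<close> is between 1/2 and 1, and there
  it takes values between 1 and \<open>2 ^ m * 2\<close>.\<close>

lemma radial_const_bounds: "0 < radial_const m" "radial_const m < \<infinity>"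
proof -
  have "radial_const m \<le> (\<integral>\<^sup>+l. ennreal (2 ^ m * 2) * indicator {-1..1::real} l \<partial>lborel)"
    unfolding radial_const_def
  proof (rule nn_integral_mono)
    fix l :: real
    show "ennreal (annular_weight m (1 / \<bar>l\<bar>) / \<bar>l\<bar>) \<le> ennreal (2 ^ m * 2) * indicator {-1..1} l"
    proof (cases "1 / \<bar>l\<bar> \<in> {1..2}")
      case True
      then have l0: "l \<noteq> 0" by auto
      then have l: "l \<noteq> 0" "\<bar>l\<bar> \<le> 1" using True by (simp_all add: le_divide_eq)
      have "(1 / \<bar>l\<bar>) ^ m * (1 / \<bar>l\<bar>) \<le> 2 ^ m * 2"
        using True by (intro mult_mono power_mono) auto
      with True l show ?thesis
        by (auto simp: annular_weight_def indicator_def abs_le_iff intro!: ennreal_leI)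
    qed (simp add: annular_weight_def)
  qed
  also have "\<dots> = ennreal (2 ^ m * 2) * 2" by (simp add: nn_integral_cmult)
  also have "\<dots> < \<infinity>" by (simp add: ennreal_mult_less_top)
  finally show "radial_const m < \<infinity>" .
  have "0 < (\<integral>\<^sup>+l. indicator {1/2..1::real} l \<partial>lborel)" by (simp add: zero_less_iff_neq_zero)
  also have "\<dots> \<le> radial_const m"
    unfolding radial_const_def
  proof (rule nn_integral_mono)
    fix l :: real
    show "indicator {1/2..1} l \<le> ennreal (annular_weight m (1 / \<bar>l\<bar>) / \<bar>l\<bar>)"
    proof (cases "l \<in> {1/2..1}")
      case True
      then have "1 \<le> 1 / \<bar>l\<bar>" "1 / \<bar>l\<bar> \<le> 2" by (auto simp: field_simps)
      then have "1 * 1 \<le> (1 / \<bar>l\<bar>) ^ m * (1 / \<bar>l\<bar>)" by (intro mult_mono one_le_power) auto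
      with True \<open>1 \<le> 1 / \<bar>l\<bar>\<close> \<open>1 / \<bar>l\<bar> \<le> 2\<close> show ?thesis
        by (simp add: annular_weight_def)
    qed simp
  qed
  finally show "0 < radial_const m" .
qed

text \<open>Cylindrical coordinates without a measure on the sphere.  Insert the identities
  \<open>\<integral> 1\<^bsub>[-1/2,1/2]\<^esub>(x \<bullet> u + \<tau>) d\<tau> = 1\<close> and \<open>\<integral> \<psi>(r/\<bar>l\<bar>)/\<bar>l\<bar> dl = const\<close> into \<open>\<integral> f\<close>, where \<open>r\<close> is the distance of
  \<open>x\<close> from the axis and \<open>\<psi>\<close> is \<^const>\<open>annular_weight\<close>; then scale orthogonally to \<open>u\<close> by \<open>l\<close>,
  translate along \<open>u\<close> by \<open>\<tau>\<close>, and exchange the order of integration.\<close>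

lemma nn_integral_cylindrical:
  fixes u :: "'a::euclidean_space" and f :: "'a \<Rightarrow> ennreal"
  assumes u: "norm u = 1" and dim: "2 \<le> DIM('a)" and [measurable]: "f \<in> borel_measurable borel"
  shows "radial_const (DIM('a) - 1) * (\<integral>\<^sup>+x. f x \<partial>lborel) =
    (\<integral>\<^sup>+y. indicator (annular_slab u) y *
      (\<integral>\<^sup>+t. \<integral>\<^sup>+s. ennreal (\<bar>s\<bar> ^ (DIM('a) - 2)) * f (t *\<^sub>R u + s *\<^sub>R perp_dir u y) \<partial>lborel \<partial>lborel) \<partial>lborel)"
proof -
  define m where "m = DIM('a) - 1"
  have m: "1 \<le> m" "DIM('a) - 2 = m - 1" using dim by (auto simp: m_def)
  let ?z = "perp_part u"
  let ?\<psi> = "annular_weight m"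
  let ?\<chi> = "indicator {- (1/2)..1/2} :: real \<Rightarrow> real"
  \<comment> \<open>\<open>k\<close> is the product of the two inserted kernels; \<open>k'\<close>
    is what becomes of it, together with the Jacobian \<open>\<bar>l\<bar> ^ m\<close>, after
    scaling and translation.\<close>
  define k where "k \<tau> l x = ?\<chi> (x \<bullet> u + \<tau>) * (?\<psi> (norm (?z x) / \<bar>l\<bar>) / \<bar>l\<bar>)" for \<tau> l :: real and x
  define k' where "k' l y = ?\<chi> (y \<bullet> u) * (?\<psi> (norm (?z y)) * \<bar>l\<bar> ^ (m - 1))" for l :: real and y
  have [measurable]: "(\<lambda>(\<tau>, l, x). k \<tau> l x) \<in> borel_measurable (borel \<Otimes>\<^sub>M borel \<Otimes>\<^sub>M borel)"
    unfolding k_def by measurable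
  have [measurable]: "(\<lambda>(l, x). k' l x) \<in> borel_measurable (borel \<Otimes>\<^sub>M borel)"
    unfolding k'_def by measurable
  have psi: "0 \<le> ?\<psi> (norm (?z x) / \<bar>l\<bar>)" for x l by (rule annular_weight_nonneg) simp
  have psi': "0 \<le> ?\<psi> (norm (?z x))" for x by (rule annular_weight_nonneg) simp
  have change: "(\<integral>\<^sup>+x. f x * ennreal (k \<tau> l x) \<partial>lborel) =
      (\<integral>\<^sup>+y. f ((y \<bullet> u - \<tau>) *\<^sub>R u + l *\<^sub>R ?z y) * ennreal (k' l y) \<partial>lborel)" if l: "l \<noteq> 0" for \<tau> l
  proof -
    have "(\<integral>\<^sup>+x. f x * ennreal (k \<tau> l x) \<partial>lborel) = (\<integral>\<^sup>+x. f (- \<tau> *\<^sub>R u + x) * ennreal (k \<tau> l (- \<tau> *\<^sub>R u + x)) \<partial>lborel)"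
      by (rule nn_integral_lborel_translation[symmetric]) measurable
    also have "\<dots> = ennreal (\<bar>l\<bar> ^ m) * (\<integral>\<^sup>+y. f (- \<tau> *\<^sub>R u + ((y \<bullet> u) *\<^sub>R u + l *\<^sub>R ?z y)) *
        ennreal (k \<tau> l (- \<tau> *\<^sub>R u + ((y \<bullet> u) *\<^sub>R u + l *\<^sub>R ?z y))) \<partial>lborel)"
      unfolding m_def perp_part_def
      by (rule nn_integral_lborel_scale_orthogonal[OF u l]) measurable
    also have "\<dots> = (\<integral>\<^sup>+y. ennreal (\<bar>l\<bar> ^ m) * (f (- \<tau> *\<^sub>R u + ((y \<bullet> u) *\<^sub>R u + l *\<^sub>R ?z y)) *
        ennreal (k \<tau> l (- \<tau> *\<^sub>R u + ((y \<bullet> u) *\<^sub>R u + l *\<^sub>R ?z y)))) \<partial>lborel)"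
      by (rule nn_integral_cmult[symmetric]) measurable
    also have "\<dots> = (\<integral>\<^sup>+y. f ((y \<bullet> u - \<tau>) *\<^sub>R u + l *\<^sub>R ?z y) * ennreal (k' l y) \<partial>lborel)"
    proof (rule nn_integral_cong)
      fix y
      have e: "- \<tau> *\<^sub>R u + ((y \<bullet> u) *\<^sub>R u + l *\<^sub>R ?z y) = (y \<bullet> u - \<tau>) *\<^sub>R u + l *\<^sub>R ?z y"
        by (simp add: algebra_simps)
      have "k \<tau> l ((y \<bullet> u - \<tau>) *\<^sub>R u + l *\<^sub>R ?z y) = ?\<chi> (y \<bullet> u) * (?\<psi> (norm (?z y)) / \<bar>l\<bar>)"
        unfolding k_def perp_part_simps[OF u] using l by simp
      then have "\<bar>l\<bar> ^ m * k \<tau> l ((y \<bullet> u - \<tau>) *\<^sub>R u + l *\<^sub>R ?z y) = k' l y"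
        using l m(1) by (simp add: k'_def power_eq_if)
      then have "ennreal (\<bar>l\<bar> ^ m) * ennreal (k \<tau> l ((y \<bullet> u - \<tau>) *\<^sub>R u + l *\<^sub>R ?z y)) = ennreal (k' l y)"
        by (subst ennreal_mult'[symmetric]) simp_all
      then show "ennreal (\<bar>l\<bar> ^ m) * (f (- \<tau> *\<^sub>R u + ((y \<bullet> u) *\<^sub>R u + l *\<^sub>R ?z y)) *
          ennreal (k \<tau> l (- \<tau> *\<^sub>R u + ((y \<bullet> u) *\<^sub>R u + l *\<^sub>R ?z y)))) =
          f ((y \<bullet> u - \<tau>) *\<^sub>R u + l *\<^sub>R ?z y) * ennreal (k' l y)"
        unfolding e by (subst mult.left_commute) (simp only:)
    qed
    finally show ?thesis .
  qed
  have radial: "(\<integral>\<^sup>+l. ennreal (?\<psi> (norm (?z x) / \<bar>l\<bar>) / \<bar>l\<bar>) \<partial>lborel) = radial_const m" if z: "?z x \<noteq> 0" for x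
  proof -
    let ?r = "norm (?z x)"
    have "(\<integral>\<^sup>+l. ennreal (?\<psi> (?r / \<bar>l\<bar>) / \<bar>l\<bar>) \<partial>lborel) =
        ennreal \<bar>?r\<bar> * (\<integral>\<^sup>+l. ennreal (?\<psi> (?r / \<bar>0 + ?r * l\<bar>) / \<bar>0 + ?r * l\<bar>) \<partial>lborel)"
      using z by (intro nn_integral_real_affine) simp_all
    also have "\<dots> = (\<integral>\<^sup>+l. ennreal \<bar>?r\<bar> * ennreal (?\<psi> (?r / \<bar>0 + ?r * l\<bar>) / \<bar>0 + ?r * l\<bar>) \<partial>lborel)"
      by (rule nn_integral_cmult[symmetric]) measurable
    also have "\<dots> = radial_const m"
      unfolding radial_const_def using z
      by (intro nn_integral_cong) (simp add: ennreal_mult'[symmetric] abs_mult)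
    finally show ?thesis .
  qed
  have chi: "(\<integral>\<^sup>+\<tau>. ennreal (?\<chi> (a + \<tau>)) \<partial>lborel) = 1" for a :: real
  proof -
    have "(\<integral>\<^sup>+\<tau>. ennreal (?\<chi> (a + \<tau>)) \<partial>lborel) = (\<integral>\<^sup>+\<tau>. ennreal (?\<chi> \<tau>) \<partial>lborel)"
      by (rule nn_integral_lborel_translation) measurable
    also have "\<dots> = 1" by (simp add: ennreal_indicator)
    finally show ?thesis .
  qed
  have "radial_const m * (\<integral>\<^sup>+x. f x \<partial>lborel) = (\<integral>\<^sup>+x. f x * radial_const m \<partial>lborel)"
    by (subst nn_integral_multc) (simp_all add: mult.commute)
  also have "\<dots> = (\<integral>\<^sup>+x. \<integral>\<^sup>+\<tau>. \<integral>\<^sup>+l. f x * ennreal (k \<tau> l x) \<partial>lborel \<partial>lborel \<partial>lborel)"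
  proof (rule nn_integral_cong_AE, use AE_perp_part_nonzero[OF u dim] in eventually_elim)
    fix x assume z: "?z x \<noteq> 0"
    have "(\<integral>\<^sup>+\<tau>. \<integral>\<^sup>+l. f x * ennreal (k \<tau> l x) \<partial>lborel \<partial>lborel) =
        (\<integral>\<^sup>+\<tau>. \<integral>\<^sup>+l. f x * ennreal (?\<chi> (x \<bullet> u + \<tau>)) * ennreal (?\<psi> (norm (?z x) / \<bar>l\<bar>) / \<bar>l\<bar>) \<partial>lborel \<partial>lborel)"
      unfolding k_def by (intro nn_integral_cong) (simp only: ennreal_mult' indicator_pos_le mult.assoc)
    also have "\<dots> = (\<integral>\<^sup>+\<tau>. f x * ennreal (?\<chi> (x \<bullet> u + \<tau>)) * radial_const m \<partial>lborel)"
      by (subst nn_integral_cmult) (simp_all add: radial[OF z])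
    also have "\<dots> = f x * radial_const m"
      by (simp add: nn_integral_multc nn_integral_cmult chi)
    finally show "f x * radial_const m = (\<integral>\<^sup>+\<tau>. \<integral>\<^sup>+l. f x * ennreal (k \<tau> l x) \<partial>lborel \<partial>lborel)" by simp
  qed
  also have "\<dots> = (\<integral>\<^sup>+\<tau>. \<integral>\<^sup>+x. \<integral>\<^sup>+l. f x * ennreal (k \<tau> l x) \<partial>lborel \<partial>lborel \<partial>lborel)"
    unfolding k_def k'_def by (rule lborel_pair.Fubini') measurable
  also have "\<dots> = (\<integral>\<^sup>+\<tau>. \<integral>\<^sup>+l. \<integral>\<^sup>+x. f x * ennreal (k \<tau> l x) \<partial>lborel \<partial>lborel \<partial>lborel)"
    unfolding k_def k'_def by (rule nn_integral_cong, rule lborel_pair.Fubini') measurable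
  also have "\<dots> = (\<integral>\<^sup>+\<tau>. \<integral>\<^sup>+l. \<integral>\<^sup>+y. f ((y \<bullet> u - \<tau>) *\<^sub>R u + l *\<^sub>R ?z y) * ennreal (k' l y) \<partial>lborel \<partial>lborel \<partial>lborel)"
    by (rule nn_integral_cong, rule nn_integral_cong_AE, rule eventually_mono[OF AE_lborel_singleton[of 0]], rule change)
  also have "\<dots> = (\<integral>\<^sup>+\<tau>. \<integral>\<^sup>+y. \<integral>\<^sup>+l. f ((y \<bullet> u - \<tau>) *\<^sub>R u + l *\<^sub>R ?z y) * ennreal (k' l y) \<partial>lborel \<partial>lborel \<partial>lborel)"
    unfolding k_def k'_def by (rule nn_integral_cong, rule lborel_pair.Fubini') measurable
  also have "\<dots> = (\<integral>\<^sup>+y. \<integral>\<^sup>+\<tau>. \<integral>\<^sup>+l. f ((y \<bullet> u - \<tau>) *\<^sub>R u + l *\<^sub>R ?z y) * ennreal (k' l y) \<partial>lborel \<partial>lborel \<partial>lborel)"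
    unfolding k_def k'_def by (rule lborel_pair.Fubini') measurable
  also have "\<dots> = (\<integral>\<^sup>+y. indicator (annular_slab u) y *
      (\<integral>\<^sup>+t. \<integral>\<^sup>+s. ennreal (\<bar>s\<bar> ^ (m - 1)) * f (t *\<^sub>R u + s *\<^sub>R perp_dir u y) \<partial>lborel \<partial>lborel) \<partial>lborel)"
  proof (rule nn_integral_cong)
    fix y
    let ?G = "\<lambda>t s. ennreal (\<bar>s\<bar> ^ (m - 1)) * f (t *\<^sub>R u + s *\<^sub>R perp_dir u y)"
    show "(\<integral>\<^sup>+\<tau>. \<integral>\<^sup>+l. f ((y \<bullet> u - \<tau>) *\<^sub>R u + l *\<^sub>R ?z y) * ennreal (k' l y) \<partial>lborel \<partial>lborel) =
        indicator (annular_slab u) y * (\<integral>\<^sup>+t. \<integral>\<^sup>+s. ?G t s \<partial>lborel \<partial>lborel)"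
    proof (cases "y \<in> annular_slab u")
      case False
      then have "k' l y = 0" for l by (auto simp: k'_def annular_weight_def annular_slab_def)
      then show ?thesis using False by simp
    next
      case True
      define r where "r = norm (?z y)"
      have r: "1 \<le> r" using True by (simp add: annular_slab_def r_def)
      have z: "?z y = r *\<^sub>R perp_dir u y" using r by (simp add: perp_dir_def r_def[symmetric])
      \<comment> \<open>One factor \<open>r\<close> is the Jacobian of \<open>s = r * l\<close>, the
        other \<open>m - 1\<close> turn \<open>l\<close> into \<open>s\<close>. After this,
        \<open>y\<close> enters only through its direction and its height, and the height disappears
        in \<open>t = y \<bullet> u - \<tau>\<close>.\<close>
      have k': "k' l y = r * \<bar>r * l\<bar> ^ (m - 1)" for l
      proof -
        have "r ^ m = r * r ^ (m - 1)" using m(1) by (simp flip: power_Suc)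
        then show ?thesis
          using True r by (simp add: k'_def annular_weight_def annular_slab_def r_def[symmetric]
              power_mult_distrib abs_mult)
      qed
      have "(\<integral>\<^sup>+l. f ((y \<bullet> u - \<tau>) *\<^sub>R u + l *\<^sub>R ?z y) * ennreal (k' l y) \<partial>lborel) =
          (\<integral>\<^sup>+s. ?G (y \<bullet> u - \<tau>) s \<partial>lborel)" for \<tau>
      proof -
        have "(\<integral>\<^sup>+s. ?G (y \<bullet> u - \<tau>) s \<partial>lborel) = ennreal \<bar>r\<bar> * (\<integral>\<^sup>+l. ?G (y \<bullet> u - \<tau>) (0 + r * l) \<partial>lborel)"
          using r by (intro nn_integral_real_affine) simp_all
        also have "\<dots> = (\<integral>\<^sup>+l. ennreal \<bar>r\<bar> * ?G (y \<bullet> u - \<tau>) (0 + r * l) \<partial>lborel)"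
          by (rule nn_integral_cmult[symmetric]) measurable
        also have "\<dots> = (\<integral>\<^sup>+l. f ((y \<bullet> u - \<tau>) *\<^sub>R u + l *\<^sub>R ?z y) * ennreal (k' l y) \<partial>lborel)"
          unfolding k' z using r by (intro nn_integral_cong) (simp add: ennreal_mult' mult_ac)
        finally show ?thesis by simp
      qed
      then have "(\<integral>\<^sup>+\<tau>. \<integral>\<^sup>+l. f ((y \<bullet> u - \<tau>) *\<^sub>R u + l *\<^sub>R ?z y) * ennreal (k' l y) \<partial>lborel \<partial>lborel) =
          (\<integral>\<^sup>+\<tau>. \<integral>\<^sup>+s. ?G (y \<bullet> u - \<tau>) s \<partial>lborel \<partial>lborel)" by simp
      also have "\<dots> = (\<integral>\<^sup>+t. \<integral>\<^sup>+s. ?G t s \<partial>lborel \<partial>lborel)"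
        using nn_integral_real_affine[of "\<lambda>t. \<integral>\<^sup>+s. ?G t s \<partial>lborel" "-1" "y \<bullet> u"] by simp
      finally show ?thesis using True by simp
    qed
  qed
  finally show ?thesis by (simp add: m_def m(2)[unfolded m_def])
qed

text \<open>A reflection carrying \<open>u\<close> to \<open>v\<close> carries one slab onto the
  other. This makes the constant of the theorem independent of the direction.\<close>

lemma emeasure_annular_slab:
  fixes u v :: "'a::euclidean_space"
  assumes u: "norm u = 1" and v: "norm v = 1"
  shows "emeasure lborel (annular_slab u) = emeasure lborel (annular_slab v)"
proof -
  define f where "f = reflect (u - v)"
  have f: "orthogonal_transformation f" unfolding f_def by (rule orthogonal_transformation_reflect)
  have fu: "f u = v" unfolding f_def using u v by (intro reflect_diff) simp
  have "f x \<in> annular_slab v \<longleftrightarrow> x \<in> annular_slab u" for x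
  proof -
    have i: "f x \<bullet> v = x \<bullet> u" using f fu by (metis orthogonal_transformation_def)
    have lf: "linear f" using f orthogonal_transformation_linear by blast
    have "perp_part v (f x) = f (perp_part u x)"
      by (simp add: perp_part_def i linear_diff[OF lf] linear_scale[OF lf] fu)
    then show ?thesis using f i by (simp add: annular_slab_def orthogonal_transformation_norm)
  qed
  then have "(\<integral>\<^sup>+x. indicator (annular_slab v) (f x) \<partial>lborel) =
      (\<integral>\<^sup>+x. indicator (annular_slab u) x \<partial>(lborel :: 'a measure))"
    by (intro nn_integral_cong) (simp add: indicator_def)
  moreover have "(\<integral>\<^sup>+x. indicator (annular_slab v) (f x) \<partial>lborel) =
      (\<integral>\<^sup>+x. indicator (annular_slab v) x \<partial>(lborel :: 'a measure))"
    by (rule nn_integral_lborel_orthogonal[OF f]) measurable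
  ultimately show ?thesis by simp
qed

lemma emeasure_annular_slab_bounds:
  fixes u :: "'a::euclidean_space"
  assumes u: "norm u = 1" and dim: "2 \<le> DIM('a)"
  shows "0 < emeasure lborel (annular_slab u)" "emeasure lborel (annular_slab u) < \<infinity>"
proof -
  have "annular_slab u \<subseteq> cball 0 3"
  proof
    fix x assume x: "x \<in> annular_slab u"
    have "\<bar>x \<bullet> u\<bar> \<le> 1" "norm (perp_part u x) \<le> 2" using x by (auto simp: annular_slab_def abs_le_iff)
    have "norm x \<le> norm ((x \<bullet> u) *\<^sub>R u) + norm (perp_part u x)"
      using norm_triangle_ineq[of "(x \<bullet> u) *\<^sub>R u" "perp_part u x"] by (simp add: perp_part_def)
    also have "\<dots> \<le> 3" using \<open>\<bar>x \<bullet> u\<bar> \<le> 1\<close> \<open>norm (perp_part u x) \<le> 2\<close> u by simp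
    finally show "x \<in> cball 0 3" by simp
  qed
  then have "bounded (annular_slab u)" using bounded_cball bounded_subset by blast
  then show "emeasure lborel (annular_slab u) < \<infinity>" by (rule emeasure_bounded_finite)
  obtain x where x: "perp_part u x \<noteq> 0"
  proof -
    have "\<not> (AE x in (lborel :: 'a measure). False)"
      using ae_filter_eq_bot_iff[of "lborel :: 'a measure"] by (simp add: trivial_limit_def emeasure_lborel_UNIV)
    then show thesis using AE_perp_part_nonzero[OF u dim] that by (metis (mono_tags, lifting) eventually_mono)
  qed
  let ?U = "{x. x \<bullet> u \<in> {-1/2<..<1/2} \<and> norm (perp_part u x) \<in> {1<..<2}}"
  \<comment> \<open>A point at height 0 and distance 3/2 from the axis, in the middle of the open
    slab.\<close>
  let ?p = "0 *\<^sub>R u + (3 / 2 / norm (perp_part u x)) *\<^sub>R perp_part u x"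
  have "?p \<in> ?U" unfolding mem_Collect_eq perp_part_simps[OF u] using x by simp
  then have ne: "?U \<noteq> {}" by blast
  have op: "open ?U"
    unfolding perp_part_def greaterThanLessThan_iff
    by (intro open_Collect_conj open_Collect_less continuous_intros)
  have "?U \<notin> null_sets lborel"
    using open_not_negligible[OF op ne] op
    by (simp add: negligible_iff_null_sets null_sets_completion_iff del: greaterThanLessThan_iff)
  then have "emeasure lborel ?U \<noteq> 0"
    using borel_open[OF op] by (simp add: null_sets_def del: greaterThanLessThan_iff)
  moreover have "emeasure lborel ?U \<le> emeasure lborel (annular_slab u)"
    by (intro emeasure_mono) (auto simp: annular_slab_def)
  ultimately show "0 < emeasure lborel (annular_slab u)" using zero_less_iff_neq_zero by (metis le_zero_eq)
qed

section \<open>Hyperplanes of the orthogonal complement of the axis\<close>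

definition hyp :: "'a::euclidean_space \<Rightarrow> 'a \<Rightarrow> 'a set" where
  "hyp u w = {x. x \<bullet> u = 0 \<and> x \<bullet> w = 0}"

text \<open>A Borel selection: applied to vectors on a common line, not all 0, it picks one of the
  two unit vectors of that line by finitely many measurable case distinctions.\<close>

primrec first_direction :: "'a::real_normed_vector list \<Rightarrow> 'a" where
  "first_direction [] = 0"
| "first_direction (v # vs) = (if v \<noteq> 0 then v /\<^sub>R norm v else first_direction vs)"

lemma measurable_first_direction:
  fixes vs :: "('b \<Rightarrow> 'a::euclidean_space) list"
  assumes "\<And>v. v \<in> set vs \<Longrightarrow> v \<in> borel_measurable M"
  shows "(\<lambda>x. first_direction (map (\<lambda>v. v x) vs)) \<in> borel_measurable M"
  using assms
proof (induction vs)
  case (Cons v vs)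
  have [measurable]: "v \<in> borel_measurable M"
    "(\<lambda>x. first_direction (map (\<lambda>v. v x) vs)) \<in> borel_measurable M"
    using Cons by auto
  show ?case by simp
qed simp

lemma first_direction_in_span:
  assumes "set vs \<subseteq> span S" "\<exists>v\<in>set vs. v \<noteq> 0"
  shows "norm (first_direction vs) = 1 \<and> first_direction vs \<in> span S"
  using assms by (induction vs) (auto intro: span_scale)

lemma orth_proj_eqI:
  assumes "subspace F" "y \<in> F" "x - y \<in> F\<^sup>\<bottom>"
  shows "orth_proj F x = y"
  unfolding orth_proj_def
proof (rule the_equality)
  fix y' assume y': "y' \<in> F \<and> x - y' \<in> F\<^sup>\<bottom>"
  have "(x - y) - (x - y') \<in> F\<^sup>\<bottom>"
    using subspace_diff[OF subspace_orthogonal_comp assms(3), of "x - y'"] y' by blast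
  then have "y' - y \<in> F\<^sup>\<bottom>" by simp
  moreover have "y' - y \<in> F" using assms y' by (intro subspace_diff) auto
  ultimately have "orthogonal (y' - y) (y' - y)" unfolding orthogonal_comp_def by blast
  then show "y' = y" by (simp add: orthogonal_self)
qed (use assms in auto)

locale axis =
  fixes u :: "'a::euclidean_space"
  assumes norm_u: "norm u = 1" and dim2: "2 \<le> DIM('a)"
begin

definition perp_unit :: "'a set" where
  "perp_unit = {w. norm w = 1 \<and> u \<bullet> w = 0}"

abbreviation G :: "'a set set" where
  "G \<equiv> grassmannian ({u}\<^sup>\<bottom>) (DIM('a) - 2)"

abbreviation GB :: "'a set measure" where
  "GB \<equiv> grassmannian_borel ({u}\<^sup>\<bottom>) (DIM('a) - 2)"

lemma uu: "u \<bullet> u = 1" using norm_u by (simp add: dot_square_norm)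

lemma perp_unitD:
  assumes "w \<in> perp_unit"
  shows "w \<bullet> w = 1" "u \<bullet> w = 0" "w \<bullet> u = 0" "norm w = 1" "w \<noteq> 0" "u \<noteq> 0" "u \<noteq> w"
proof -
  show "norm w = 1" "u \<bullet> w = 0" using assms by (auto simp: perp_unit_def)
  then show "w \<bullet> w = 1" "w \<bullet> u = 0" by (simp_all add: dot_square_norm inner_commute)
  show "w \<noteq> 0" using \<open>norm w = 1\<close> by force
  show "u \<noteq> 0" using norm_u by force
  show "u \<noteq> w" using \<open>u \<bullet> w = 0\<close> uu by force
qed

lemma orthogonal_comp_hyp: "hyp u w = (span {u, w})\<^sup>\<bottom>"
proof -
  have "(span {u, w})\<^sup>\<bottom> = {u, w}\<^sup>\<bottom>"
  proof (intro equalityI subsetI)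
    fix x assume "x \<in> {u, w}\<^sup>\<bottom>"
    then have "orthogonal x y" if "y \<in> span {u, w}" for y
      using that by (intro orthogonal_to_span[OF that]) (auto simp: orthogonal_comp_def orthogonal_commute)
    then show "x \<in> (span {u, w})\<^sup>\<bottom>" by (simp add: orthogonal_comp_def orthogonal_commute)
  qed (use span_superset[of "{u, w}"] in \<open>auto simp: orthogonal_comp_def\<close>)
  then show ?thesis by (auto simp: hyp_def orthogonal_comp_def orthogonal_def inner_commute)
qed

lemma subspace_hyp: "subspace (hyp u w)"
  unfolding orthogonal_comp_hyp by (rule subspace_orthogonal_comp)

lemma hyp_orthogonal_comp: "(hyp u w)\<^sup>\<bottom> = span {u, w}"
  unfolding orthogonal_comp_hyp by (rule orthogonal_comp_self) simp

lemma hyp_orthogonal_comp_Int: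
  assumes w: "w \<in> perp_unit"
  shows "(hyp u w)\<^sup>\<bottom> \<inter> {u}\<^sup>\<bottom> = span {w}"
proof (intro equalityI subsetI)
  fix x assume x: "x \<in> (hyp u w)\<^sup>\<bottom> \<inter> {u}\<^sup>\<bottom>"
  then have "x \<in> span {u, w}" by (simp add: hyp_orthogonal_comp)
  then obtain a where "x - a *\<^sub>R u \<in> span {w}" by (auto simp: span_breakdown_eq)
  then obtain b where b: "x - a *\<^sub>R u = b *\<^sub>R w" by (auto simp: span_singleton)
  have "u \<bullet> x = 0" using x by (simp add: orthogonal_comp_def orthogonal_def)
  moreover have "x = a *\<^sub>R u + b *\<^sub>R w" using b by (simp add: algebra_simps)
  ultimately have "a = 0" using perp_unitD[OF w] uu by (simp add: inner_add_right)
  then show "x \<in> span {w}" using \<open>x = a *\<^sub>R u + b *\<^sub>R w\<close> by (simp add: span_base span_scale)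
next
  fix x assume "x \<in> span {w}"
  then have "x \<in> span {u, w}" using span_mono[of "{w}" "{u, w}"] by auto
  moreover obtain b where "x = b *\<^sub>R w" using \<open>x \<in> span {w}\<close> by (auto simp: span_singleton)
  ultimately show "x \<in> (hyp u w)\<^sup>\<bottom> \<inter> {u}\<^sup>\<bottom>"
    using perp_unitD[OF w] by (simp add: hyp_orthogonal_comp) (simp add: orthogonal_comp_def orthogonal_def)
qed

lemma dim_hyp:
  assumes w: "w \<in> perp_unit"
  shows "dim (hyp u w) = DIM('a) - 2"
proof -
  have ind: "independent {u, w}"
    using perp_unitD[OF w] by (intro pairwise_orthogonal_independent) (auto simp: pairwise_def orthogonal_def)
  have "dim {y \<in> UNIV. \<forall>x\<in>span {u, w}. orthogonal x y} + dim (span {u, w}) = dim (UNIV :: 'a set)"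
    by (rule dim_subspace_orthogonal_to_vectors) auto
  moreover have "dim (span {u, w}) = 2"
    using dim_span_eq_card_independent[OF ind] perp_unitD[OF w] by simp
  moreover have "{y \<in> UNIV. \<forall>x\<in>span {u, w}. orthogonal x y} = hyp u w"
    unfolding orthogonal_comp_hyp by (simp add: orthogonal_comp_def)
  ultimately show ?thesis by simp
qed

lemma hyp_in_grassmannian:
  assumes w: "w \<in> perp_unit"
  shows "hyp u w \<in> G"
proof -
  have "hyp u w \<subseteq> {u}\<^sup>\<bottom>"
    by (auto simp: hyp_def orthogonal_comp_def orthogonal_def inner_commute)
  then show ?thesis using subspace_hyp dim_hyp[OF w] by (simp add: grassmannian_def)
qed

text \<open>The orthogonal complement of \<open>E\<close> inside the hyperplane orthogonal to
  \<open>u\<close> has dimension \<open>(n - 1) - (n - 2) = 1\<close>. A unit vector in it is the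
  normal, and equality of dimensions turns the inclusion into an equality.\<close>

lemma grassmannian_hypE:
  assumes "E \<in> G"
  obtains w where "w \<in> perp_unit" "E = hyp u w"
proof -
  have E: "subspace E" "E \<subseteq> {u}\<^sup>\<bottom>" "dim E = DIM('a) - 2" using assms by (auto simp: grassmannian_def)
  have s: "subspace ({u}\<^sup>\<bottom>)" by (rule subspace_orthogonal_comp)
  have "dim {y \<in> UNIV. \<forall>x\<in>span {u}. orthogonal x y} + dim (span {u}) = dim (UNIV :: 'a set)"
    by (rule dim_subspace_orthogonal_to_vectors) auto
  moreover have "dim (span {u}) = 1"
    using norm_u by (subst dim_span_eq_card_independent) auto
  moreover have "{y \<in> UNIV. \<forall>x\<in>span {u}. orthogonal x y} = {u}\<^sup>\<bottom>"
    by (auto simp: orthogonal_comp_def span_singleton orthogonal_def intro: exI[of _ 1])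
  ultimately have dW: "dim ({u}\<^sup>\<bottom>) = DIM('a) - 1" by simp
  have "dim {y \<in> {u}\<^sup>\<bottom>. \<forall>x\<in>E. orthogonal x y} + dim E = dim ({u}\<^sup>\<bottom>)"
    by (rule dim_subspace_orthogonal_to_vectors[OF E(1) s E(2)])
  then have "dim {y \<in> {u}\<^sup>\<bottom>. \<forall>x\<in>E. orthogonal x y} \<noteq> 0" using dW E(3) dim2 by linarith
  then obtain y where y: "y \<in> {u}\<^sup>\<bottom>" "\<And>x. x \<in> E \<Longrightarrow> orthogonal x y" "y \<noteq> 0"
    unfolding dim_eq_0 by blast
  define w where "w = y /\<^sub>R norm y"
  have w: "w \<in> perp_unit"
    using y(1,3) by (simp add: perp_unit_def w_def orthogonal_comp_def orthogonal_def)
  have "E \<subseteq> hyp u w"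
  proof
    fix x assume x: "x \<in> E"
    then have "x \<bullet> u = 0" using E(2) by (auto simp: orthogonal_comp_def orthogonal_def inner_commute)
    moreover have "x \<bullet> w = 0" using y(2)[OF x] by (simp add: w_def orthogonal_def)
    ultimately show "x \<in> hyp u w" by (simp add: hyp_def)
  qed
  then have "E = hyp u w"
    using E dim_hyp[OF w] by (intro subspace_dim_equal subspace_hyp) auto
  with w that show thesis by blast
qed

lemma hyp_eq_iff:
  assumes "w \<in> perp_unit" "w' \<in> perp_unit"
  shows "hyp u w = hyp u w' \<longleftrightarrow> w' = w \<or> w' = - w"
proof
  assume "hyp u w = hyp u w'"
  then have "span {w} = span {w'}" using hyp_orthogonal_comp_Int assms by metis
  then have "w' \<in> span {w}" by (simp add: span_base)
  then obtain k where k: "w' = k *\<^sub>R w" by (auto simp: span_singleton)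
  then have "\<bar>k\<bar> = 1" using perp_unitD(4)[OF assms(1)] perp_unitD(4)[OF assms(2)] by simp
  then show "w' = w \<or> w' = - w" using k by (auto simp: abs_if split: if_splits)
qed (auto simp: hyp_def)

lemma orth_proj_hyp:
  assumes w: "w \<in> perp_unit"
  shows "orth_proj (hyp u w) x = x - (x \<bullet> u) *\<^sub>R u - (x \<bullet> w) *\<^sub>R w"
proof (rule orth_proj_eqI[OF subspace_hyp])
  show "x - (x \<bullet> u) *\<^sub>R u - (x \<bullet> w) *\<^sub>R w \<in> hyp u w"
    using perp_unitD[OF w] uu by (simp add: hyp_def inner_diff_left)
  have "(x \<bullet> u) *\<^sub>R u + (x \<bullet> w) *\<^sub>R w \<in> span {u, w}"
    by (intro span_add span_scale span_base) auto
  then show "x - (x - (x \<bullet> u) *\<^sub>R u - (x \<bullet> w) *\<^sub>R w) \<in> (hyp u w)\<^sup>\<bottom>"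
    by (simp add: hyp_orthogonal_comp add.commute)
qed

text \<open>Defined for every \<open>w\<close>, so that continuity in \<open>w\<close> can be stated
  on the whole space; for \<open>w\<close> in \<open>perp_unit\<close> it is the projection onto
  \<open>hyp u w\<close>, through which the Grassmannian receives its topology.\<close>

definition proj_blinfun :: "'a \<Rightarrow> 'a \<Rightarrow>\<^sub>L 'a" where
  "proj_blinfun w = Blinfun (\<lambda>x. x - (x \<bullet> u) *\<^sub>R u - (x \<bullet> w) *\<^sub>R w)"

lemma proj_blinfun_apply: "blinfun_apply (proj_blinfun w) x = x - (x \<bullet> u) *\<^sub>R u - (x \<bullet> w) *\<^sub>R w"
  unfolding proj_blinfun_def
  by (subst bounded_linear_Blinfun_apply) (auto intro!: bounded_linear_intros)

lemma Blinfun_orth_proj_hyp: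
  assumes "w \<in> perp_unit"
  shows "Blinfun (orth_proj (hyp u w)) = proj_blinfun w"
  unfolding proj_blinfun_def using orth_proj_hyp[OF assms] by presburger

lemma continuous_on_proj_blinfun: "continuous_on UNIV proj_blinfun"
  by (intro continuous_on_blinfun_componentwise) (simp add: proj_blinfun_apply continuous_intros)

lemma space_GB: "space GB = G"
  by (simp add: grassmannian_borel_def)

lemma measurable_hyp:
  assumes [measurable]: "g \<in> borel_measurable M" and g: "\<And>x. x \<in> space M \<Longrightarrow> g x \<in> perp_unit"
  shows "(\<lambda>x. hyp u (g x)) \<in> M \<rightarrow>\<^sub>M GB"
  unfolding grassmannian_borel_def
proof (rule measurable_vimage_algebra2)
  show "(\<lambda>x. hyp u (g x)) \<in> space M \<rightarrow> G" using g hyp_in_grassmannian by auto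
  have "(\<lambda>x. proj_blinfun (g x)) \<in> borel_measurable M"
    using borel_measurable_continuous_onI[OF continuous_on_proj_blinfun] by measurable
  then show "(\<lambda>x. Blinfun (orth_proj (hyp u (g x)))) \<in> borel_measurable M"
    using g Blinfun_orth_proj_hyp by (subst measurable_cong) auto
qed

section \<open>A measurable choice of the unit normal\<close>

definition basis_list :: "'a list" where
  "basis_list = (SOME bs. set bs = Basis)"

text \<open>For \<open>E = hyp u w\<close> the vector attached to \<open>b\<close> is
  \<open>(b \<bullet> w) w\<close>, a multiple of the normal and measurable in \<open>E\<close>;
  some basis vector makes it nonzero. The resulting sign is uncontrolled, so later uses must be even
  in the normal.\<close>

definition hyp_normal :: "'a set \<Rightarrow> 'a" where
  "hyp_normal E = first_direction (map (\<lambda>b. b - (b \<bullet> u) *\<^sub>R u - blinfun_apply (Blinfun (orth_proj E)) b) basis_list)"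

lemma set_basis_list: "set basis_list = Basis"
  unfolding basis_list_def by (rule someI_ex) (rule finite_list[OF finite_Basis])

lemma measurable_hyp_normal[measurable]: "hyp_normal \<in> borel_measurable GB"
proof -
  have P[measurable]: "(\<lambda>E. Blinfun (orth_proj E)) \<in> borel_measurable GB"
    unfolding grassmannian_borel_def by (rule measurable_vimage_algebra1) auto
  have "(\<lambda>E. blinfun_apply (Blinfun (orth_proj E)) b) \<in> borel_measurable GB" for b :: 'a
  proof -
    have "(\<lambda>F :: 'a \<Rightarrow>\<^sub>L 'a. blinfun_apply F b) \<in> borel_measurable borel"
      by (intro borel_measurable_continuous_onI continuous_intros)
    from measurable_compose[OF P this] show ?thesis .
  qed
  then have "(\<lambda>E. first_direction (map (\<lambda>v. v E)
      (map (\<lambda>b E. b - (b \<bullet> u) *\<^sub>R u - blinfun_apply (Blinfun (orth_proj E)) b) basis_list))) \<in> borel_measurable GB"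
    by (intro measurable_first_direction) auto
  then show ?thesis by (simp add: hyp_normal_def[abs_def] comp_def)
qed

lemma hyp_normal:
  assumes "E \<in> G"
  shows "hyp_normal E \<in> perp_unit" "hyp u (hyp_normal E) = E"
proof -
  obtain w where w: "w \<in> perp_unit" "E = hyp u w" using grassmannian_hypE[OF assms] .
  have e: "hyp_normal E = first_direction (map (\<lambda>b. (b \<bullet> w) *\<^sub>R w) basis_list)"
    unfolding hyp_normal_def w(2) Blinfun_orth_proj_hyp[OF w(1)] proj_blinfun_apply by simp
  have "\<exists>b\<in>Basis. b \<bullet> w \<noteq> 0" using perp_unitD(5)[OF w(1)] euclidean_all_zero_iff[of w] by (metis inner_commute)
  then have "norm (hyp_normal E) = 1 \<and> hyp_normal E \<in> span {w}"
    unfolding e using perp_unitD(5)[OF w(1)]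
    by (intro first_direction_in_span) (auto simp: set_basis_list intro: span_scale span_base)
  then obtain k where "hyp_normal E = k *\<^sub>R w" "norm (hyp_normal E) = 1"
    unfolding span_singleton by blast
  note k = this
  then have "\<bar>k\<bar> = 1" using perp_unitD(4)[OF w(1)] by simp
  then have "hyp_normal E = w \<or> hyp_normal E = - w" using k by (auto simp: abs_if split: if_splits)
  then show "hyp_normal E \<in> perp_unit" "hyp u (hyp_normal E) = E"
    using w by (auto simp: perp_unit_def hyp_def)
qed

lemma hyp_normal_hyp:
  assumes "w \<in> perp_unit"
  shows "hyp_normal (hyp u w) = w \<or> hyp_normal (hyp u w) = - w"
  using hyp_normal[OF hyp_in_grassmannian[OF assms]] hyp_eq_iff assms by metis

lemma measurable_comp_hyp:
  assumes "g \<in> borel_measurable GB" "\<And>E. E \<in> G \<Longrightarrow> g E \<in> perp_unit"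
  shows "(\<lambda>E. hyp u (g E)) \<in> GB \<rightarrow>\<^sub>M GB"
  using assms by (intro measurable_hyp) (auto simp: space_GB)


subsection \<open>The Haar measure\<close>

definition stabilizes :: "('a \<Rightarrow> 'a) \<Rightarrow> bool" where
  "stabilizes f \<longleftrightarrow> orthogonal_transformation f \<and> f ` ({u}\<^sup>\<bottom>) = {u}\<^sup>\<bottom>"

definition haar_prob :: "'a set measure \<Rightarrow> bool" where
  "haar_prob \<sigma> \<longleftrightarrow> sets \<sigma> = sets GB \<and> emeasure \<sigma> (space \<sigma>) = 1 \<and>
     (\<forall>f. stabilizes f \<longrightarrow> (\<forall>A\<in>sets \<sigma>. emeasure \<sigma> ((\<lambda>E. f ` E) ` A) = emeasure \<sigma> A))"

lemma mem_comp_u: "x \<in> {u}\<^sup>\<bottom> \<longleftrightarrow> x \<bullet> u = 0"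
  by (simp add: orthogonal_comp_def orthogonal_def inner_commute)

lemma stabilizes_axis:
  assumes "stabilizes f"
  shows "f u = u \<or> f u = - u"
proof -
  have f: "\<And>x y. f x \<bullet> f y = x \<bullet> y" and fW: "f ` ({u}\<^sup>\<bottom>) = {u}\<^sup>\<bottom>"
    using assms by (auto simp: stabilizes_def orthogonal_transformation_def)
  define y where "y = f u - (f u \<bullet> u) *\<^sub>R u"
  have yu: "y \<bullet> u = 0" by (simp add: y_def inner_diff_left uu)
  then have "y \<in> f ` ({u}\<^sup>\<bottom>)" unfolding fW by (simp add: mem_comp_u)
  then obtain x where x: "x \<bullet> u = 0" "y = f x" by (auto simp: mem_comp_u)
  have "y \<bullet> f u = 0" using x f by simp
  moreover have "y \<bullet> y = y \<bullet> f u - (f u \<bullet> u) * (y \<bullet> u)"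
    by (subst (2) y_def) (simp add: inner_diff_right)
  ultimately have "y = 0" using yu by simp
  then have e: "f u = (f u \<bullet> u) *\<^sub>R u" by (simp add: y_def)
  have "norm (f u) = 1" using f[of u u] uu by (simp add: norm_eq_sqrt_inner)
  then have "\<bar>f u \<bullet> u\<bar> = 1" using e norm_u by (metis mult.right_neutral norm_scaleR)
  then show ?thesis using e by (auto simp: abs_if split: if_splits)
qed

lemma stabilizesI:
  assumes "orthogonal_transformation f" "f u = u"
  shows "stabilizes f"
proof -
  have f: "\<And>x y. f x \<bullet> f y = x \<bullet> y" using assms by (simp add: orthogonal_transformation_def)
  have "x \<in> f ` ({u}\<^sup>\<bottom>)" if x: "x \<bullet> u = 0" for x
  proof -
    obtain y where y: "x = f y" using assms(1) orthogonal_transformation_surj by (metis surjD)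
    then have "y \<bullet> u = 0" using x f[of y u] assms(2) by simp
    then show ?thesis using y by (simp add: mem_comp_u)
  qed
  moreover have "f x \<bullet> u = 0" if "x \<bullet> u = 0" for x using that f[of x u] assms(2) by simp
  ultimately show ?thesis using assms(1) by (auto simp: stabilizes_def mem_comp_u)
qed

lemma stabilizes_inverse:
  assumes "stabilizes f"
  shows "\<exists>g. stabilizes g \<and> (\<forall>x. f (g x) = x) \<and> (\<forall>x. g (f x) = x)"
proof -
  have f: "orthogonal_transformation f" "f ` ({u}\<^sup>\<bottom>) = {u}\<^sup>\<bottom>" using assms by (auto simp: stabilizes_def)
  have b: "bij f" using f(1) orthogonal_transformation_bij by blast
  then have gf: "inv f (f x) = x" "f (inv f x) = x" for x
    by (simp_all add: bij_is_inj bij_is_surj surj_f_inv_f)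
  have "inv f ` ({u}\<^sup>\<bottom>) = inv f ` f ` ({u}\<^sup>\<bottom>)" by (simp only: f(2))
  also have "\<dots> = {u}\<^sup>\<bottom>" by (simp add: image_image gf)
  finally have "stabilizes (inv f)" using orthogonal_transformation_inv[OF f(1)] by (simp add: stabilizes_def)
  with gf show ?thesis by blast
qed

lemma stabilizes_perp_unit:
  assumes f: "stabilizes f" and w: "w \<in> perp_unit"
  shows "f w \<in> perp_unit"
proof -
  have o: "orthogonal_transformation f" using f by (simp add: stabilizes_def)
  have "u \<bullet> f w = 0 \<longleftrightarrow> f u \<bullet> f w = 0" using stabilizes_axis[OF f] by auto
  also have "f u \<bullet> f w = u \<bullet> w" using o by (simp add: orthogonal_transformation_def)
  finally show ?thesis using w o by (simp add: perp_unit_def orthogonal_transformation_norm)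
qed

lemma stabilizes_image_hyp:
  assumes f: "stabilizes f"
  shows "f ` hyp u w = hyp u (f w)"
proof -
  have o: "\<And>x y. f x \<bullet> f y = x \<bullet> y" using f by (simp add: stabilizes_def orthogonal_transformation_def)
  obtain g where g: "\<And>x. f (g x) = x" using stabilizes_inverse[OF f] by blast
  have iff: "f x \<in> hyp u (f w) \<longleftrightarrow> x \<in> hyp u w" for x
  proof -
    have "f x \<bullet> u = 0 \<longleftrightarrow> f x \<bullet> f u = 0" using stabilizes_axis[OF f] by auto
    then show ?thesis by (simp add: hyp_def o)
  qed
  show ?thesis
  proof (intro equalityI subsetI)
    fix y assume "y \<in> hyp u (f w)"
    then have "g y \<in> hyp u w" using iff[of "g y"] by (simp add: g)
    then show "y \<in> f ` hyp u w" using g by (metis imageI)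
  qed (use iff in auto)
qed

lemma stabilizes_image:
  assumes f: "stabilizes f" and E: "E \<in> G"
  shows "f ` E = hyp u (f (hyp_normal E))" "f ` E \<in> G"
    "hyp_normal (f ` E) = f (hyp_normal E) \<or> hyp_normal (f ` E) = - f (hyp_normal E)"
proof -
  show e: "f ` E = hyp u (f (hyp_normal E))"
    using stabilizes_image_hyp[OF f, of "hyp_normal E"] hyp_normal(2)[OF E] by simp
  have fw: "f (hyp_normal E) \<in> perp_unit" using hyp_normal(1)[OF E] by (rule stabilizes_perp_unit[OF f])
  show "f ` E \<in> G" unfolding e by (rule hyp_in_grassmannian[OF fw])
  show "hyp_normal (f ` E) = f (hyp_normal E) \<or> hyp_normal (f ` E) = - f (hyp_normal E)"
    unfolding e by (rule hyp_normal_hyp[OF fw])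
qed

text \<open>The image under \<open>f\<close> is the preimage under the inverse \<open>g\<close>, and
  on subspaces \<open>g\<close> acts as the composite of the Borel maps \<open>hyp_normal\<close>,
  \<open>g\<close> and \<open>hyp u\<close>.\<close>

lemma stabilizes_image_sets:
  assumes f: "stabilizes f" and A: "A \<in> sets GB"
  shows "(\<lambda>E. f ` E) ` A \<in> sets GB"
    "\<And>g. stabilizes g \<Longrightarrow> (\<And>x. f (g x) = x) \<Longrightarrow> (\<And>x. g (f x) = x) \<Longrightarrow>
       (\<lambda>E. f ` E) ` A = {E \<in> G. g ` E \<in> A}"
proof -
  have AG: "A \<subseteq> G" using sets.sets_into_space[OF A] by (simp add: space_GB)
  show e: "(\<lambda>E. f ` E) ` A = {E \<in> G. g ` E \<in> A}"
    if g: "stabilizes g" "\<And>x. f (g x) = x" "\<And>x. g (f x) = x" for g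
  proof (intro equalityI subsetI)
    fix E assume "E \<in> (\<lambda>E. f ` E) ` A"
    then obtain E' where E': "E' \<in> A" "E = f ` E'" by blast
    then show "E \<in> {E \<in> G. g ` E \<in> A}" using AG stabilizes_image(2)[OF f] g by (auto simp: image_image)
  next
    fix E assume "E \<in> {E \<in> G. g ` E \<in> A}"
    moreover have "E = f ` g ` E" by (simp add: image_image g)
    ultimately show "E \<in> (\<lambda>E. f ` E) ` A" by blast
  qed
  obtain g where g: "stabilizes g" "\<And>x. f (g x) = x" "\<And>x. g (f x) = x" using stabilizes_inverse[OF f] by blast
  have "linear g" using g(1) by (simp add: stabilizes_def orthogonal_transformation_linear)
  then have [measurable]: "g \<in> borel_measurable borel"
    by (intro borel_measurable_continuous_onI linear_continuous_on) (simp add: linear_linear)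
  have "(\<lambda>E. hyp u (g (hyp_normal E))) \<in> GB \<rightarrow>\<^sub>M GB"
  proof (rule measurable_comp_hyp)
    show "(\<lambda>E. g (hyp_normal E)) \<in> borel_measurable GB" by measurable
    show "g (hyp_normal E) \<in> perp_unit" if "E \<in> G" for E
      using stabilizes_perp_unit[OF g(1) hyp_normal(1)[OF that]] .
  qed
  from measurable_sets[OF this A]
  have "(\<lambda>E. hyp u (g (hyp_normal E))) -` A \<inter> space GB \<in> sets GB" .
  also have "(\<lambda>E. hyp u (g (hyp_normal E))) -` A \<inter> space GB = {E \<in> G. g ` E \<in> A}"
    using stabilizes_image(1)[OF g(1)] by (auto simp: space_GB)
  finally show "(\<lambda>E. f ` E) ` A \<in> sets GB" unfolding e[OF g] .
qed

section \<open>Uniqueness of the Haar measure on the Grassmannian\<close>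

definition near :: "real \<Rightarrow> 'a set \<Rightarrow> 'a set \<Rightarrow> bool" where
  "near e E F \<longleftrightarrow> 1 - e < \<bar>hyp_normal E \<bullet> hyp_normal F\<bar>"

lemma near_commute: "near e E F \<longleftrightarrow> near e F E"
  by (simp add: near_def inner_commute)

lemma near_sets: "{F \<in> G. near e E F} \<in> sets GB"
  unfolding near_def space_GB[symmetric] by measurable

text \<open>The reflection carrying one normal to the other fixes \<open>u\<close>, as both normals
  are orthogonal to it, so it is admissible and maps one near-ball into the other; symmetry gives
  the converse inequality. Since \<open>near\<close> takes an absolute value, the sign choices in
  \<open>hyp_normal\<close> are harmless.\<close>

lemma haar_prob_near:
  assumes s: "haar_prob \<sigma>" and EE: "E \<in> G" "E' \<in> G"
  shows "emeasure \<sigma> {F \<in> G. near e E F} = emeasure \<sigma> {F \<in> G. near e E' F}"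
proof -
  have le: "emeasure \<sigma> {F \<in> G. near e E F} \<le> emeasure \<sigma> {F \<in> G. near e E' F}"
    if E: "E \<in> G" "E' \<in> G" for E E'
  proof -
    let ?w = "hyp_normal E" and ?w' = "hyp_normal E'"
    define f where "f = reflect (?w - ?w')"
    have f: "orthogonal_transformation f" unfolding f_def by (rule orthogonal_transformation_reflect)
    have w: "?w \<in> perp_unit" "?w' \<in> perp_unit" using hyp_normal E by auto
    have fw: "f ?w = ?w'" unfolding f_def using perp_unitD(4)[OF w(1)] perp_unitD(4)[OF w(2)]
      by (intro reflect_diff) simp
    have "f u = u" unfolding f_def using perp_unitD(2)[OF w(1)] perp_unitD(2)[OF w(2)]
      by (intro reflect_fixes) (simp add: inner_diff_right)
    then have st: "stabilizes f" by (rule stabilizesI[OF f])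
    have sub: "(\<lambda>F. f ` F) ` {F \<in> G. near e E F} \<subseteq> {F \<in> G. near e E' F}"
    proof (rule image_subsetI)
      fix F assume F: "F \<in> {F \<in> G. near e E F}"
      then have "hyp_normal (f ` F) = f (hyp_normal F) \<or> hyp_normal (f ` F) = - f (hyp_normal F)"
        using stabilizes_image(3)[OF st] by blast
      then have "\<bar>?w' \<bullet> hyp_normal (f ` F)\<bar> = \<bar>f ?w \<bullet> f (hyp_normal F)\<bar>" using fw by auto
      also have "\<dots> = \<bar>?w \<bullet> hyp_normal F\<bar>" using f by (simp add: orthogonal_transformation_def)
      finally have "near e E' (f ` F)" using F unfolding near_def by simp
      moreover have "f ` F \<in> G" using F stabilizes_image(2)[OF st] by blast
      ultimately show "f ` F \<in> {F \<in> G. near e E' F}" by blast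
    qed
    have "emeasure \<sigma> {F \<in> G. near e E F} = emeasure \<sigma> ((\<lambda>F. f ` F) ` {F \<in> G. near e E F})"
      using s st near_sets[of e E] by (simp add: haar_prob_def)
    also have "\<dots> \<le> emeasure \<sigma> {F \<in> G. near e E' F}"
      using sub s near_sets by (intro emeasure_mono) (simp_all add: haar_prob_def)
    finally show ?thesis .
  qed
  from le[OF EE] le[OF EE(2,1)] show ?thesis by (rule antisym)
qed

lemma perp_unit_nonempty: "perp_unit \<noteq> {}"
proof -
  have "\<exists>x. perp_part u x \<noteq> 0"
  proof (rule ccontr)
    assume "\<not> ?thesis"
    then have "UNIV \<subseteq> span {u}"
      unfolding span_singleton perp_part_def by auto
    then have "DIM('a) \<le> card {u}" using dim_le_card[of "UNIV :: 'a set" "{u}"] by simp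
    then show False using dim2 by simp
  qed
  then obtain x where "perp_part u x \<noteq> 0" by blast
  then have "perp_dir u x \<in> perp_unit"
    using perp_part_simps(3)[OF norm_u, of x] by (simp add: perp_unit_def perp_dir_def inner_commute)
  then show ?thesis by blast
qed

text \<open>By compactness finitely many near-balls cover the Grassmannian. They all have the same
  measure, so one null ball would make the whole space null.\<close>

lemma haar_prob_near_pos:
  assumes s: "haar_prob \<sigma>" and E: "E \<in> G" and e: "0 < e"
  shows "emeasure \<sigma> {F \<in> G. near e E F} \<noteq> 0"
proof
  assume zero: "emeasure \<sigma> {F \<in> G. near e E F} = 0"
  have "perp_unit = sphere 0 1 \<inter> {w. u \<bullet> w = 0}" by (auto simp: perp_unit_def)
  then have "compact perp_unit" by (simp add: compact_Int_closed closed_hyperplane)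
  \<comment> \<open>For unit vectors, distance below \<open>sqrt (2 * e)\<close> means inner product
    above \<open>1 - e\<close>, which is the bound in \<open>near\<close>.\<close>
  moreover have "perp_unit \<subseteq> (\<Union>w\<in>perp_unit. ball w (sqrt (2 * e)))" using e by auto
  ultimately obtain D where D: "D \<subseteq> perp_unit" "finite D" "perp_unit \<subseteq> (\<Union>w\<in>D. ball w (sqrt (2 * e)))"
    by (elim compactE_image) auto
  have "G \<subseteq> (\<Union>w\<in>D. {F \<in> G. near e (hyp u w) F})"
  proof
    fix F assume F: "F \<in> G"
    let ?v = "hyp_normal F"
    have v: "?v \<in> perp_unit" using hyp_normal F by blast
    then obtain w where w: "w \<in> D" "dist w ?v < sqrt (2 * e)" using D(3) by (auto simp: mem_ball)
    have wp: "w \<in> perp_unit" using D w by blast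
    have "(norm (w - ?v))\<^sup>2 = 2 - 2 * (w \<bullet> ?v)"
      using perp_unitD(1)[OF wp] perp_unitD(1)[OF v]
      by (simp add: power2_norm_eq_inner inner_diff_left inner_diff_right inner_commute)
    moreover have "(norm (w - ?v))\<^sup>2 < (sqrt (2 * e))\<^sup>2"
      using w(2) by (intro power_strict_mono) (auto simp: dist_norm)
    ultimately have "1 - e < w \<bullet> ?v" using e by simp
    then have "near e (hyp u w) F" using hyp_normal_hyp[OF wp] by (auto simp: near_def)
    then show "F \<in> (\<Union>w\<in>D. {F \<in> G. near e (hyp u w) F})" using w F by blast
  qed
  moreover have sets: "{F \<in> G. near e (hyp u w) F} \<in> sets \<sigma>" for w
    using s near_sets by (simp add: haar_prob_def)
  ultimately have "emeasure \<sigma> G \<le> emeasure \<sigma> (\<Union>w\<in>D. {F \<in> G. near e (hyp u w) F})"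
    using D(2) by (intro emeasure_mono sets.finite_UN) auto
  also have "\<dots> \<le> (\<Sum>w\<in>D. emeasure \<sigma> {F \<in> G. near e (hyp u w) F})"
    using D(2) sets by (intro emeasure_subadditive_finite) auto
  also have "\<dots> = 0"
  proof (intro sum.neutral ballI)
    fix w assume "w \<in> D"
    then have "hyp u w \<in> G" using D(1) hyp_in_grassmannian by blast
    then show "emeasure \<sigma> {F \<in> G. near e (hyp u w) F} = 0"
      using haar_prob_near[OF s E] zero by simp
  qed
  finally have "emeasure \<sigma> G = 0" by simp
  moreover have "space \<sigma> = G" using s sets_eq_imp_space_eq space_GB by (metis haar_prob_def)
  ultimately show False using s by (simp add: haar_prob_def)
qed

text \<open>Double counting of the pairs of near subspaces: a near-ball has the same measure around
  each centre, for either measure.\<close>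

lemma haar_prob_le_neighbourhood:
  assumes s: "haar_prob \<sigma>" and t: "haar_prob \<tau>" and e: "0 < e"
    and C: "C \<in> sets GB" and C': "C' \<in> sets GB"
    and nb: "\<And>E F. E \<in> C \<Longrightarrow> F \<in> G \<Longrightarrow> near e E F \<Longrightarrow> F \<in> C'"
  shows "emeasure \<sigma> C \<le> emeasure \<tau> C'"
proof -
  obtain E0 where E0: "E0 \<in> G" using perp_unit_nonempty hyp_in_grassmannian by blast
  define c where "c \<sigma> = emeasure \<sigma> {F \<in> G. near e E0 F}" for \<sigma> :: "'a set measure"
  have sets: "sets \<sigma> = sets GB" "space \<sigma> = G" "emeasure \<sigma> G = 1" if "haar_prob \<sigma>" for \<sigma>
    using that sets_eq_imp_space_eq[of \<sigma> GB] by (auto simp: haar_prob_def space_GB)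
  have count: "c \<tau> * emeasure \<sigma> C \<le> c \<sigma> * emeasure \<tau> C'"
    if s: "haar_prob \<sigma>" and t: "haar_prob \<tau>" and C: "C \<in> sets GB" and C': "C' \<in> sets GB"
      and nb: "\<And>E F. E \<in> C \<Longrightarrow> F \<in> G \<Longrightarrow> near e E F \<Longrightarrow> F \<in> C'" for \<sigma> \<tau> C C'
  proof -
    interpret S: finite_measure \<sigma> by standard (simp add: sets[OF s])
    interpret T: finite_measure \<tau> by standard (simp add: sets[OF t])
    interpret pair_sigma_finite \<sigma> \<tau> ..
    note [measurable_cong] = sets(1)[OF s] sets(1)[OF t]
    note [measurable] = C C'
    have CG: "C \<subseteq> G" using sets.sets_into_space[OF C] by (simp add: space_GB)
    define \<kappa> where "\<kappa> E F = (if near e E F then 1 else 0 :: ennreal)" for E F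
    have [measurable]: "(\<lambda>(E, F). \<kappa> E F) \<in> borel_measurable (GB \<Otimes>\<^sub>M GB)"
      unfolding \<kappa>_def near_def by measurable
    have ball: "(\<integral>\<^sup>+F. \<kappa> E F \<partial>\<rho>) = c \<rho>" if r: "haar_prob \<rho>" and E: "E \<in> G" for \<rho> E
    proof -
      have "(\<integral>\<^sup>+F. \<kappa> E F \<partial>\<rho>) = (\<integral>\<^sup>+F. indicator {F \<in> G. near e E F} F \<partial>\<rho>)"
        by (intro nn_integral_cong) (simp add: \<kappa>_def sets[OF r] indicator_def)
      also have "\<dots> = emeasure \<rho> {F \<in> G. near e E F}" using near_sets sets(1)[OF r] by simp
      also have "\<dots> = c \<rho>" unfolding c_def by (rule haar_prob_near[OF r E E0])
      finally show ?thesis .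
    qed
    have "c \<tau> * emeasure \<sigma> C = (\<integral>\<^sup>+E. c \<tau> * indicator C E \<partial>\<sigma>)"
      by (simp add: nn_integral_cmult_indicator sets(1)[OF s] C)
    also have "\<dots> = (\<integral>\<^sup>+E. \<integral>\<^sup>+F. indicator C E * \<kappa> E F \<partial>\<tau> \<partial>\<sigma>)"
    proof (rule nn_integral_cong)
      fix E assume "E \<in> space \<sigma>"
      then have E: "E \<in> G" by (simp add: sets[OF s])
      have "(\<lambda>F. \<kappa> E F) \<in> borel_measurable \<tau>" using E by (simp add: space_GB)
      then show "c \<tau> * indicator C E = (\<integral>\<^sup>+F. indicator C E * \<kappa> E F \<partial>\<tau>)"
        by (simp add: nn_integral_cmult ball[OF t E] mult.commute)
    qed
    also have "\<dots> = (\<integral>\<^sup>+F. \<integral>\<^sup>+E. indicator C E * \<kappa> E F \<partial>\<sigma> \<partial>\<tau>)"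
      by (rule Fubini'[symmetric]) measurable
    also have "\<dots> \<le> (\<integral>\<^sup>+F. c \<sigma> * indicator C' F \<partial>\<tau>)"
    proof (rule nn_integral_mono)
      fix F assume "F \<in> space \<tau>"
      then have F: "F \<in> G" by (simp add: sets[OF t])
      have "(\<integral>\<^sup>+E. indicator C E * \<kappa> E F \<partial>\<sigma>) \<le> (\<integral>\<^sup>+E. \<kappa> F E * indicator C' F \<partial>\<sigma>)"
        using nb F CG by (intro nn_integral_mono) (auto simp: \<kappa>_def near_commute indicator_def)
      also have "\<dots> = c \<sigma> * indicator C' F"
        using F by (subst nn_integral_multc) (simp_all add: ball[OF s F] space_GB)
      finally show "(\<integral>\<^sup>+E. indicator C E * \<kappa> E F \<partial>\<sigma>) \<le> c \<sigma> * indicator C' F" .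
    qed
    also have "\<dots> = c \<sigma> * emeasure \<tau> C'"
      by (simp add: nn_integral_cmult_indicator sets(1)[OF t] C')
    finally show ?thesis .
  qed
  have GG: "G \<in> sets GB" using sets.top[of GB] by (simp add: space_GB)
  \<comment> \<open>Counting with the whole Grassmannian as both sets shows that the two measures
    give near-balls the same mass, which can then be cancelled.\<close>
  have "c \<tau> \<le> c \<sigma>" "c \<sigma> \<le> c \<tau>"
    using count[OF s t GG GG] count[OF t s GG GG] sets(3)[OF s] sets(3)[OF t] by simp_all
  then have cc: "c \<tau> = c \<sigma>" by simp
  have "c \<sigma> \<noteq> 0" unfolding c_def by (rule haar_prob_near_pos[OF s E0 e])
  moreover have "c \<sigma> \<le> 1"
    unfolding c_def sets(3)[OF s, symmetric] using sets(1)[OF s] GG by (intro emeasure_mono) auto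
  then have "c \<sigma> \<noteq> \<infinity>" by (auto simp: top_unique)
  moreover have "c \<sigma> * emeasure \<sigma> C \<le> c \<sigma> * emeasure \<tau> C'"
    using count[OF s t C C' nb] cc by simp
  ultimately show ?thesis by (simp add: ennreal_mult_le_mult_iff)
qed

lemma norm_proj_blinfun_diff:
  assumes w: "w \<in> perp_unit" "v \<in> perp_unit"
  shows "norm (proj_blinfun w - proj_blinfun v) \<le> 2 * norm (w - v)"
proof (rule norm_blinfun_bound)
  fix x
  have "blinfun_apply (proj_blinfun w - proj_blinfun v) x = (x \<bullet> (v - w)) *\<^sub>R v + (x \<bullet> w) *\<^sub>R (v - w)"
    by (simp add: blinfun.diff_left proj_blinfun_apply algebra_simps inner_diff_right)
  also have "norm \<dots> \<le> \<bar>x \<bullet> (v - w)\<bar> * norm v + \<bar>x \<bullet> w\<bar> * norm (v - w)"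
    by (rule order_trans[OF norm_triangle_ineq]) simp
  also have "\<dots> \<le> (norm x * norm (v - w)) * 1 + (norm x * 1) * norm (v - w)"
    using Cauchy_Schwarz_ineq2[of x "v - w"] Cauchy_Schwarz_ineq2[of x w] perp_unitD(4)[OF w(1)] perp_unitD(4)[OF w(2)]
    by (intro add_mono mult_mono) auto
  also have "\<dots> = 2 * norm (w - v) * norm x" by (simp add: norm_minus_commute)
  finally show "norm (blinfun_apply (proj_blinfun w - proj_blinfun v) x) \<le> 2 * norm (w - v) * norm x" .
qed simp

text \<open>For suitably signed normals the squared distance is
  \<open>2 - 2 * (w \<bullet> v)\<close>, here below \<open>(e / 2)\<^sup>2\<close>, and the
  projection depends on the normal with Lipschitz constant 2. This gives the constant 8.\<close>

lemma near_imp_close: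
  assumes E: "E \<in> G" "F \<in> G" and e: "0 < e" and nr: "near (e\<^sup>2 / 8) E F"
  shows "dist (Blinfun (orth_proj F)) (Blinfun (orth_proj E)) \<le> e"
proof -
  let ?w = "hyp_normal E" and ?v = "hyp_normal F"
  have w: "?w \<in> perp_unit" "?v \<in> perp_unit" using hyp_normal E by auto
  define v where "v = (if ?w \<bullet> ?v \<ge> 0 then ?v else - ?v)"
  have v: "v \<in> perp_unit" "hyp u v = F" using w(2) hyp_normal(2)[OF E(2)]
    by (auto simp: v_def perp_unit_def hyp_def)
  have "1 - e\<^sup>2 / 8 < ?w \<bullet> v" using nr by (auto simp: near_def v_def abs_if split: if_splits)
  moreover have "(norm (?w - v))\<^sup>2 = 2 - 2 * (?w \<bullet> v)"
    using perp_unitD(1)[OF w(1)] perp_unitD(1)[OF v(1)]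
    by (simp add: power2_norm_eq_inner inner_diff_left inner_diff_right inner_commute)
  ultimately have "(norm (?w - v))\<^sup>2 \<le> (e / 2)\<^sup>2" by (simp add: power_divide)
  then have "norm (?w - v) \<le> e / 2" by (rule power2_le_imp_le) (use e in simp)
  then have "norm (proj_blinfun v - proj_blinfun ?w) \<le> e"
    using norm_proj_blinfun_diff[OF v(1) w(1)] by (simp add: norm_minus_commute)
  then show ?thesis
    using Blinfun_orth_proj_hyp[OF v(1)] Blinfun_orth_proj_hyp[OF w(1)] v(2) hyp_normal(2)[OF E(1)]
    by (simp add: dist_norm)
qed

text \<open>The sets \<open>D k\<close> are neighbourhoods that shrink to the closed set. Each has
  at least the required mass under \<tau> by double counting, and continuity from above passes to
  the limit.\<close>

lemma haar_prob_closed_le: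
  assumes s: "haar_prob \<sigma>" and t: "haar_prob \<tau>" and C: "closed C" "C \<noteq> {}"
  shows "emeasure \<sigma> {E \<in> G. Blinfun (orth_proj E) \<in> C} \<le> emeasure \<tau> {E \<in> G. Blinfun (orth_proj E) \<in> C}"
proof -
  let ?P = "\<lambda>E. Blinfun (orth_proj E)"
  define D where "D k = {E \<in> G. infdist (?P E) C \<le> inverse (real (Suc k))}" for k
  have P[measurable]: "?P \<in> borel_measurable GB"
    unfolding grassmannian_borel_def by (rule measurable_vimage_algebra1) auto
  have "(\<lambda>x. infdist x C) \<in> borel_measurable borel"
    by (intro borel_measurable_continuous_onI continuous_intros)
  from measurable_compose[OF P this] have [measurable]: "(\<lambda>E. infdist (?P E) C) \<in> borel_measurable GB" .
  have D: "D k \<in> sets GB" for k unfolding D_def space_GB[symmetric] by measurable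
  have CG: "{E \<in> G. ?P E \<in> C} \<in> sets GB"
  proof -
    have "{E \<in> G. ?P E \<in> C} = ?P -` C \<inter> space GB" by (auto simp: space_GB)
    then show ?thesis using measurable_sets[OF P borel_closed[OF C(1)]] by simp
  qed
  have le: "emeasure \<sigma> {E \<in> G. ?P E \<in> C} \<le> emeasure \<tau> (D k)" for k
  proof (rule haar_prob_le_neighbourhood[OF s t _ CG D])
    let ?e = "inverse (real (Suc k))"
    show "0 < ?e\<^sup>2 / 8" by simp
    fix E F assume "E \<in> {E \<in> G. ?P E \<in> C}" "F \<in> G" "near (?e\<^sup>2 / 8) E F"
    then have "dist (?P F) (?P E) \<le> ?e" "?P E \<in> C" using near_imp_close[of E F ?e] by auto
    then have "infdist (?P F) C \<le> ?e" by (meson infdist_le order_trans)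
    then show "F \<in> D k" using \<open>F \<in> G\<close> by (simp add: D_def)
  qed
  have eq: "(\<Inter>k. D k) = {E \<in> G. ?P E \<in> C}"
  proof (intro equalityI subsetI)
    fix E assume E: "E \<in> (\<Inter>k. D k)"
    then have "E \<in> G" "\<And>k. infdist (?P E) C \<le> inverse (real (Suc k))" by (auto simp: D_def)
    moreover have "infdist (?P E) C = 0"
    proof (rule ccontr)
      assume "infdist (?P E) C \<noteq> 0"
      then have "0 < infdist (?P E) C" using infdist_nonneg[of "?P E" C] by linarith
      then obtain k where "inverse (real (Suc k)) < infdist (?P E) C" using reals_Archimedean by blast
      then show False using calculation(2)[of k] by simp
    qed
    ultimately show "E \<in> {E \<in> G. ?P E \<in> C}" using in_closed_iff_infdist_zero[OF C] by simp
  qed (auto simp: D_def)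
  have st: "sets \<tau> = sets GB" "emeasure \<tau> (space \<tau>) = 1" using t by (auto simp: haar_prob_def)
  interpret T: finite_measure \<tau> by standard (simp add: st)
  have "decseq D"
  proof (rule decseq_SucI, rule subsetI)
    fix k E assume "E \<in> D (Suc k)"
    then have E: "E \<in> G" "infdist (?P E) C \<le> inverse (real (Suc (Suc k)))" by (simp_all add: D_def)
    have "inverse (real (Suc (Suc k))) \<le> inverse (real (Suc k))" by (simp add: field_simps)
    with E(2) have "infdist (?P E) C \<le> inverse (real (Suc k))" by (rule order_trans)
    with E(1) show "E \<in> D k" by (simp add: D_def)
  qed
  then have "(INF k. emeasure \<tau> (D k)) = emeasure \<tau> (\<Inter>k. D k)"
    using D st(1) T.emeasure_finite by (intro INF_emeasure_decseq) auto
  moreover have "emeasure \<sigma> {E \<in> G. ?P E \<in> C} \<le> (INF k. emeasure \<tau> (D k))"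
    using le by (intro INF_greatest)
  ultimately show ?thesis by (simp add: eq)
qed

text \<open>The two measures agree on preimages of closed sets of operators, which form a generator
  stable under intersection.\<close>

lemma haar_prob_unique:
  assumes s: "haar_prob \<sigma>" and t: "haar_prob \<tau>"
  shows "\<sigma> = \<tau>"
proof -
  let ?P = "\<lambda>E. Blinfun (orth_proj E) :: 'a \<Rightarrow>\<^sub>L 'a"
  define C where "C = {?P -` A \<inter> G | A. closed A}"
  have "GB = vimage_algebra G ?P (sigma UNIV {A. closed A})"
    unfolding grassmannian_borel_def by (simp only: borel_eq_closed)
  also have "\<dots> = sigma G C"
    unfolding C_def by (subst vimage_algebra_sigma) auto
  finally have "sets GB = sets (sigma G C)" by (rule arg_cong)
  then have sC: "sets GB = sigma_sets G C" by (simp add: C_def sets_measure_of_conv subset_iff) (auto simp: C_def sets_measure_of)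
  have st: "sets \<sigma> = sigma_sets G C" "sets \<tau> = sigma_sets G C" using s t sC by (auto simp: haar_prob_def)
  have one: "emeasure \<sigma> G = 1" "emeasure \<tau> G = 1"
    using s t sets_eq_imp_space_eq[of _ GB] by (auto simp: haar_prob_def space_GB)
  show ?thesis
  proof (rule measure_eqI_generator_eq[where A = "\<lambda>_. G"])
    show "Int_stable C"
      unfolding Int_stable_def C_def
    proof safe
      fix A B :: "('a \<Rightarrow>\<^sub>L 'a) set" assume "closed A" "closed B"
      then show "\<exists>D. ?P -` A \<inter> G \<inter> (?P -` B \<inter> G) = ?P -` D \<inter> G \<and> closed D"
        by (intro exI[of _ "A \<inter> B"]) auto
    qed
    show "C \<subseteq> Pow G" by (auto simp: C_def)
    show "range (\<lambda>_. G) \<subseteq> C" unfolding C_def by (auto intro!: exI[of _ UNIV])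
    show "emeasure \<sigma> X = emeasure \<tau> X" if "X \<in> C" for X
    proof -
      obtain A where "closed A" "X = ?P -` A \<inter> G" using \<open>X \<in> C\<close> unfolding C_def by blast
      then have A: "closed A" "X = {E \<in> G. ?P E \<in> A}" by auto
      show ?thesis
      \<comment> \<open>The empty set is separate because \<open>infdist\<close> to it is 0 by
        default.\<close>
      proof (cases "A = {}")
        case False
        from haar_prob_closed_le[OF s t A(1) False] haar_prob_closed_le[OF t s A(1) False]
        show ?thesis unfolding A(2) by (rule antisym)
      qed (simp add: A)
    qed
  qed (use st one in auto)
qed

section \<open>Existence of the Haar measure and its link to cylindrical coordinates\<close>

definition perp_direction :: "'a \<Rightarrow> 'a" where
  "perp_direction x = (if perp_part u x = 0 then (SOME w. w \<in> perp_unit) else perp_dir u x)"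

text \<open>The uniform distribution on the slab, pushed forward by the hyperplane orthogonal to the
  direction of the point. \<open>perp_direction\<close> differs from \<open>perp_dir\<close> only on
  the axis, where any unit normal keeps the map inside the Grassmannian.\<close>

definition slab_haar :: "'a set measure" where
  "slab_haar = distr (uniform_measure lborel (annular_slab u)) GB (\<lambda>x. hyp u (perp_direction x))"

lemma measurable_perp_direction[measurable]: "perp_direction \<in> borel_measurable borel"
  unfolding perp_direction_def[abs_def] by measurable

lemma perp_direction: "perp_direction x \<in> perp_unit"
proof (cases "perp_part u x = 0")
  case True
  then show ?thesis using perp_unit_nonempty by (simp add: perp_direction_def some_in_eq)
next
  case False
  then show ?thesis using perp_part_simps(3)[OF norm_u, of x]
    by (simp add: perp_direction_def perp_unit_def perp_dir_def inner_commute)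
qed

lemma perp_direction_slab: "x \<in> annular_slab u \<Longrightarrow> perp_direction x = perp_dir u x"
  by (auto simp: annular_slab_def perp_direction_def)

lemma measurable_hyp_perp_direction[measurable]: "(\<lambda>x. hyp u (perp_direction x)) \<in> borel \<rightarrow>\<^sub>M GB"
  using perp_direction by (intro measurable_hyp) auto

lemma nn_integral_slab_haar:
  assumes [measurable]: "F \<in> borel_measurable GB"
  shows "(\<integral>\<^sup>+E. F E \<partial>slab_haar) =
    (\<integral>\<^sup>+x. indicator (annular_slab u) x * F (hyp u (perp_dir u x)) \<partial>lborel) / emeasure lborel (annular_slab u)"
proof -
  have "(\<integral>\<^sup>+E. F E \<partial>slab_haar) =
      (\<integral>\<^sup>+x. F (hyp u (perp_direction x)) \<partial>uniform_measure lborel (annular_slab u))"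
    unfolding slab_haar_def by (rule nn_integral_distr) measurable
  also have "\<dots> = (\<integral>\<^sup>+x. F (hyp u (perp_direction x)) * indicator (annular_slab u) x \<partial>lborel) /
      emeasure lborel (annular_slab u)"
    by (rule nn_integral_uniform_measure) measurable
  also have "(\<integral>\<^sup>+x. F (hyp u (perp_direction x)) * indicator (annular_slab u) x \<partial>lborel) =
      (\<integral>\<^sup>+x. indicator (annular_slab u) x * F (hyp u (perp_dir u x)) \<partial>lborel)"
    by (intro nn_integral_cong) (simp add: indicator_def perp_direction_slab)
  finally show ?thesis .
qed

text \<open>An admissible map may reverse \<open>u\<close>; the slab is preserved all the same
  because its height interval is symmetric about 0.\<close>

lemma stabilizes_annular_slab:
  assumes g: "stabilizes g"
  shows "g x \<in> annular_slab u \<longleftrightarrow> x \<in> annular_slab u"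
    "hyp u (perp_dir u (g x)) = g ` hyp u (perp_dir u x)"
proof -
  have o: "orthogonal_transformation g" using g by (simp add: stabilizes_def)
  then have i: "g x \<bullet> g y = x \<bullet> y" for y by (simp add: orthogonal_transformation_def)
  have lg: "linear g" using o orthogonal_transformation_linear by blast
  have ax: "g u = u \<or> g u = - u" by (rule stabilizes_axis[OF g])
  have p: "perp_part u (g x) = g (perp_part u x)"
  proof -
    have "g (perp_part u x) = g x - (g x \<bullet> g u) *\<^sub>R g u"
      by (simp add: perp_part_def linear_diff[OF lg] linear_scale[OF lg] i)
    also have "\<dots> = perp_part u (g x)" using ax by (auto simp: perp_part_def)
    finally show ?thesis by simp
  qed
  have "g x \<bullet> u = x \<bullet> u \<or> g x \<bullet> u = - (x \<bullet> u)" using ax i[of u] by auto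
  then show "g x \<in> annular_slab u \<longleftrightarrow> x \<in> annular_slab u"
    using o by (auto simp: annular_slab_def p orthogonal_transformation_norm)
  have "perp_dir u (g x) = g (perp_dir u x)"
    using o by (simp add: perp_dir_def p linear_scale[OF lg] orthogonal_transformation_norm)
  then show "hyp u (perp_dir u (g x)) = g ` hyp u (perp_dir u x)"
    by (simp add: stabilizes_image_hyp[OF g])
qed

text \<open>Invariance is inherited from Lebesgue measure: moving a set of subspaces by
  \<open>f\<close> amounts to substituting \<open>g x\<close> for \<open>x\<close> in the slab
  integral, where \<open>g\<close> is the inverse of \<open>f\<close>.\<close>

lemma haar_prob_slab_haar: "haar_prob slab_haar"
  unfolding haar_prob_def
proof (intro conjI allI impI ballI)
  have pos: "emeasure lborel (annular_slab u) \<noteq> 0" "emeasure lborel (annular_slab u) \<noteq> \<infinity>"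
    using emeasure_annular_slab_bounds[OF norm_u dim2] by auto
  show sets: "sets slab_haar = sets GB" by (simp add: slab_haar_def)
  have "emeasure slab_haar (space slab_haar) = (\<integral>\<^sup>+E. 1 \<partial>slab_haar)" by simp
  also have "\<dots> = emeasure lborel (annular_slab u) / emeasure lborel (annular_slab u)"
    by (subst nn_integral_slab_haar) simp_all
  also have "\<dots> = 1" using pos by (intro ennreal_divide_self) (auto simp: less_top)
  finally show "emeasure slab_haar (space slab_haar) = 1" .
  fix f A assume f: "stabilizes f" and "A \<in> sets slab_haar"
  then have A[measurable]: "A \<in> sets GB" by (simp add: sets)
  obtain g where g: "stabilizes g" "\<And>x. f (g x) = x" "\<And>x. g (f x) = x" using stabilizes_inverse[OF f] by blast
  have fA[measurable]: "(\<lambda>E. f ` E) ` A \<in> sets GB" by (rule stabilizes_image_sets(1)[OF f A])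
  have em: "emeasure slab_haar B =
      (\<integral>\<^sup>+x. indicator (annular_slab u) x * indicator B (hyp u (perp_direction x)) \<partial>lborel) /
      emeasure lborel (annular_slab u)" if [measurable]: "B \<in> sets GB" for B
  proof -
    have "emeasure slab_haar B = (\<integral>\<^sup>+E. indicator B E \<partial>slab_haar)" by (simp add: sets that)
    also have "\<dots> = (\<integral>\<^sup>+x. indicator (annular_slab u) x * indicator B (hyp u (perp_dir u x)) \<partial>lborel) /
        emeasure lborel (annular_slab u)" by (rule nn_integral_slab_haar) measurable
    also have "(\<integral>\<^sup>+x. indicator (annular_slab u) x * indicator B (hyp u (perp_dir u x)) \<partial>lborel) =
        (\<integral>\<^sup>+x. indicator (annular_slab u) x * indicator B (hyp u (perp_direction x)) \<partial>lborel)"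
      by (intro nn_integral_cong) (simp add: indicator_def perp_direction_slab)
    finally show ?thesis .
  qed
  have "(\<integral>\<^sup>+x. indicator (annular_slab u) x * indicator ((\<lambda>E. f ` E) ` A) (hyp u (perp_direction x)) \<partial>lborel) =
      (\<integral>\<^sup>+x. indicator (annular_slab u) (g x) * indicator A (hyp u (perp_direction (g x))) \<partial>(lborel :: 'a measure))"
  proof (rule nn_integral_cong)
    fix x
    show "(indicator (annular_slab u) x * indicator ((\<lambda>E. f ` E) ` A) (hyp u (perp_direction x)) :: ennreal) =
        indicator (annular_slab u) (g x) * indicator A (hyp u (perp_direction (g x)))"
    proof (cases "x \<in> annular_slab u")
      case True
      then have gx: "g x \<in> annular_slab u" by (simp add: stabilizes_annular_slab(1)[OF g(1)])
      have "hyp u (perp_direction x) \<in> (\<lambda>E. f ` E) ` A \<longleftrightarrow> g ` hyp u (perp_direction x) \<in> A"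
        using stabilizes_image_sets(2)[OF f A g] hyp_in_grassmannian[OF perp_direction] by simp
      also have "g ` hyp u (perp_direction x) = hyp u (perp_direction (g x))"
        using stabilizes_annular_slab(2)[OF g(1)] perp_direction_slab True gx by simp
      finally show ?thesis using True gx by (simp add: indicator_def)
    next
      case False
      then show ?thesis by (simp add: stabilizes_annular_slab(1)[OF g(1)])
    qed
  qed
  also have "\<dots> = (\<integral>\<^sup>+x. indicator (annular_slab u) x * indicator A (hyp u (perp_direction x)) \<partial>lborel)"
    using g(1) by (intro nn_integral_lborel_orthogonal) (simp add: stabilizes_def, measurable)
  finally show "emeasure slab_haar ((\<lambda>E. f ` E) ` A) = emeasure slab_haar A"
    by (simp add: em[OF A] em[OF fA])
qed

lemma grassmannian_haar_eq: "grassmannian_haar ({u}\<^sup>\<bottom>) (DIM('a) - 2) = slab_haar"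
proof -
  have "grassmannian_haar ({u}\<^sup>\<bottom>) (DIM('a) - 2) = (THE \<sigma>. haar_prob \<sigma>)"
    unfolding grassmannian_haar_def haar_prob_def stabilizes_def ..
  also have "\<dots> = slab_haar"
    using haar_prob_slab_haar haar_prob_unique by (intro the_equality) auto
  finally show ?thesis .
qed

text \<open>The average over the slab in \<open>nn_integral_cylindrical\<close> depends on the point
  only through its direction, so it is a Haar average. The sign of \<open>hyp_normal\<close> does
  not matter because the inner double integral is even in the normal.\<close>

lemma nn_integral_haar_cylindrical:
  assumes [measurable]: "f \<in> borel_measurable borel"
  shows "radial_const (DIM('a) - 1) * (\<integral>\<^sup>+x. f x \<partial>lborel) = emeasure lborel (annular_slab u) *
    (\<integral>\<^sup>+E. \<integral>\<^sup>+t. \<integral>\<^sup>+s. ennreal (\<bar>s\<bar> ^ (DIM('a) - 2)) * f (t *\<^sub>R u + s *\<^sub>R hyp_normal E) \<partial>lborel \<partial>lborel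
      \<partial>grassmannian_haar ({u}\<^sup>\<bottom>) (DIM('a) - 2))"
proof -
  let ?\<Phi> = "\<lambda>w. \<integral>\<^sup>+t. \<integral>\<^sup>+s. ennreal (\<bar>s\<bar> ^ (DIM('a) - 2)) * f (t *\<^sub>R u + s *\<^sub>R w) \<partial>lborel \<partial>lborel"
  let ?V = "emeasure lborel (annular_slab u)"
  have even: "?\<Phi> (- w) = ?\<Phi> w" for w
  proof (rule nn_integral_cong)
    fix t
    show "(\<integral>\<^sup>+s. ennreal (\<bar>s\<bar> ^ (DIM('a) - 2)) * f (t *\<^sub>R u + s *\<^sub>R - w) \<partial>lborel) =
        (\<integral>\<^sup>+s. ennreal (\<bar>s\<bar> ^ (DIM('a) - 2)) * f (t *\<^sub>R u + s *\<^sub>R w) \<partial>lborel)"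
      using nn_integral_real_affine[of "\<lambda>s. ennreal (\<bar>s\<bar> ^ (DIM('a) - 2)) * f (t *\<^sub>R u + s *\<^sub>R w)" "-1" 0]
      by simp
  qed
  have V: "?V \<noteq> 0" "?V \<noteq> \<infinity>" using emeasure_annular_slab_bounds[OF norm_u dim2] by auto
  have "(\<integral>\<^sup>+E. ?\<Phi> (hyp_normal E) \<partial>slab_haar) =
      (\<integral>\<^sup>+x. indicator (annular_slab u) x * ?\<Phi> (hyp_normal (hyp u (perp_dir u x))) \<partial>lborel) / ?V"
    by (rule nn_integral_slab_haar) measurable
  also have "(\<integral>\<^sup>+x. indicator (annular_slab u) x * ?\<Phi> (hyp_normal (hyp u (perp_dir u x))) \<partial>lborel) =
      (\<integral>\<^sup>+x. indicator (annular_slab u) x * ?\<Phi> (perp_dir u x) \<partial>lborel)"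
  proof (rule nn_integral_cong)
    fix x
    show "indicator (annular_slab u) x * ?\<Phi> (hyp_normal (hyp u (perp_dir u x))) =
        indicator (annular_slab u) x * ?\<Phi> (perp_dir u x)"
    proof (cases "x \<in> annular_slab u")
      case True
      then have "perp_dir u x \<in> perp_unit" using perp_direction[of x] perp_direction_slab by simp
      from hyp_normal_hyp[OF this] have "?\<Phi> (hyp_normal (hyp u (perp_dir u x))) = ?\<Phi> (perp_dir u x)"
        by (elim disjE) (simp_all only: even)
      then show ?thesis by simp
    qed simp
  qed
  also have "\<dots> = radial_const (DIM('a) - 1) * (\<integral>\<^sup>+x. f x \<partial>lborel)"
    by (rule nn_integral_cylindrical[OF norm_u dim2, symmetric]) measurable
  finally have "?V * (\<integral>\<^sup>+E. ?\<Phi> (hyp_normal E) \<partial>slab_haar) =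
      ?V * (radial_const (DIM('a) - 1) * (\<integral>\<^sup>+x. f x \<partial>lborel) / ?V)" by simp
  also have "\<dots> = radial_const (DIM('a) - 1) * (\<integral>\<^sup>+x. f x \<partial>lborel)"
    using V by (subst ennreal_times_divide, subst mult.commute) (intro mult_divide_eq_ennreal, auto)
  finally show ?thesis by (simp add: grassmannian_haar_eq)
qed


subsection \<open>The rolodex\<close>

text \<open>The normal of \<open>span (insert x E)\<close> inside the plane \<open>E\<^sup>\<bottom>\<close> is \<open>x\<close> turned by a right angle,
  and homogeneity absorbs its length.\<close>

lemma wedge_projection_hyp:
  assumes I: "\<And>c v. lp_projection_integral p K (c *\<^sub>R v) = \<bar>c\<bar> powr p * lp_projection_integral p K v"
    and p: "1 < p" and w: "w \<in> perp_unit"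
  shows "wedge_projection p K (hyp u w) (s *\<^sub>R u + t *\<^sub>R w) =
    lp_projection_integral p K (s *\<^sub>R w - t *\<^sub>R u) powr (1 / p)"
proof -
  let ?E = "hyp u w" and ?x = "s *\<^sub>R u + t *\<^sub>R w"
  note W = perp_unitD[OF w] and uu
  have xE: "?x \<in> ?E\<^sup>\<bottom>" unfolding hyp_orthogonal_comp by (intro span_add span_scale span_base) auto
  have proj: "orth_proj (?E\<^sup>\<bottom>) ?x = ?x"
    using xE subspace_0[OF subspace_orthogonal_comp] by (intro orth_proj_eqI subspace_orthogonal_comp) simp_all
  have xx: "?x \<bullet> ?x = s * s + t * t" by (simp add: inner_add_left inner_add_right W uu)
  show ?thesis
  proof (cases "?x = 0")
    \<comment> \<open>At \<open>x = 0\<close> the chosen normal is arbitrary but is multiplied by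
      norm 0; on the right, homogeneity with factor 0 gives 0.\<close>
    case True
    then have "s * s + t * t = 0" using xx by simp
    then have "s = 0" "t = 0" by (simp_all add: sum_squares_eq_zero_iff)
    moreover have "lp_projection_integral p K 0 = 0" using I[of 0 0] p by simp
    ultimately show ?thesis using proj p by (simp add: wedge_projection_def)
  next
    case False
    define r where "r = norm ?x"
    have r: "0 < r" "r * r = s * s + t * t"
      using False xx by (simp_all add: r_def flip: power2_norm_eq_inner power2_eq_square)
    have normal_iff: "v \<in> (span (insert ?x ?E))\<^sup>\<bottom> \<longleftrightarrow> v \<bullet> ?x = 0 \<and> v \<in> ?E\<^sup>\<bottom>" for v
    proof
      assume "v \<in> (span (insert ?x ?E))\<^sup>\<bottom>"
      then have o: "y \<bullet> v = 0" if "y \<in> insert ?x ?E" for y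
        using span_base[OF that] by (auto simp: orthogonal_comp_def orthogonal_def)
      have "v \<bullet> ?x = 0" using o[of ?x] by (subst inner_commute) blast
      moreover have "v \<in> ?E\<^sup>\<bottom>" using o by (simp add: orthogonal_comp_def orthogonal_def)
      ultimately show "v \<bullet> ?x = 0 \<and> v \<in> ?E\<^sup>\<bottom>" ..
    next
      assume "v \<bullet> ?x = 0 \<and> v \<in> ?E\<^sup>\<bottom>"
      then have "orthogonal v y" if "y \<in> insert ?x ?E" for y
        using that by (auto simp: orthogonal_comp_def orthogonal_def inner_commute)
      then have "orthogonal v y" if "y \<in> span (insert ?x ?E)" for y
        by (rule orthogonal_to_span[OF that])
      then show "v \<in> (span (insert ?x ?E))\<^sup>\<bottom>" by (simp add: orthogonal_comp_def orthogonal_commute)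
    qed
    define v where "v = wedge_normal ?E ?x"
    have "norm v = 1 \<and> v \<in> (span (insert ?x ?E))\<^sup>\<bottom>"
      unfolding v_def wedge_normal_def
    proof (rule someI)
      let ?v = "(1 / r) *\<^sub>R (s *\<^sub>R w - t *\<^sub>R u)"
      have "(s *\<^sub>R w - t *\<^sub>R u) \<bullet> (s *\<^sub>R w - t *\<^sub>R u) = r * r"
        unfolding r(2) by (simp add: inner_diff_left inner_diff_right W uu)
      then have "norm (s *\<^sub>R w - t *\<^sub>R u) = r" using r(1) by (simp add: norm_eq_sqrt_inner)
      then have "norm ?v = 1" using r(1) by simp
      moreover have "?v \<bullet> ?x = 0"
        by (simp add: inner_diff_left inner_add_right W uu)
      moreover have "?v \<in> ?E\<^sup>\<bottom>"
        unfolding hyp_orthogonal_comp by (intro span_scale span_diff span_base) auto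
      ultimately show "norm ?v = 1 \<and> ?v \<in> (span (insert ?x ?E))\<^sup>\<bottom>" by (simp only: normal_iff simp_thms)
    qed
    then have v: "norm v = 1" "v \<bullet> ?x = 0" "v \<in> span {u, w}"
      by (simp_all only: normal_iff hyp_orthogonal_comp)
    obtain a b where ab: "v = a *\<^sub>R u + b *\<^sub>R w"
    proof -
      from v(3) obtain a where "v - a *\<^sub>R u \<in> span {w}" by (auto simp: span_breakdown_eq)
      then obtain b where "v - a *\<^sub>R u = b *\<^sub>R w" unfolding span_singleton by blast
      then have "v = a *\<^sub>R u + b *\<^sub>R w" by (simp add: algebra_simps)
      then show thesis by (rule that)
    qed
    have "v \<bullet> v = 1" using v(1) by (simp add: dot_square_norm)
    then have ab1: "a * a + b * b = 1" unfolding ab by (simp add: inner_add_left inner_add_right W uu)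
    have ab0: "a * s + b * t = 0" using v(2) unfolding ab by (simp add: inner_add_left inner_add_right W uu mult.commute)
    \<comment> \<open>\<open>q\<close> is the inner product of \<open>v\<close> with the turned
      vector \<open>s w - t u\<close>. It equals \<open>r\<close> or \<open>- r\<close>, the sign
      recording which of the two normals was chosen; homogeneity sees only its absolute
      value.\<close>
    define q where "q = b * s - a * t"
    have "q * q = (a * a + b * b) * (s * s + t * t) - (a * s + b * t) * (a * s + b * t)"
      by (simp add: q_def algebra_simps)
    then have "q * q = r * r" using ab0 ab1 r(2) by simp
    then have qr: "\<bar>q\<bar> = r" using r(1) by (auto simp: square_eq_iff)
    have "q * s = b * (s * s + t * t) - t * (a * s + b * t)" "q * t = s * (a * s + b * t) - a * (s * s + t * t)"
      by (simp_all add: q_def algebra_simps)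
    then have qs: "q * s = b * (r * r)" "q * t = - a * (r * r)" using ab0 r(2) by simp_all
    have "q *\<^sub>R (s *\<^sub>R w - t *\<^sub>R u) = (q * s) *\<^sub>R w - (q * t) *\<^sub>R u" by (simp add: algebra_simps)
    also have "\<dots> = (r * r) *\<^sub>R v" unfolding qs ab by (simp add: algebra_simps)
    finally have "\<bar>q\<bar> powr p * lp_projection_integral p K (s *\<^sub>R w - t *\<^sub>R u) =
        \<bar>r * r\<bar> powr p * lp_projection_integral p K v"
      by (simp only: I[symmetric])
    then have "r powr p * lp_projection_integral p K (s *\<^sub>R w - t *\<^sub>R u) =
        r powr p * (r powr p * lp_projection_integral p K v)"
      using r(1) by (simp add: qr powr_mult)
    then have "lp_projection_integral p K (s *\<^sub>R w - t *\<^sub>R u) = r powr p * lp_projection_integral p K v"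
      using r(1) by simp
    then show ?thesis using r(1) p
      by (simp add: wedge_projection_def proj v_def[symmetric] r_def[symmetric] powr_mult powr_powr)
  qed
qed

section \<open>Coordinates on the rolodex and its measure\<close>

abbreviation HM :: "'a set measure" where
  "HM \<equiv> grassmannian_haar ({u}\<^sup>\<bottom>) (DIM('a) - 2)"

abbreviation RS :: "('a set \<times> 'a) measure" where
  "RS \<equiv> restrict_space (GB \<Otimes>\<^sub>M borel) (rolodex_space u)"

definition plane_coord :: "'a set \<Rightarrow> real \<Rightarrow> real \<Rightarrow> 'a" where
  "plane_coord E s t = s *\<^sub>R u + t *\<^sub>R hyp_normal E"

lemma haar_prob_HM: "haar_prob HM"
  using haar_prob_slab_haar by (simp add: grassmannian_haar_eq)

lemma sets_HM: "sets HM = sets GB" and space_HM: "space HM = G"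
  using haar_prob_HM sets_eq_imp_space_eq[of HM GB] by (auto simp: haar_prob_def space_GB)

lemma orthogonal_comp_normal:
  assumes "E \<in> G"
  shows "E\<^sup>\<bottom> = span {u, hyp_normal E}" "E\<^sup>\<bottom> \<inter> {u}\<^sup>\<bottom> = span {hyp_normal E}"
  using hyp_orthogonal_comp[of "hyp_normal E"] hyp_orthogonal_comp_Int[OF hyp_normal(1)[OF assms]]
  by (simp_all add: hyp_normal(2)[OF assms])

lemma plane_coord:
  assumes E: "E \<in> G"
  shows "plane_coord E s t \<in> E\<^sup>\<bottom>" "plane_coord E s t \<bullet> u = s" "plane_coord E s t \<bullet> hyp_normal E = t"
proof -
  show "plane_coord E s t \<in> E\<^sup>\<bottom>"
    unfolding orthogonal_comp_normal(1)[OF E] plane_coord_def by (intro span_add span_scale span_base) auto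
  show "plane_coord E s t \<bullet> u = s" "plane_coord E s t \<bullet> hyp_normal E = t"
    using perp_unitD[OF hyp_normal(1)[OF E]] uu by (simp_all add: plane_coord_def inner_add_left)
qed

lemma plane_coordE:
  assumes E: "E \<in> G" and x: "x \<in> E\<^sup>\<bottom>"
  shows "x = plane_coord E (x \<bullet> u) (x \<bullet> hyp_normal E)"
proof -
  have "x \<in> span {u, hyp_normal E}" using x orthogonal_comp_normal(1)[OF E] by simp
  then obtain a where "x - a *\<^sub>R u \<in> span {hyp_normal E}" by (auto simp: span_breakdown_eq)
  then obtain b where "x - a *\<^sub>R u = b *\<^sub>R hyp_normal E" unfolding span_singleton by blast
  then have "x = plane_coord E a b" by (simp add: plane_coord_def algebra_simps)
  then show ?thesis using plane_coord(2,3)[OF E, of a b] by simp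
qed

lemma space_RS: "space RS = rolodex_space u"
  by (auto simp: space_restrict_space space_pair_measure rolodex_space_def space_GB)

lemma measurable_plane_coord:
  "(\<lambda>(E, s, t). (E, plane_coord E s t)) \<in> GB \<Otimes>\<^sub>M (borel \<Otimes>\<^sub>M borel) \<rightarrow>\<^sub>M RS"
proof (rule measurable_restrict_space2)
  show "(\<lambda>(E, s, t). (E, plane_coord E s t)) \<in> space (GB \<Otimes>\<^sub>M (borel \<Otimes>\<^sub>M borel)) \<rightarrow> rolodex_space u"
    using plane_coord(1) by (auto simp: space_pair_measure space_GB rolodex_space_def)
  show "(\<lambda>(E, s, t). (E, plane_coord E s t)) \<in> GB \<Otimes>\<^sub>M (borel \<Otimes>\<^sub>M borel) \<rightarrow>\<^sub>M GB \<Otimes>\<^sub>M borel"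
    unfolding plane_coord_def by measurable
qed

lemma sets_RS_section:
  assumes A: "A \<in> sets RS" and E: "E \<in> G"
  shows "{x. (E, x) \<in> A} \<in> sets borel"
proof -
  obtain B where B: "B \<in> sets (GB \<Otimes>\<^sub>M (borel :: 'a measure))" "A = rolodex_space u \<inter> B"
    using A by (auto simp: sets_restrict_space)
  have "Pair E -` B \<in> sets (borel :: 'a measure)" using B(1) by (rule sets_Pair1)
  moreover have "E\<^sup>\<bottom> \<in> sets borel" by (intro borel_closed closed_subspace subspace_orthogonal_comp)
  moreover have "{x. (E, x) \<in> A} = Pair E -` B \<inter> E\<^sup>\<bottom>" using E by (auto simp: B(2) rolodex_space_def)
  ultimately show ?thesis by simp
qed

text \<open>The set function is the pushforward of a product measure under the map
  \<open>(E, s, t) \<mapsto> (E, s u + t w(E))\<close> with a measurable choice of the unit vector \<open>w(E)\<close>; hence it is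
  countably additive and \<^const>\<open>rolodex_measure\<close> is not a junk value.\<close>

lemma emeasure_rolodex_measure:
  assumes A: "A \<in> sets RS"
  shows "emeasure (rolodex_measure u) A =
    (\<integral>\<^sup>+E. \<integral>\<^sup>+s. \<integral>\<^sup>+t. ennreal (\<bar>s\<bar> ^ (DIM('a) - 2)) * indicator A (E, plane_coord E s t) \<partial>lborel \<partial>lborel \<partial>HM)"
proof -
  let ?k = "DIM('a) - 2"
  define \<mu> where "\<mu> A = (\<integral>\<^sup>+E. (\<integral>\<^sup>+x. ennreal (\<bar>x \<bullet> u\<bar> ^ ?k) * indicator A (E, x) \<partial>subspace_lebesgue (E\<^sup>\<bottom>)) \<partial>HM)"
    for A :: "('a set \<times> 'a) set"
  have coord: "\<mu> A = (\<integral>\<^sup>+E. \<integral>\<^sup>+s. \<integral>\<^sup>+t. ennreal (\<bar>s\<bar> ^ ?k) * indicator A (E, plane_coord E s t) \<partial>lborel \<partial>lborel \<partial>HM)"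
    if A: "A \<in> sets RS" for A
    unfolding \<mu>_def
  proof (rule nn_integral_cong)
    fix E assume "E \<in> space HM"
    then have E: "E \<in> G" by (simp add: space_HM)
    note w = perp_unitD[OF hyp_normal(1)[OF E]]
    have [measurable]: "{x. (E, x) \<in> A} \<in> sets borel" by (rule sets_RS_section[OF A E])
    have ind: "indicator A (E, x) = (indicator {x. (E, x) \<in> A} x :: ennreal)" for x
      by (simp add: indicator_def)
    have "(\<integral>\<^sup>+x. ennreal (\<bar>x \<bullet> u\<bar> ^ ?k) * indicator A (E, x) \<partial>subspace_lebesgue (E\<^sup>\<bottom>)) =
        (\<integral>\<^sup>+s. \<integral>\<^sup>+t. ennreal (\<bar>(s *\<^sub>R u + t *\<^sub>R hyp_normal E) \<bullet> u\<bar> ^ ?k) *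
          indicator A (E, s *\<^sub>R u + t *\<^sub>R hyp_normal E) \<partial>lborel \<partial>lborel)"
      unfolding orthogonal_comp_normal(1)[OF E] ind
      by (rule nn_integral_subspace_lebesgue_plane[OF norm_u w(4) w(2)]) measurable
    then show "(\<integral>\<^sup>+x. ennreal (\<bar>x \<bullet> u\<bar> ^ ?k) * indicator A (E, x) \<partial>subspace_lebesgue (E\<^sup>\<bottom>)) =
        (\<integral>\<^sup>+s. \<integral>\<^sup>+t. ennreal (\<bar>s\<bar> ^ ?k) * indicator A (E, plane_coord E s t) \<partial>lborel \<partial>lborel)"
      unfolding plane_coord_def[symmetric] plane_coord(2)[OF E] .
  qed
  define Q where "Q = density (HM \<Otimes>\<^sub>M (lborel \<Otimes>\<^sub>M lborel)) (\<lambda>(E, s, t :: real). ennreal (\<bar>s\<bar> ^ ?k))"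
  define \<nu> where "\<nu> = distr Q RS (\<lambda>(E, s, t). (E, plane_coord E s t))"
  have sb: "sets (HM \<Otimes>\<^sub>M (lborel \<Otimes>\<^sub>M lborel)) = sets (GB \<Otimes>\<^sub>M (borel \<Otimes>\<^sub>M (borel :: real measure) :: (real \<times> real) measure))"
    by (intro sets_pair_measure_cong sets_HM) auto
  have mQ: "(\<lambda>(E, s, t). (E, plane_coord E s t)) \<in> Q \<rightarrow>\<^sub>M RS"
  proof -
    have "sets Q = sets (GB \<Otimes>\<^sub>M (borel \<Otimes>\<^sub>M (borel :: real measure) :: (real \<times> real) measure))"
      unfolding Q_def sets_density by (rule sb)
    from measurable_cong_sets[OF this refl] show ?thesis using measurable_plane_coord by blast
  qed
  have \<nu>: "emeasure \<nu> A = \<mu> A" if A: "A \<in> sets RS" for A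
  proof -
    have mA: "(\<lambda>z. indicator A (case z of (E, s, t) \<Rightarrow> (E, plane_coord E s t)) :: ennreal)
        \<in> borel_measurable (HM \<Otimes>\<^sub>M (lborel \<Otimes>\<^sub>M lborel))"
      using measurable_compose[OF measurable_plane_coord borel_measurable_indicator[OF A]]
      by (subst measurable_cong_sets[OF sb refl])
    have mS: "(\<lambda>(E, s, t). ennreal (\<bar>s\<bar> ^ ?k)) \<in> borel_measurable (HM \<Otimes>\<^sub>M (lborel \<Otimes>\<^sub>M (lborel :: real measure)))"
      by measurable
    have R: "sigma_finite_measure (lborel \<Otimes>\<^sub>M lborel :: (real \<times> real) measure)"
      by (simp add: lborel_prod sigma_finite_lborel)
    have "emeasure \<nu> A = (\<integral>\<^sup>+z. indicator A z \<partial>\<nu>)"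
      using A by (simp add: \<nu>_def)
    also have "\<dots> = (\<integral>\<^sup>+z. indicator A (case z of (E, s, t) \<Rightarrow> (E, plane_coord E s t)) \<partial>Q)"
      unfolding \<nu>_def by (rule nn_integral_distr[OF mQ]) (use A in simp)
    also have "\<dots> = (\<integral>\<^sup>+z. (case z of (E, s, t) \<Rightarrow> ennreal (\<bar>s\<bar> ^ ?k)) *
        indicator A (case z of (E, s, t) \<Rightarrow> (E, plane_coord E s t)) \<partial>(HM \<Otimes>\<^sub>M (lborel \<Otimes>\<^sub>M lborel)))"
      unfolding Q_def by (rule nn_integral_density[OF mS mA])
    also have "\<dots> = (\<integral>\<^sup>+E. \<integral>\<^sup>+y. (case (E, y) of (E, s, t) \<Rightarrow> ennreal (\<bar>s\<bar> ^ ?k)) *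
        indicator A (case (E, y) of (E, s, t) \<Rightarrow> (E, plane_coord E s t)) \<partial>(lborel \<Otimes>\<^sub>M lborel) \<partial>HM)"
      by (rule sigma_finite_measure.nn_integral_fst[OF R, symmetric]) (intro borel_measurable_times_ennreal mS mA)
    also have "\<dots> = (\<integral>\<^sup>+E. \<integral>\<^sup>+s. \<integral>\<^sup>+t. ennreal (\<bar>s\<bar> ^ ?k) * indicator A (E, plane_coord E s t) \<partial>lborel \<partial>lborel \<partial>HM)"
    proof (rule nn_integral_cong)
      fix E assume "E \<in> space HM"
      then have E: "E \<in> space HM" .
      have "(\<lambda>y. (case (E, y) of (E, s, t) \<Rightarrow> ennreal (\<bar>s\<bar> ^ ?k)) *
          indicator A (case (E, y) of (E, s, t) \<Rightarrow> (E, plane_coord E s t))) \<in> borel_measurable (lborel \<Otimes>\<^sub>M lborel)"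
        using measurable_compose[OF measurable_Pair1'[OF E] mS] measurable_compose[OF measurable_Pair1'[OF E] mA]
        by (intro borel_measurable_times_ennreal) auto
      then show "(\<integral>\<^sup>+y. (case (E, y) of (E, s, t) \<Rightarrow> ennreal (\<bar>s\<bar> ^ ?k)) *
          indicator A (case (E, y) of (E, s, t) \<Rightarrow> (E, plane_coord E s t)) \<partial>(lborel \<Otimes>\<^sub>M lborel)) =
          (\<integral>\<^sup>+s. \<integral>\<^sup>+t. ennreal (\<bar>s\<bar> ^ ?k) * indicator A (E, plane_coord E s t) \<partial>lborel \<partial>lborel)"
        by (subst lborel.nn_integral_fst[symmetric]) simp_all
    qed
    also have "\<dots> = \<mu> A" by (rule coord[OF A, symmetric])
    finally show ?thesis .
  qed
  have closed: "sets RS \<subseteq> Pow (rolodex_space u)" using sets.space_closed[of RS] by (simp only: space_RS)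
  have "rolodex_measure u = measure_of (rolodex_space u) (sets RS) \<mu>"
    unfolding rolodex_measure_def \<mu>_def ..
  \<comment> \<open>\<open>measure_of\<close> depends on its set function only through the values on
    the sigma-algebra, where these are the values of the measure \<nu>.\<close>
  also have "\<dots> = measure_of (rolodex_space u) (sets RS) (emeasure \<nu>)"
    using \<nu> sets.sigma_sets_eq[of RS] by (intro measure_of_eq[OF closed]) (simp only: space_RS)
  also have "\<dots> = \<nu>"
    using measure_of_of_measure[of \<nu>] by (simp only: \<nu>_def space_distr sets_distr space_RS)
  finally show ?thesis using \<nu>[OF A] coord[OF A] by simp
qed

section \<open>The rolodex of a fixed body in terms of its gauge\<close>

context
  fixes p :: real and K :: "'a set" and g :: "'a \<Rightarrow> real"
  assumes p: "1 < p"
    and hom: "\<And>c v. lp_projection_integral p K (c *\<^sub>R v) = \<bar>c\<bar> powr p * lp_projection_integral p K v"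
    and g_def: "\<And>v. g v = lp_projection_integral p K v powr (1 / p)"
    and g_meas[measurable]: "g \<in> borel_measurable borel"
begin

lemma wedge_projection_plane_coord:
  assumes "E \<in> G"
  shows "wedge_projection p K E (plane_coord E s t) = g (s *\<^sub>R hyp_normal E - t *\<^sub>R u)"
  using wedge_projection_hyp[OF hom p hyp_normal(1)[OF assms], of s t]
  by (simp add: hyp_normal(2)[OF assms] plane_coord_def g_def)

lemma mem_lp_rolodex:
  assumes "E \<in> G"
  shows "(E, plane_coord E s t) \<in> lp_rolodex p K u \<longleftrightarrow> g (s *\<^sub>R hyp_normal E - t *\<^sub>R u) \<le> 1"
  using assms plane_coord(1)[OF assms] wedge_projection_plane_coord[OF assms]
  by (simp add: lp_rolodex_def L_body_def)

text \<open>Recovering the coordinates by inner products with \<open>u\<close> and the normal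
  expresses membership by an inequality that is jointly measurable in \<open>E\<close> and
  \<open>x\<close>.\<close>

lemma sets_lp_rolodex: "lp_rolodex p K u \<in> sets RS"
proof -
  let ?Q = "{z \<in> space (GB \<Otimes>\<^sub>M borel). g ((snd z \<bullet> u) *\<^sub>R hyp_normal (fst z) - (snd z \<bullet> hyp_normal (fst z)) *\<^sub>R u) \<le> 1}"
  have "?Q \<in> sets (GB \<Otimes>\<^sub>M borel)" by measurable
  moreover have "lp_rolodex p K u = rolodex_space u \<inter> ?Q"
  proof (intro equalityI subsetI)
    fix z assume z: "z \<in> lp_rolodex p K u"
    then obtain E x where E: "z = (E, x)" "E \<in> G" "x \<in> E\<^sup>\<bottom>" by (auto simp: lp_rolodex_def L_body_def)
    then show "z \<in> rolodex_space u \<inter> ?Q"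
      using z mem_lp_rolodex[OF E(2), of "x \<bullet> u" "x \<bullet> hyp_normal E"] plane_coordE[OF E(2,3)]
      by (simp add: rolodex_space_def space_pair_measure space_GB)
  next
    fix z assume z: "z \<in> rolodex_space u \<inter> ?Q"
    then obtain E x where E: "z = (E, x)" "E \<in> G" "x \<in> E\<^sup>\<bottom>" by (auto simp: rolodex_space_def)
    then show "z \<in> lp_rolodex p K u"
      using z mem_lp_rolodex[OF E(2), of "x \<bullet> u" "x \<bullet> hyp_normal E"] plane_coordE[OF E(2,3)]
      by simp
  qed
  ultimately show ?thesis by (auto simp: sets_restrict_space)
qed

lemma emeasure_lp_rolodex:
  "emeasure (rolodex_measure u) (lp_rolodex p K u) =
    (\<integral>\<^sup>+E. \<integral>\<^sup>+s. \<integral>\<^sup>+t. ennreal (\<bar>s\<bar> ^ (DIM('a) - 2)) * indicator {x. g x \<le> 1} (s *\<^sub>R hyp_normal E - t *\<^sub>R u)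
      \<partial>lborel \<partial>lborel \<partial>HM)"
  unfolding emeasure_rolodex_measure[OF sets_lp_rolodex]
  by (intro nn_integral_cong) (simp add: indicator_def mem_lp_rolodex space_HM)

lemma emeasure_L_slice:
  assumes E: "E \<in> G"
  shows "emeasure (subspace_lebesgue (E\<^sup>\<bottom> \<inter> {u}\<^sup>\<bottom>)) (L_slice p K E u s) =
    (\<integral>\<^sup>+t. indicator {x. g x \<le> 1} (s *\<^sub>R hyp_normal E - t *\<^sub>R u) \<partial>lborel)"
proof -
  let ?w = "hyp_normal E"
  note w = perp_unitD[OF hyp_normal(1)[OF E]]
  have tw: "t *\<^sub>R ?w \<in> L_slice p K E u s \<longleftrightarrow> g (s *\<^sub>R ?w - t *\<^sub>R u) \<le> 1" for t
  proof -
    have "t *\<^sub>R ?w \<in> E\<^sup>\<bottom> \<inter> {u}\<^sup>\<bottom>"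
      unfolding orthogonal_comp_normal(2)[OF E] by (intro span_scale span_base) simp
    moreover have "t *\<^sub>R ?w + s *\<^sub>R u = plane_coord E s t" by (simp add: plane_coord_def)
    ultimately show ?thesis by (simp add: L_slice_def wedge_projection_plane_coord[OF E])
  qed
  \<comment> \<open>Reading the parameter \<open>t\<close> as \<open>y \<bullet> ?w\<close> exhibits
    the slice as a Borel set.\<close>
  have "L_slice p K E u s = span {?w} \<inter> {y. g (s *\<^sub>R ?w - (y \<bullet> ?w) *\<^sub>R u) \<le> 1}"
  proof (rule set_eqI)
    fix y
    show "y \<in> L_slice p K E u s \<longleftrightarrow> y \<in> span {?w} \<inter> {y. g (s *\<^sub>R ?w - (y \<bullet> ?w) *\<^sub>R u) \<le> 1}"
    proof (cases "y \<in> span {?w}")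
      case True
      then obtain t where t: "y = t *\<^sub>R ?w" unfolding span_singleton by blast
      then have "y \<bullet> ?w = t" by (simp add: w)
      then show ?thesis using True tw[of t] t by (simp add: w)
    next
      case False
      then show ?thesis using orthogonal_comp_normal(2)[OF E] by (auto simp: L_slice_def)
    qed
  qed
  moreover have "span {?w} \<in> sets borel" by (intro borel_closed closed_subspace) simp
  moreover have "{y. g (s *\<^sub>R ?w - (y \<bullet> ?w) *\<^sub>R u) \<le> 1} \<in> sets borel" by measurable
  ultimately have "L_slice p K E u s \<in> sets borel" by simp
  from emeasure_subspace_lebesgue_line[OF w(4) this]
  show ?thesis unfolding orthogonal_comp_normal(2)[OF E] by (simp add: indicator_def tw)
qed

lemma nn_integral_L_slice:
  "(\<integral>\<^sup>+E. (\<integral>\<^sup>+s. ennreal (\<bar>s\<bar> ^ (DIM('a) - 2)) *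
      emeasure (subspace_lebesgue (E\<^sup>\<bottom> \<inter> {u}\<^sup>\<bottom>)) (L_slice p K E u s) \<partial>lborel) \<partial>HM) =
    emeasure (rolodex_measure u) (lp_rolodex p K u)"
  unfolding emeasure_lp_rolodex
proof (rule nn_integral_cong, rule nn_integral_cong)
  fix E s assume "E \<in> space HM"
  then have E: "E \<in> G" by (simp add: space_HM)
  show "ennreal (\<bar>s\<bar> ^ (DIM('a) - 2)) * emeasure (subspace_lebesgue (E\<^sup>\<bottom> \<inter> {u}\<^sup>\<bottom>)) (L_slice p K E u s) =
      (\<integral>\<^sup>+t. ennreal (\<bar>s\<bar> ^ (DIM('a) - 2)) * indicator {x. g x \<le> 1} (s *\<^sub>R hyp_normal E - t *\<^sub>R u) \<partial>lborel)"
    unfolding emeasure_L_slice[OF E] by (rule nn_integral_cmult[symmetric]) measurable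
qed

text \<open>On the rolodex side the weighted coordinate \<open>s\<close> belongs to
  \<open>u\<close>, on the cylindrical side it is the signed distance from the axis; the right-angle
  turn in \<open>wedge_projection_plane_coord\<close> exchanges these roles. What remains is the
  order of integration and the sign of \<open>t\<close>.\<close>

lemma emeasure_gauge_ball:
  "radial_const (DIM('a) - 1) * emeasure lborel {x. g x \<le> 1} =
    emeasure lborel (annular_slab u) * emeasure (rolodex_measure u) (lp_rolodex p K u)"
proof -
  let ?k = "DIM('a) - 2"
  let ?f = "indicator {x. g x \<le> 1} :: 'a \<Rightarrow> ennreal"
  have [measurable]: "{x. g x \<le> 1} \<in> sets borel" by measurable
  have "radial_const (DIM('a) - 1) * emeasure lborel {x. g x \<le> 1} =
      radial_const (DIM('a) - 1) * (\<integral>\<^sup>+x. ?f x \<partial>lborel)" by simp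
  also have "\<dots> = emeasure lborel (annular_slab u) *
      (\<integral>\<^sup>+E. \<integral>\<^sup>+t. \<integral>\<^sup>+s. ennreal (\<bar>s\<bar> ^ ?k) * ?f (t *\<^sub>R u + s *\<^sub>R hyp_normal E) \<partial>lborel \<partial>lborel \<partial>HM)"
    by (rule nn_integral_haar_cylindrical) measurable
  also have "(\<integral>\<^sup>+E. \<integral>\<^sup>+t. \<integral>\<^sup>+s. ennreal (\<bar>s\<bar> ^ ?k) * ?f (t *\<^sub>R u + s *\<^sub>R hyp_normal E) \<partial>lborel \<partial>lborel \<partial>HM) =
      (\<integral>\<^sup>+E. \<integral>\<^sup>+s. \<integral>\<^sup>+t. ennreal (\<bar>s\<bar> ^ ?k) * ?f (s *\<^sub>R hyp_normal E - t *\<^sub>R u) \<partial>lborel \<partial>lborel \<partial>HM)"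
  proof (rule nn_integral_cong)
    fix E
    have "(\<integral>\<^sup>+t. \<integral>\<^sup>+s. ennreal (\<bar>s\<bar> ^ ?k) * ?f (t *\<^sub>R u + s *\<^sub>R hyp_normal E) \<partial>lborel \<partial>lborel) =
        (\<integral>\<^sup>+s. \<integral>\<^sup>+t. ennreal (\<bar>s\<bar> ^ ?k) * ?f (t *\<^sub>R u + s *\<^sub>R hyp_normal E) \<partial>lborel \<partial>lborel)"
      by (rule lborel_pair.Fubini') measurable
    also have "\<dots> = (\<integral>\<^sup>+s. \<integral>\<^sup>+t. ennreal (\<bar>s\<bar> ^ ?k) * ?f (s *\<^sub>R hyp_normal E - t *\<^sub>R u) \<partial>lborel \<partial>lborel)"
    proof (rule nn_integral_cong)
      fix s
      show "(\<integral>\<^sup>+t. ennreal (\<bar>s\<bar> ^ ?k) * ?f (t *\<^sub>R u + s *\<^sub>R hyp_normal E) \<partial>lborel) =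
          (\<integral>\<^sup>+t. ennreal (\<bar>s\<bar> ^ ?k) * ?f (s *\<^sub>R hyp_normal E - t *\<^sub>R u) \<partial>lborel)"
        using nn_integral_real_affine[of "\<lambda>t. ennreal (\<bar>s\<bar> ^ ?k) * ?f (t *\<^sub>R u + s *\<^sub>R hyp_normal E)" "-1" 0]
        by simp
    qed
    finally show "(\<integral>\<^sup>+t. \<integral>\<^sup>+s. ennreal (\<bar>s\<bar> ^ ?k) * ?f (t *\<^sub>R u + s *\<^sub>R hyp_normal E) \<partial>lborel \<partial>lborel) =
        (\<integral>\<^sup>+s. \<integral>\<^sup>+t. ennreal (\<bar>s\<bar> ^ ?k) * ?f (s *\<^sub>R hyp_normal E - t *\<^sub>R u) \<partial>lborel \<partial>lborel)" .
  qed
  finally show ?thesis unfolding emeasure_lp_rolodex .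
qed

end

end

section \<open>Volume of the polar projection body\<close>

lemma
  fixes K :: "'a::euclidean_space set"
  assumes K: "K \<in> convex_bodies_o" and dim: "2 \<le> DIM('a)" and p: "1 < p"
  shows lp_projection_integral_nonneg: "0 \<le> lp_projection_integral p K v"
    and lp_projection_integral_scaleR:
      "lp_projection_integral p K (c *\<^sub>R v) = \<bar>c\<bar> powr p * lp_projection_integral p K v"
    and lp_projection_integral_convex: "convex_on UNIV (lp_projection_integral p K)"
proof -
  have K': "compact K" "convex K" "interior K \<noteq> {}" "0 \<in> interior K" using K by (auto simp: convex_bodies_o_def)
  then have ne: "K \<noteq> {}" using interior_subset by blast
  let ?M = "surface_area_measure K"
  let ?k = "\<lambda>\<theta>. support_function K \<theta> powr (1 - p)"
  have fin: "finite_measure ?M" by (rule finite_measure_surface_area_measure[OF K'(1-3) dim])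
  have [measurable]: "support_function K \<in> borel_measurable borel"
    by (rule borel_measurable_continuous_onI[OF continuous_on_support_function[OF K'(1) ne]])
  have "?k \<in> borel_measurable borel" by measurable
  from measurable_compose[OF measurable_surface_area_measure[of K] this]
  have km: "?k \<in> borel_measurable ?M" .
  obtain r where r: "0 < r" "\<And>\<theta>. norm \<theta> = 1 \<Longrightarrow> r \<le> support_function K \<theta>"
    using support_function_bounded_below[OF K'(1,4)] by blast
  have bd: "0 \<le> ?k \<theta> \<and> ?k \<theta> \<le> r powr (1 - p)" if "\<theta> \<in> space ?M" for \<theta>
    using r(2)[of \<theta>] that r(1) p by (auto simp: space_surface_area_measure intro!: powr_mono2')
  note weight = fin space_surface_area_measure measurable_surface_area_measure km bd p
  show "0 \<le> lp_projection_integral p K v"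
    unfolding lp_projection_integral_def by (rule lp_integral_nonneg[OF weight])
  show "lp_projection_integral p K (c *\<^sub>R v) = \<bar>c\<bar> powr p * lp_projection_integral p K v"
    unfolding lp_projection_integral_def by (rule lp_integral_scaleR[OF weight])
  show "convex_on UNIV (lp_projection_integral p K)"
    unfolding lp_projection_integral_def[abs_def] by (rule lp_integral_convex[OF weight])
qed

text \<open>By homogeneity the factor \<open>d\<close> can be moved inside the projection integral
  as a dilation by \<open>d powr (1 / p)\<close>. Hence the unit ball of the unnormalised gauge is
  the polar body dilated by this number.\<close>

lemma emeasure_lp_polar_projection_body:
  fixes K :: "'a::euclidean_space set"
  assumes K: "K \<in> convex_bodies_o" and dim: "2 \<le> DIM('a)" and p: "1 < p"
  defines "d \<equiv> 1 / (real DIM('a) * unit_ball_vol (real DIM('a)) * c_const (real DIM('a) - 2) p)"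
  shows "0 < d"
    and "ennreal ((d powr (1 / p)) ^ DIM('a)) * emeasure lborel (lp_polar_projection_body p K) =
      emeasure lborel {x. lp_projection_integral p K x powr (1 / p) \<le> 1}"
proof -
  let ?I = "lp_projection_integral p K"
  let ?\<kappa> = "d powr (1 / p)"
  note nn = lp_projection_integral_nonneg[OF K dim p]
  note hom = lp_projection_integral_scaleR[OF K dim p]
  note conv = lp_projection_integral_convex[OF K dim p]
  have e: "real DIM('a) - 2 = real (DIM('a) - 2)" using dim by (simp add: of_nat_diff)
  have "0 < c_const (real DIM('a) - 2) p" unfolding e by (rule c_const_pos[OF p])
  then show d: "0 < d" by (simp add: d_def)
  have "continuous_on UNIV ?I" by (rule convex_on_continuous[OF open_UNIV conv])
  then have [measurable]: "?I \<in> borel_measurable borel" by (rule borel_measurable_continuous_onI)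
  have body: "lp_polar_projection_body p K = {x. (d * ?I x) powr (1 / p) \<le> 1}"
    unfolding lp_polar_projection_body_def lp_projection_body_def d_def[symmetric]
    by (rule polar_body_of_lp_gauge[OF nn hom conv p d])
  have scale: "?I (?\<kappa> *\<^sub>R x) = d * ?I x" for x
    using d p by (simp add: hom powr_powr)
  have [measurable]: "{x. ?I x powr (1 / p) \<le> 1} \<in> sets borel" by measurable
  have "emeasure lborel {x. ?I x powr (1 / p) \<le> 1} = (\<integral>\<^sup>+x. indicator {x. ?I x powr (1 / p) \<le> 1} x \<partial>lborel)"
    by simp
  also have "\<dots> = ennreal (\<bar>?\<kappa>\<bar> ^ DIM('a)) *
      (\<integral>\<^sup>+x. indicator {x. ?I x powr (1 / p) \<le> 1} (0 + ?\<kappa> *\<^sub>R x) \<partial>lborel)"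
    by (rule nn_integral_lborel_affine) (measurable, use d in simp)
  also have "(\<integral>\<^sup>+x. indicator {x. ?I x powr (1 / p) \<le> 1} (0 + ?\<kappa> *\<^sub>R x) \<partial>lborel) =
      (\<integral>\<^sup>+x. indicator (lp_polar_projection_body p K) x \<partial>(lborel :: 'a measure))"
    by (intro nn_integral_cong) (simp add: indicator_def body scale)
  also have "\<dots> = emeasure lborel (lp_polar_projection_body p K)"
    by (intro nn_integral_indicator) (simp add: body)
  finally show "ennreal (?\<kappa> ^ DIM('a)) * emeasure lborel (lp_polar_projection_body p K) =
      emeasure lborel {x. ?I x powr (1 / p) \<le> 1}" by simp
qed

theorem lemma5p2:
  fixes p :: real
  assumes "2 \<le> CARD('n::finite)" and "1 < p"
  shows "\<exists>c::real. 0 \<le> c \<and>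
    (\<forall>K\<in>convex_bodies_o. \<forall>u\<in>sphere (0 :: real ^ 'n) 1.
       emeasure lborel (lp_polar_projection_body p K)
         = ennreal c * emeasure (rolodex_measure u) (lp_rolodex p K u) \<and>
       ennreal c * emeasure (rolodex_measure u) (lp_rolodex p K u)
         = ennreal c *
           (\<integral>\<^sup>+E. (\<integral>\<^sup>+s. ennreal (\<bar>s\<bar> ^ (CARD('n) - 2))
                      * emeasure (subspace_lebesgue (E\<^sup>\<bottom> \<inter> {u}\<^sup>\<bottom>)) (L_slice p K E u s)
                    \<partial>(lborel :: real measure))
              \<partial>grassmannian_haar ({u}\<^sup>\<bottom>) (CARD('n) - 2)))"
proof -
  have dim: "2 \<le> DIM(real ^ 'n)" using assms(1) by simp
  \<comment> \<open>The constant must be fixed before \<open>u\<close> is given, so the slab volume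
    is taken at a reference direction.\<close>
  obtain u0 :: "real ^ 'n" where u0: "norm u0 = 1" using vector_choose_size[of 1] by auto
  define d where "d = 1 / (real DIM(real ^ 'n) * unit_ball_vol (real DIM(real ^ 'n)) *
    c_const (real DIM(real ^ 'n) - 2) p)"
  define V where "V = emeasure lborel (annular_slab u0)"
  define R where "R = radial_const (DIM(real ^ 'n) - 1)"
  define \<kappa> where "\<kappa> = (d powr (1 / p)) ^ DIM(real ^ 'n)"
  have V: "0 < V" "V < \<infinity>" unfolding V_def by (rule emeasure_annular_slab_bounds[OF u0 dim])+
  have R: "0 < R" "R < \<infinity>" unfolding R_def by (rule radial_const_bounds)+
  \<comment> \<open>This solves the two relations \<open>R * vol {g \<le> 1} = V * ?X\<close>, from
    cylindrical coordinates, and \<open>vol {g \<le> 1} = \<kappa> * vol\<close> of the polar body,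
    where \<open>?X\<close> is the measure of the rolodex.\<close>
  define c where "c = enn2real V / enn2real R / \<kappa>"
  show ?thesis
  proof (intro exI[of _ c] conjI ballI)
    show "0 \<le> c" by (simp add: c_def \<kappa>_def)
    fix K :: "(real ^ 'n) set" and u :: "real ^ 'n"
    assume K: "K \<in> convex_bodies_o" and "u \<in> sphere 0 1"
    then have u: "norm u = 1" by simp
    interpret axis u by standard (use u dim in auto)
    let ?I = "lp_projection_integral p K"
    let ?g = "\<lambda>v. ?I v powr (1 / p)"
    have "continuous_on UNIV ?I"
      by (rule convex_on_continuous[OF open_UNIV lp_projection_integral_convex[OF K dim assms(2)]])
    then have [measurable]: "?I \<in> borel_measurable borel" by (rule borel_measurable_continuous_onI)
    have gm: "?g \<in> borel_measurable borel" by measurable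
    note hom = lp_projection_integral_scaleR[OF K dim assms(2)]
    let ?X = "emeasure (rolodex_measure u) (lp_rolodex p K u)"
    have d: "0 < d" and vol: "ennreal \<kappa> * emeasure lborel (lp_polar_projection_body p K) =
        emeasure lborel {x. ?g x \<le> 1}"
      using emeasure_lp_polar_projection_body[OF K dim assms(2)] unfolding d_def \<kappa>_def by blast+
    have \<kappa>: "0 < \<kappa>" using d by (simp add: \<kappa>_def)
    have "R * emeasure lborel {x. ?g x \<le> 1} = V * ?X"
      unfolding R_def V_def emeasure_annular_slab[OF u0 u]
      by (rule emeasure_gauge_ball[OF assms(2) hom refl gm])
    then have eq: "ennreal (enn2real R * \<kappa>) * emeasure lborel (lp_polar_projection_body p K) = ennreal (enn2real V) * ?X"
      using R V \<kappa> by (simp add: ennreal_mult' vol[symmetric] mult.assoc less_top)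
    have R': "0 < enn2real R" using R by (simp add: enn2real_positive_iff)
    then have pos: "0 < enn2real R * \<kappa>" using \<kappa> by simp
    have c: "ennreal c * ?X = ennreal (1 / (enn2real R * \<kappa>)) * (ennreal (enn2real V) * ?X)"
      unfolding c_def using pos
      by (subst mult.assoc[symmetric], subst ennreal_mult'[symmetric]) (auto simp: mult.commute)
    also have "\<dots> = ennreal (1 / (enn2real R * \<kappa>)) *
        (ennreal (enn2real R * \<kappa>) * emeasure lborel (lp_polar_projection_body p K))"
      by (simp only: eq)
    also have "\<dots> = ennreal (1 / (enn2real R * \<kappa>) * (enn2real R * \<kappa>)) * emeasure lborel (lp_polar_projection_body p K)"
      using pos by (subst mult.assoc[symmetric], subst ennreal_mult'[symmetric]) auto
    also have "\<dots> = emeasure lborel (lp_polar_projection_body p K)" using R' \<kappa> by simp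
    finally show "emeasure lborel (lp_polar_projection_body p K) = ennreal c * ?X" by simp
    have "(\<integral>\<^sup>+E. (\<integral>\<^sup>+s. ennreal (\<bar>s\<bar> ^ (CARD('n) - 2)) *
        emeasure (subspace_lebesgue (E\<^sup>\<bottom> \<inter> {u}\<^sup>\<bottom>)) (L_slice p K E u s) \<partial>lborel)
        \<partial>grassmannian_haar ({u}\<^sup>\<bottom>) (CARD('n) - 2)) = ?X"
      using nn_integral_L_slice[OF assms(2) hom refl gm] by simp
    then show "ennreal c * ?X = ennreal c *
        (\<integral>\<^sup>+E. (\<integral>\<^sup>+s. ennreal (\<bar>s\<bar> ^ (CARD('n) - 2)) *
          emeasure (subspace_lebesgue (E\<^sup>\<bottom> \<inter> {u}\<^sup>\<bottom>)) (L_slice p K E u s) \<partial>lborel)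
          \<partial>grassmannian_haar ({u}\<^sup>\<bottom>) (CARD('n) - 2))" by simp
  qed
qed
end
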